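(* Let $\mathbf{X}\subset\mathbb{R}^n$ be a Borel set, let $\mu,\lambda$ be finite positive Borel measures on $\mathbf{X}$ with all moments $\mu_\alpha=\int \mathbf{x}^\alpha d\mu$, $\lambda_\alpha=\int\mathbf{x}^\alpha d\lambda$ ($\alpha\in\mathbb{N}^n$) finite, and assume that both moment sequences $(\mu_\alpha)$ and $(\lambda_\alpha)$ satisfy Carleman's condition. Let $\gamma>0$ be fixed. For every $d\ge1$ let $(\mathbf{y}^d,\mathbf{v}^d,\mathbf{u}^d)$ be an arbitrary optimal solution of the semidefinite program $$\rho_d=\sup_{\mathbf{y},\mathbf{u},\mathbf{v}}\Big\{y_0:\ y_\alpha+v_\alpha=\mu_\alpha,\ \ y_\alpha+u_\alpha=\gamma\lambda_\alpha\ \ (\alpha\in\mathbb{N}^n_{2d});\quad \mathbf{M}_d(\mathbf{y}),\ \mathbf{M}_d(\mathbf{u}),\ \mathbf{M}_d(\mathbf{v})\succeq0\Big\},$$ and, by completing with zeros, consider $\mathbf{y}^d,\mathbf{v}^d,\mathbf{u}^d$ as sequences indexed by $\mathbb{N}^n$ (i.e. as elements of $\mathbb{R}[\mathbf{x}]^*$). Then the sequence of triplets $(\mathbf{y}^d,\mathbf{v}^d,\mathbf{u}^d)_{d}$ converges to some $(\mathbf{y}^*,\mathbf{v}^*,\mathbf{u}^* )\in(\mathbb{R}[\mathbf{x}]^* )^3$ as $d\to\infty$, that is, for every fixed $\alpha\in\mathbb{N}^n$: $$\lim_{d\to\infty}y^d_\alpha=y^*_\alpha;\qquad \lim_{d\to\infty}v^d_\alpha=v^*_\alpha=\mu_\alpha-y^*_\alpha;\qquad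 \lim_{d\to\infty}u^d_\alpha=u^*_\alpha=\gamma\lambda_\alpha-y^*_\alpha.$$ Moreover, $\mathbf{y}^*$ is the vector of moments of the measure $\nu^*_\gamma\le\mu$ which is the unique optimal solution of $$\rho_\gamma=\sup_\nu\{\nu(\mathbf{X}):\ \nu\le\mu,\ \nu\le\gamma\lambda,\ \nu\in M(\mathbf{X})_+\},$$ and which has density $f^*_\gamma=\gamma\wedge f^*\in L_\infty(\mathbf{X},\lambda)$ with respect to $\lambda$, with $\Vert f^*_\gamma\Vert_\infty\le\gamma$, where $f^*\in L_1(\mathbf{X},\lambda)_+$ is the density with respect to $\lambda$ of the absolutely continuous part $\nu^*$ in the Lebesgue decomposition $(\nu^*,\mu-\nu^* )$ of $\mu$ with respect to $\lambda$. Similarly, $\mathbf{v}^*$ is the vector of moments of the measure $\psi^*:=\mu-\nu^*_\gamma$.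
   Context: $\mathbb{N}^n_{k}:=\{\alpha\in\mathbb{N}^n:\sum_i\alpha_i\le k\}$. The variables $\mathbf{y}=(y_\alpha)$, $\mathbf{u}=(u_\alpha)$, $\mathbf{v}=(v_\alpha)$ of the semidefinite program are real vectors indexed by $\alpha\in\mathbb{N}^n_{2d}$. For a real sequence $\mathbf{z}=(z_\alpha)$, the moment matrix $\mathbf{M}_d(\mathbf{z})$ is the real symmetric matrix with rows and columns indexed by $\mathbb{N}^n_d$ and with entry $(\alpha,\beta)$ equal to $z_{\alpha+\beta}$; $\succeq0$ means positive semidefinite. The Riesz functional is $L_{\mathbf{z}}(f)=\sum_\alpha f_\alpha z_\alpha$ for $f=\sum_\alpha f_\alpha\mathbf{x}^\alpha\in\mathbb{R}[\mathbf{x}]$; sequences indexed by $\mathbb{N}^n$ are identified with elements of the algebraic dual $\mathbb{R}[\mathbf{x}]^*$ in this way. A sequence $\mathbf{z}=(z_\alpha)_{\alpha\in\mathbb{N}^n}$ satisfies Carleman's condition if $\sum_{k=1}^\infty L_{\mathbf{z}}(x_i^{2k})^{-1/(2k)}=+\infty$ for all $i=1,\ldots,n$. $M(\mathbf{X})_+$ is the cone of finite positive Borel measures on $\mathbf{X}$; $\nu\le\mu$ means $\nu(B)\le\mu(B)$ for all Borel $B$. The Lebesgue decomposition of $\mu$ with respect to $\lambda$ is $\mu=\nu^*+(\mu-\nu^* )$ with $\nu^*\ll\lambda$ and $\mu-\nu^*\perp\lambda$ (both positive). $(\gamma\wedge f^* )(\mathbf{x})=\min(\gamma,f^*(\mathbf{x}))$,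 and $\Vert\cdot\Vert_\infty$ is the essential supremum norm with respect to $\lambda$. $L_1(\mathbf{X},\lambda)_+$ is the cone of nonnegative elements of $L_1(\mathbf{X},\lambda)$. *)

theory Defs
  imports "HOL-Probability.Essential_Supremum" "HOL-Library.Poly_Mapping"
begin

text \<open>Multi-indices are finitely supported maps \<open>'n \<Rightarrow>\<^sub>0 nat\<close> over a finite index type \<open>'n\<close>,
  and real polynomials are finitely supported maps from multi-indices to coefficients.\<close>

type_synonym 'n mindex = "'n \<Rightarrow>\<^sub>0 nat"
type_synonym 'n mpoly = "'n mindex \<Rightarrow>\<^sub>0 real"

definition mindices_le :: "nat \<Rightarrow> 'n::finite mindex set" where
  "mindices_le k = {\<alpha>. (\<Sum>i\<in>UNIV. Poly_Mapping.lookup \<alpha> i) \<le> k}"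

lemma finite_mindices_le: "finite (mindices_le k :: 'n::finite mindex set)"
proof (rule inj_on_finite[of Poly_Mapping.lookup])
  show "inj_on Poly_Mapping.lookup (mindices_le k :: 'n mindex set)"
    by (simp add: inj_on_def poly_mapping.lookup_inject)
  have "Poly_Mapping.lookup \<alpha> i \<le> k" if "\<alpha> \<in> mindices_le k" for \<alpha> :: "'n mindex" and i
    using that member_le_sum[of i UNIV "Poly_Mapping.lookup \<alpha>"] by (simp add: mindices_le_def)
  then show "Poly_Mapping.lookup ` (mindices_le k :: 'n mindex set) \<subseteq> (UNIV :: 'n set) \<rightarrow>\<^sub>E {..k}"
    by auto
  show "finite ((UNIV :: 'n set) \<rightarrow>\<^sub>E {..k})"
    by (intro finite_PiE) auto
qed

definition monomial :: "'n::finite mindex \<Rightarrow> real ^ 'n \<Rightarrow> real" where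
  "monomial \<alpha> x = (\<Prod>i\<in>UNIV. (x $ i) ^ Poly_Mapping.lookup \<alpha> i)"

definition poly_var :: "'n \<Rightarrow> 'n mpoly" where
  "poly_var i = Poly_Mapping.single (Poly_Mapping.single i 1) 1"

definition riesz :: "('n mindex \<Rightarrow> real) \<Rightarrow> 'n mpoly \<Rightarrow> real" where
  "riesz z f = (\<Sum>\<alpha>\<in>Poly_Mapping.keys f. Poly_Mapping.lookup f \<alpha> * z \<alpha>)"

text \<open>The series is summed in \<open>ennreal\<close>, where \<open>inverse 0 = \<infinity>\<close>: if some \<open>L\<^sub>z(x\<^sub>i\<^sup>2\<^sup>k)\<close> vanishes, its
  term is infinite, as the usual convention for Carleman's condition requires. The index \<open>k\<close>
  is shifted by one.\<close>

definition carleman :: "('n mindex \<Rightarrow> real) \<Rightarrow> bool" where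
  "carleman z \<longleftrightarrow>
    (\<forall>i. suminf (\<lambda>k. inverse (ennreal (root (2 * Suc k) (riesz z (poly_var i ^ (2 * Suc k)))))) = \<infinity>)"

definition psd_on :: "'a set \<Rightarrow> ('a \<Rightarrow> 'a \<Rightarrow> real) \<Rightarrow> bool" where
  "psd_on I A \<longleftrightarrow> (\<forall>a\<in>I. \<forall>b\<in>I. A a b = A b a) \<and>
    (\<forall>c. 0 \<le> (\<Sum>a\<in>I. \<Sum>b\<in>I. c a * A a b * c b))"

definition moment_matrix :: "('n mindex \<Rightarrow> real) \<Rightarrow> 'n mindex \<Rightarrow> 'n mindex \<Rightarrow> real" where
  "moment_matrix z \<alpha> \<beta> = z (\<alpha> + \<beta>)"

text \<open>Vectors indexed by the multi-indices of degree at most \<open>2d\<close> are represented by sequences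
  vanishing at all other multi-indices, so a feasible point is already completed with zeros.
  The arguments \<open>m\<close> and \<open>l\<close> are the moment sequences of \<open>\<mu>\<close> and \<open>\<lambda>\<close>.\<close>

definition sdp_feasible ::
  "('n::finite mindex \<Rightarrow> real) \<Rightarrow> ('n mindex \<Rightarrow> real) \<Rightarrow> real \<Rightarrow> nat \<Rightarrow>
   ('n mindex \<Rightarrow> real) \<times> ('n mindex \<Rightarrow> real) \<times> ('n mindex \<Rightarrow> real) \<Rightarrow> bool" where
  "sdp_feasible m l \<gamma> d = (\<lambda>(y, u, v).
     (\<forall>\<alpha>. \<alpha> \<notin> mindices_le (2 * d) \<longrightarrow> y \<alpha> = 0 \<and> u \<alpha> = 0 \<and> v \<alpha> = 0) \<and>
     (\<forall>\<alpha>\<in>mindices_le (2 * d). y \<alpha> + v \<alpha> = m \<alpha> \<and> y \<alpha> + u \<alpha> = \<gamma> * l \<alpha>) \<and>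
     psd_on (mindices_le d) (moment_matrix y) \<and>
     psd_on (mindices_le d) (moment_matrix u) \<and>
     psd_on (mindices_le d) (moment_matrix v))"

definition sdp_optimal ::
  "('n::finite mindex \<Rightarrow> real) \<Rightarrow> ('n mindex \<Rightarrow> real) \<Rightarrow> real \<Rightarrow> nat \<Rightarrow>
   ('n mindex \<Rightarrow> real) \<times> ('n mindex \<Rightarrow> real) \<times> ('n mindex \<Rightarrow> real) \<Rightarrow> bool" where
  "sdp_optimal m l \<gamma> d = is_arg_max (\<lambda>(y, u, v). y 0) (sdp_feasible m l \<gamma> d)"

definition finite_borel_measures :: "'a::topological_space set \<Rightarrow> 'a measure set" where
  "finite_borel_measures X = {M. sets M = sets (restrict_space borel X) \<and> finite_measure M}"

definition all_moments_finite :: "(real ^ 'n::finite) measure \<Rightarrow> bool" where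
  "all_moments_finite M \<longleftrightarrow> (\<forall>\<alpha>. integrable M (monomial \<alpha>))"

definition moment :: "(real ^ 'n::finite) measure \<Rightarrow> 'n mindex \<Rightarrow> real" where
  "moment M \<alpha> = (LINT x|M. monomial \<alpha> x)"

text \<open>All measures compared below have the same \<open>\<sigma>\<close>-algebra, for which \<open>\<le>\<close> on measures is the
  setwise comparison (see \<open>le_measure\<close>).\<close>

definition measure_optimal :: "'a::topological_space set \<Rightarrow> 'a measure \<Rightarrow> 'a measure \<Rightarrow> real \<Rightarrow> 'a measure \<Rightarrow> bool" where
  "measure_optimal X \<mu> lam \<gamma> = is_arg_max (\<lambda>\<nu>. measure \<nu> X)
     (\<lambda>\<nu>. \<nu> \<in> finite_borel_measures X \<and> \<nu> \<le> \<mu> \<and> \<nu> \<le> scale_measure (ennreal \<gamma>) lam)"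

definition mutually_singular :: "'a measure \<Rightarrow> 'a measure \<Rightarrow> bool" where
  "mutually_singular M N \<longleftrightarrow>
    (\<exists>A\<in>sets M. A \<in> sets N \<and> emeasure M A = 0 \<and> emeasure N (space N - A) = 0)"

definition lebesgue_decomposition :: "'a measure \<Rightarrow> 'a measure \<Rightarrow> 'a measure \<Rightarrow> 'a measure \<Rightarrow> bool" where
  "lebesgue_decomposition \<mu> lam \<nu> \<sigma> \<longleftrightarrow>
    sets \<nu> = sets \<mu> \<and> sets \<sigma> = sets \<mu> \<and>
    (\<forall>B\<in>sets \<mu>. emeasure \<mu> B = emeasure \<nu> B + emeasure \<sigma> B) \<and>
    absolutely_continuous lam \<nu> \<and> mutually_singular \<sigma> lam"

end

theory Submission
  imports Defs "HOL-Probability.Levy" "HOL-Library.Diagonal_Subsequence"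
begin

text \<open>A pointwise limit \<open>z\<close> of \<open>y\<^sup>d\<close> along a subsequence has positive semidefinite moment matrices, and so
  have \<open>\<mu> - z\<close> and \<open>\<gamma>\<lambda> - z\<close>. Hence \<open>L\<^sub>z\<close> is bounded for the norm of \<open>L\<^sub>2(\<mu>)\<close>, and the Riesz representation
  theorem gives \<open>\<phi> \<in> L\<^sub>2(\<mu>)\<close> such that \<open>z\<close> is the moment sequence of \<open>\<phi>\<mu>\<close>. Carleman's condition makes
  polynomials dense in \<open>L\<^sub>2(|\<phi>|\<mu>)\<close>, so that \<open>\<integral>\<phi>p\<^sup>2 d\<mu> \<ge> 0\<close> for all polynomials \<open>p\<close> forces \<open>\<phi> \<ge> 0\<close>; likewise
  \<open>\<phi> \<le> 1\<close>. In the same way \<open>z\<close> is the moment sequence of some \<open>\<psi>\<lambda>\<close> with \<open>0 \<le> \<psi> \<le> \<gamma>\<close>. By determinacy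
  \<open>\<phi>\<mu> = \<psi>\<lambda>\<close> is feasible for the problem on measures, with mass at least \<open>\<rho>\<^sub>\<gamma>\<close> because every feasible
  measure yields a feasible point of each semidefinite program. That problem has a setwise largest
  feasible measure, namely \<open>(\<gamma> \<and> f\<^sup>*)\<lambda>\<close>. So all limit points coincide with its moment sequence.

  Both density and determinacy reduce, one coordinate at a time, to the determinacy of finite measures
  on the line, where Carleman's condition makes the Fourier transform quasi-analytic; this is proved by
  Bang's argument.\<close>

section \<open>Quasi-analyticity\<close>

text \<open>The constraint on \<open>v\<close> closes the first gap: in the limit it says L(p^2)
  \<le> \<integral>p^2 d\<mu>, so a density is present before its sign is known. The sign has to be
  read off squares of polynomials, which is where density of polynomials enters. An element of the
  orthogonal complement is a signed weight, whose positive and negative parts give two measures with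
  equal moments; being merely square integrable, these parts must inherit Carleman's condition from
  \<mu> through Cauchy-Schwarz. Each application doubles the order of a moment, and three of them
  bound a moment of order \<open>k\<close> by the eighth root of one of order \<open>8 * k\<close>:
  this is the origin of all eighth roots. Two densities are needed because \<phi> \<le> 1 controls
  only \<nu> \<le> \<mu> and \<psi> \<le> \<gamma> only \<nu> \<le> \<gamma>\<lambda>.\<close>

lemma carleman_inequality:
  fixes a :: "nat \<Rightarrow> real"
  assumes pos: "\<And>n. a n > 0" and a: "summable a"
  shows "summable (\<lambda>n. (\<Prod>i<Suc n. a i) powr (1 / Suc n))"
proof -
  \<comment> \<open>Polya's weights: the product of the first \<open>n\<close> of them is
    \<open>(n + 1) ^ n\<close>, so the geometric mean of \<open>c i * a i\<close> over
    \<open>i \<le> n\<close> is \<open>n + 2\<close> times that of the \<open>a i\<close>. Dividing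
    by it leaves the telescoping kernel \<open>1 / ((n + 1) * (n + 2))\<close>, while
    \<open>c i / (i + 1)\<close> stays below \<open>exp 1\<close>.\<close>
  define c where "c i = (real i + 2) ^ Suc i / (real i + 1) ^ i" for i
  define b where "b i = c i * a i" for i
  have c_pos: "c i > 0" for i
    by (simp add: c_def)
  have prod_c: "(\<Prod>i<n. c i) = (real n + 1) ^ n" for n
  proof (induction n)
    case (Suc n)
    have "(real n + 1) ^ n \<noteq> 0" by (metis add.commute of_nat_Suc of_nat_neq_0 power_not_zero)
    then have "(real n + 1) ^ n * c n = (real n + 2) ^ Suc n"
      unfolding c_def by simp
    then show ?case by (simp add: Suc.IH add.commute del: power_Suc)
  qed simp
  \<comment> \<open>The kernel is \<open>1 / (m + 1) - 1 / (m + 2)\<close>; the subtracted sum is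
    the contribution of the upper end of the summation, nonnegative and later dropped.\<close>
  have telescope: "(\<Sum>m<N. (\<Sum>i<Suc m. b i) / ((real m + 1) * (real m + 2)))
      = (\<Sum>i<N. b i / (real i + 1)) - (\<Sum>i<N. b i) / (real N + 1)" for N
  proof (induction N)
    case (Suc N)
    have "s / ((x + 1) * (x + 2)) - s' / (x + 1) = y / (x + 1) - s / (x + 2)"
      if "s = s' + y" "x \<ge> 0" for s s' x y :: real
    proof -
      have "s / ((x + 1) * (x + 2)) = s / (x + 1) - s / (x + 2)"
        using that(2) by (simp add: divide_simps) (simp add: algebra_simps)
      then show ?thesis using that(1) by (simp add: add_divide_distrib)
    qed
    from this[of "\<Sum>i<Suc N. b i" "\<Sum>i<N. b i" "b N" "real N"]
    have "(\<Sum>i<Suc N. b i) / ((real N + 1) * (real N + 2)) - (\<Sum>i<N. b i) / (real N + 1)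
        = b N / (real N + 1) - (\<Sum>i<Suc N. b i) / (real N + 2)"
      by simp
    with Suc show ?case
      by (simp add: add.commute)
  qed simp
  have c_le: "c i / (real i + 1) \<le> exp 1" for i
  proof -
    have "c i / (real i + 1) = (1 + 1 / (real i + 1)) ^ Suc i"
    proof -
      have "1 + 1 / (real i + 1) = (real i + 2) / (real i + 1)" by (simp add: field_simps)
      then show ?thesis by (simp add: c_def power_divide field_simps)
    qed
    also have "\<dots> \<le> exp (1 / (real i + 1)) ^ Suc i"
      by (intro power_mono exp_ge_add_one_self) auto
    also have "\<dots> = exp 1"
      by (subst exp_of_nat_mult[symmetric]) (simp add: field_simps)
    finally show ?thesis .
  qed
  have amgm: "(\<Prod>i<Suc n. a i) powr (1 / Suc n) \<le> (\<Sum>i<Suc n. b i) / ((real n + 1) * (real n + 2))" for n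
  proof -
    have "(\<Prod>i<Suc n. b i) powr (1 / Suc n) \<le> (\<Sum>i<Suc n. b i / Suc n)"
      using arith_geom_mean[of "{..<Suc n}" b] pos c_pos
      by (simp add: b_def less_imp_le lessThan_empty_iff)
    moreover have "(\<Prod>i<Suc n. b i) = (real n + 2) ^ Suc n * (\<Prod>i<Suc n. a i)"
      unfolding b_def prod.distrib prod_c by (simp add: add.commute)
    moreover have "((real n + 2) ^ Suc n) powr (1 / Suc n) = real n + 2"
      by (subst powr_realpow[symmetric]) (auto simp: powr_powr simp del: power_Suc)
    moreover have "(\<Prod>i<Suc n. a i) > 0"
      by (intro prod_pos) (auto simp: pos)
    ultimately have "(real n + 2) * (\<Prod>i<Suc n. a i) powr (1 / Suc n) \<le> (\<Sum>i<Suc n. b i) / Suc n"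
      by (simp add: powr_mult sum_divide_distrib del: prod.lessThan_Suc sum.lessThan_Suc power_Suc)
    then have "(\<Prod>i<Suc n. a i) powr (1 / Suc n) \<le> (\<Sum>i<Suc n. b i) / Suc n / (real n + 2)"
      by (subst pos_le_divide_eq) (auto simp: mult.commute)
    then show ?thesis
      by (simp add: add.commute del: prod.lessThan_Suc sum.lessThan_Suc)
  qed
  show ?thesis
  proof (rule summableI_nonneg_bounded)
    fix N
    have "(\<Sum>n<N. (\<Prod>i<Suc n. a i) powr (1 / Suc n))
        \<le> (\<Sum>m<N. (\<Sum>i<Suc m. b i) / ((real m + 1) * (real m + 2)))"
      by (intro sum_mono amgm)
    also have "\<dots> \<le> (\<Sum>i<N. b i / (real i + 1))"
    proof -
      have "0 \<le> (\<Sum>i<N. b i) / (real N + 1)"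
        using pos c_pos by (intro divide_nonneg_nonneg sum_nonneg) (auto simp: b_def intro: less_imp_le)
      then show ?thesis unfolding telescope by linarith
    qed
    also have "\<dots> \<le> (\<Sum>i<N. exp 1 * a i)"
    proof (rule sum_mono)
      fix i
      have "b i / (real i + 1) = c i / (real i + 1) * a i" by (simp add: b_def)
      also have "\<dots> \<le> exp 1 * a i" using c_le pos by (intro mult_right_mono) (auto intro: less_imp_le)
      finally show "b i / (real i + 1) \<le> exp 1 * a i" .
    qed
    also have "\<dots> \<le> exp 1 * suminf a"
      unfolding sum_distrib_left[symmetric]
      using a pos by (intro mult_left_mono sum_le_suminf) (auto intro: less_imp_le)
    finally show "(\<Sum>n<N. (\<Prod>i<Suc n. a i) powr (1 / Suc n)) \<le> exp 1 * suminf a" .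
  qed simp
qed

text \<open>Carleman's condition speaks of roots, whereas Bang's steps have the length of ratios.
  The product of the square roots of consecutive ratios telescopes to
  \<open>sqrt (t 0 / t n)\<close>, so Carleman's inequality bounds the series of roots by the series
  of ratios; \<open>t 0 \<ge> 1\<close> lets the numerator be dropped.\<close>

lemma not_summable_sqrt_ratio:
  fixes t :: "nat \<Rightarrow> real"
  assumes pos: "\<And>n. t n > 0" and t0: "t 0 \<ge> 1"
    and div: "\<not> summable (\<lambda>n. t (Suc n) powr (- 1 / (2 * Suc n)))"
  shows "\<not> summable (\<lambda>n. sqrt (t n / t (Suc n)))"
proof
  assume "summable (\<lambda>n. sqrt (t n / t (Suc n)))"
  then have S: "summable (\<lambda>n. (\<Prod>i<Suc n. sqrt (t i / t (Suc i))) powr (1 / Suc n))"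
    using pos by (intro carleman_inequality) auto
  have prod: "(\<Prod>i<n. sqrt (t i / t (Suc i))) = sqrt (t 0 / t n)" for n
  proof (induction n)
    case 0 then show ?case using pos[of 0] by simp
  next
    case (Suc n)
    then show ?case using pos[of n] by (simp add: real_sqrt_mult[symmetric])
  qed
  have "t (Suc n) powr (- 1 / (2 * Suc n)) \<le> (\<Prod>i<Suc n. sqrt (t i / t (Suc i))) powr (1 / Suc n)" for n
  proof -
    have "t (Suc n) powr (- 1 / (2 * Suc n)) = (1 / t (Suc n)) powr (1 / (2 * Suc n))"
      using pos[of "Suc n"] by (simp add: powr_divide powr_minus_divide)
    also have "\<dots> \<le> (t 0 / t (Suc n)) powr (1 / (2 * Suc n))"
      using t0 pos[of "Suc n"] by (intro powr_mono2) (auto simp: divide_right_mono)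
    also have "\<dots> = (sqrt (t 0 / t (Suc n))) powr (1 / Suc n)"
      using pos[of "Suc n"] pos[of 0] by (simp add: powr_half_sqrt[symmetric] powr_powr)
    finally show ?thesis unfolding prod .
  qed
  then have "summable (\<lambda>n. t (Suc n) powr (- 1 / (2 * Suc n)))"
    by (intro summable_comparison_test'[OF S, of 0]) simp
  with div show False by contradiction
qed

text \<open>Each block of four terms is compared with its first one. The residue 3 fits the later
  use, where a product of four increasing ratios is bounded by the fourth power of the last
  one.\<close>

lemma not_summable_subsample:
  fixes r :: "nat \<Rightarrow> real"
  assumes "\<And>n. r n \<ge> 0" and dec: "decseq r" and "\<not> summable r"
  shows "\<not> summable (\<lambda>k. r (4 * k + 3))"
proof
  assume "summable (\<lambda>k. r (4 * k + 3))"
  then have "summable (\<lambda>k. r (4 * Suc k))"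
    by (rule summable_comparison_test'[of _ 0]) (auto intro!: decseqD[OF dec] simp: assms(1))
  then have S: "summable (\<lambda>k. r (4 * k))"
    by (subst (asm) summable_Suc_iff[of "\<lambda>k. r (4 * k)"])
  have "summable r"
  proof (rule summableI_nonneg_bounded)
    fix N
    have "(\<Sum>n<N. r n) \<le> (\<Sum>n<N*4. r n)"
      by (intro sum_mono2) (auto simp: assms(1))
    also have "\<dots> = (\<Sum>m<N. \<Sum>n = m*4..<m*4+4. r n)"
      by (rule sum.nat_group[symmetric])
    also have "\<dots> \<le> (\<Sum>m<N. 4 * r (4 * m))"
    proof (rule sum_mono)
      fix m
      have "(\<Sum>n = m*4..<m*4+4. r n) \<le> (\<Sum>n = m*4..<m*4+4. r (4 * m))"
        by (intro sum_mono decseqD[OF dec]) auto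
      then show "(\<Sum>n = m*4..<m*4+4. r n) \<le> 4 * r (4 * m)" by simp
    qed
    also have "\<dots> \<le> 4 * suminf (\<lambda>m. r (4 * m))"
      unfolding sum_distrib_left[symmetric]
      by (intro mult_left_mono sum_le_suminf S) (auto simp: assms(1))
    finally show "(\<Sum>n<N. r n) \<le> 4 * suminf (\<lambda>m. r (4 * m))" .
  qed (rule assms(1))
  with assms(3) show False by contradiction
qed

text \<open>Only the Taylor estimate between the members of the family is used, so \<open>F\<close> need not be known to be
  the sequence of derivatives of \<open>F 0\<close>. The proof tracks the bounds \<open>|F k t| \<le> e\<^bsup>k-N\<^esup> M k\<close> for all \<open>k\<close>: they hold
  for every \<open>N\<close> at \<open>0\<close>, and a step of length \<open>M N / (e M (N + 1))\<close> costs one unit of \<open>N\<close>.\<close>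

lemma bang_quasi_analytic:
  fixes F :: "nat \<Rightarrow> real \<Rightarrow> 'a::real_normed_vector" and M :: "nat \<Rightarrow> real"
  assumes M_pos: "\<And>k. M k > 0"
    and ratio_mono: "\<And>k. M (Suc k) / M k \<le> M (Suc (Suc k)) / M (Suc k)"
    and div: "\<not> summable (\<lambda>k. M k / M (Suc k))"
    and bound: "\<And>k t. norm (F k t) \<le> M k"
    and taylor: "\<And>k t s n. norm (F k (t + s) - (\<Sum>j\<le>n. (s ^ j / fact j) *\<^sub>R F (k + j) t))
        \<le> M (k + Suc n) * \<bar>s\<bar> ^ Suc n / fact (Suc n)"
    and zero: "\<And>k. F k 0 = 0"
  shows "F 0 t = 0"
proof -
  define small where "small N t \<longleftrightarrow> (\<forall>k. norm (F k t) \<le> exp (real k - real N) * M k)" for N t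
  \<comment> \<open>The factor \<open>1 / exp 1\<close> keeps
    \<open>exp 1 * \<bar>s\<bar> * M (Suc N) / M N\<close> at most 1, so the Taylor sum is bounded
    by the exponential series at 1, and its value \<open>exp 1\<close> is the unit of
    \<open>N\<close> that is lost.\<close>
  define \<delta> where "\<delta> N = M N / M (Suc N) / exp 1" for N
  have \<delta>_nonneg: "\<delta> i \<ge> 0" for i
    using M_pos[of i] M_pos[of "Suc i"] by (simp add: \<delta>_def)
  have mono: "incseq (\<lambda>k. M (Suc k) / M k)"
    by (rule incseq_SucI) (rule ratio_mono)
  have growth: "M (k + j) \<le> M k * (M (Suc N) / M N) ^ j" if "k + j \<le> Suc N" for k j N
    using that
  proof (induction j)
    case (Suc j)
    have "M (k + Suc j) = M (k + j) * (M (Suc (k + j)) / M (k + j))"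
      using M_pos[of "k + j"] by simp
    also have "\<dots> \<le> M (k + j) * (M (Suc N) / M N)"
      using Suc.prems less_imp_le[OF M_pos[of "k + j"]] by (intro mult_left_mono incseqD[OF mono]) auto
    also have "\<dots> \<le> M k * (M (Suc N) / M N) ^ j * (M (Suc N) / M N)"
      using Suc M_pos[of N] M_pos[of "Suc N"] by (intro mult_right_mono) auto
    finally show ?case by (simp add: ac_simps)
  qed simp
  have step: "small N (t + s)" if small: "small (Suc N) t" and s: "\<bar>s\<bar> \<le> \<delta> N" for N t s
    unfolding small_def
  proof
    fix k
    show "norm (F k (t + s)) \<le> exp (real k - real N) * M k"
    proof (cases "k \<le> N")
      \<comment> \<open>For \<open>k > N\<close> the factor \<open>exp (k - N)\<close> exceeds 1 and
        the uniform bound suffices.\<close>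
      case False
      then have "1 * M k \<le> exp (real k - real N) * M k"
        using M_pos[of k] by (intro mult_right_mono) auto
      then show ?thesis using bound[of k "t + s"] by linarith
    next
      case True
      \<comment> \<open>The expansion stops just before the member of index \<open>N + 1\<close>.
        The remainder then involves \<open>M (N + 1)\<close>, whose weight at level
        \<open>Suc N\<close> is \<open>exp 0\<close>, so it fits in as the next summand.\<close>
      define n where "n = N - k"
      have N: "Suc N = k + Suc n" using True by (simp add: n_def)
      define R where "R = M (Suc N) / M N"
      have R: "R > 0" using M_pos by (simp add: R_def)
      have x: "exp 1 * \<bar>s\<bar> * R \<le> 1"
      proof -
        have "\<bar>s\<bar> * (exp 1 * R) \<le> \<delta> N * (exp 1 * R)" using s R by (intro mult_right_mono) auto
        also have "\<dots> = 1" using M_pos[of N] M_pos[of "Suc N"] by (simp add: \<delta>_def R_def)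
        finally show ?thesis by (simp add: ac_simps)
      qed
      have x0: "0 \<le> exp 1 * \<bar>s\<bar> * R" using R by simp
      have summand: "exp (real (k + j) - real (Suc N)) * M (k + j) * \<bar>s\<bar> ^ j / fact j
          \<le> exp (real k - real (Suc N)) * M k * (1 / fact j)" if "j \<le> Suc n" for j
      proof -
        have "exp (real (k + j) - real (Suc N)) * M (k + j) * \<bar>s\<bar> ^ j / fact j
            \<le> exp (real (k + j) - real (Suc N)) * (M k * R ^ j) * \<bar>s\<bar> ^ j / fact j"
          using growth[of k j N] that N unfolding R_def
          by (intro divide_right_mono mult_right_mono mult_left_mono) auto
        also have "\<dots> = exp (real k - real (Suc N)) * M k * ((exp 1 * \<bar>s\<bar> * R) ^ j / fact j)"
        proof -
          have "exp (real (k + j) - real (Suc N)) = exp (real k - real (Suc N)) * exp 1 ^ j"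
            by (simp add: exp_of_nat_mult[symmetric] exp_add[symmetric] del: of_nat_Suc)
          then show ?thesis by (simp add: power_mult_distrib del: of_nat_Suc)
        qed
        also have "\<dots> \<le> exp (real k - real (Suc N)) * M k * (1 / fact j)"
          using x x0 M_pos[of k] by (intro mult_left_mono divide_right_mono power_le_one) auto
        finally show ?thesis .
      qed
      have "norm (F k (t + s)) \<le> norm (\<Sum>j\<le>n. (s ^ j / fact j) *\<^sub>R F (k + j) t)
          + norm (F k (t + s) - (\<Sum>j\<le>n. (s ^ j / fact j) *\<^sub>R F (k + j) t))"
        by (rule norm_triangle_sub)
      also have "\<dots> \<le> (\<Sum>j\<le>n. exp (real (k + j) - real (Suc N)) * M (k + j) * \<bar>s\<bar> ^ j / fact j)
          + M (k + Suc n) * \<bar>s\<bar> ^ Suc n / fact (Suc n)"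
      proof (intro add_mono taylor order_trans[OF norm_sum] sum_mono)
        fix j
        have "norm ((s ^ j / fact j) *\<^sub>R F (k + j) t) = \<bar>s\<bar> ^ j / fact j * norm (F (k + j) t)"
          by (simp add: power_abs)
        also have "\<dots> \<le> \<bar>s\<bar> ^ j / fact j * (exp (real (k + j) - real (Suc N)) * M (k + j))"
          by (intro mult_left_mono small[unfolded small_def, rule_format]) simp
        finally show "norm ((s ^ j / fact j) *\<^sub>R F (k + j) t)
            \<le> exp (real (k + j) - real (Suc N)) * M (k + j) * \<bar>s\<bar> ^ j / fact j"
          by (simp add: ac_simps)
      qed
      also have "M (k + Suc n) * \<bar>s\<bar> ^ Suc n / fact (Suc n)
          = exp (real (k + Suc n) - real (Suc N)) * M (k + Suc n) * \<bar>s\<bar> ^ Suc n / fact (Suc n)"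
        unfolding N by simp
      also have "(\<Sum>j\<le>n. exp (real (k + j) - real (Suc N)) * M (k + j) * \<bar>s\<bar> ^ j / fact j) + \<dots>
          = (\<Sum>j\<le>Suc n. exp (real (k + j) - real (Suc N)) * M (k + j) * \<bar>s\<bar> ^ j / fact j)"
        by simp
      also have "\<dots> \<le> (\<Sum>j\<le>Suc n. exp (real k - real (Suc N)) * M k * (1 / fact j))"
        by (intro sum_mono summand) simp
      also have "\<dots> = exp (real k - real (Suc N)) * M k * (\<Sum>j<Suc (Suc n). 1 / fact j)"
        unfolding sum_distrib_left lessThan_Suc_atMost ..
      also have "\<dots> \<le> exp (real k - real (Suc N)) * M k * exp 1"
      proof (intro mult_left_mono)
        have "(\<lambda>j. 1 / fact j :: real) sums exp 1"
          using exp_converges[of "1::real"] by (simp add: inverse_eq_divide)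
        then show "(\<Sum>j<Suc (Suc n). 1 / fact j) \<le> (exp 1 :: real)"
          unfolding sums_iff using sum_le_suminf[of "\<lambda>j. 1 / fact j :: real" "{..<Suc (Suc n)}"] by simp
      qed (use M_pos[of k] in auto)
      also have "\<dots> = exp (real k - real N) * M k"
      proof -
        have "exp (real k - real N) = exp (real k - real (Suc N)) * exp 1"
          by (simp add: exp_add[symmetric])
        then show ?thesis by simp
      qed
      finally show ?thesis .
    qed
  qed
  have reach: "small K t" if "\<bar>t\<bar> \<le> (\<Sum>i<m. \<delta> (K + i))" for K m t
    using that
  proof (induction m arbitrary: K t)
    case 0
    then have "t = 0" by simp
    then show ?case
      using M_pos zero unfolding small_def by (auto intro: less_imp_le)
  next
    case (Suc m)
    define D where "D = (\<Sum>i<m. \<delta> (Suc K + i))"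
    have le: "\<bar>t\<bar> \<le> \<delta> K + D"
      using Suc.prems unfolding sum.lessThan_Suc_shift D_def by simp
    have D: "D \<ge> 0" unfolding D_def by (intro sum_nonneg \<delta>_nonneg)
    \<comment> \<open>\<open>t\<close> is clamped to \<open>[- D, D]\<close>: the clamped point is
      within reach of the remaining \<open>m\<close> steps, and what is cut off has length at most
      \<open>\<delta> K\<close>.\<close>
    define t' where "t' = max (- D) (min D t)"
    have "\<bar>t'\<bar> \<le> D" "\<bar>t - t'\<bar> \<le> \<delta> K"
      using D le \<delta>_nonneg[of K] by (auto simp: t'_def)
    with Suc.IH[of t' "Suc K"] step[of K t' "t - t'"] show ?case
      unfolding D_def by simp
  qed
  have all_small: "small K t" for K
  proof -
    \<comment> \<open>Every tail of the step lengths has unbounded partial sums, so each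
      \<open>t\<close> is reached from each level \<open>K\<close>.\<close>
    have "\<not> summable (\<lambda>i. \<delta> (K + i))"
    proof
      assume "summable (\<lambda>i. \<delta> (K + i))"
      then have "summable \<delta>" by (subst (asm) add.commute) (simp add: summable_iff_shift)
      then have "summable (\<lambda>N. \<delta> N * exp 1)" by (rule summable_mult2)
      with div show False by (simp add: \<delta>_def)
    qed
    then have "\<exists>m. \<bar>t\<bar> \<le> (\<Sum>i<m. \<delta> (K + i))"
      using summableI_nonneg_bounded[of "\<lambda>i. \<delta> (K + i)" "\<bar>t\<bar>"] \<delta>_nonneg
      by (meson linear)
    then show ?thesis using reach by blast
  qed
  have "norm (F 0 t) \<le> 0"
  proof (rule tendsto_lowerbound)
    have "(\<lambda>K. exp (- real K)) \<longlonglongrightarrow> 0"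
      by (intro filterlim_compose[OF exp_at_bot] filterlim_uminus_at_bot_at_top[THEN filterlim_compose] 
            filterlim_real_sequentially)
    then show "(\<lambda>K. exp (- real K) * M 0) \<longlonglongrightarrow> 0"
      by (auto intro: tendsto_mult_left_zero)
    show "\<forall>\<^sub>F K in sequentially. norm (F 0 t) \<le> exp (- real K) * M 0"
      using all_small unfolding small_def by (intro always_eventually allI) (metis diff_0 of_nat_0)
  qed simp
  then show ?thesis by simp
qed

section \<open>Determinacy on the line\<close>

text \<open>\<open>G k\<close> is the formal k-th derivative of the Fourier transform of
  \<open>P\<close>. Expanding \<open>iexp (s * x)\<close> under the integral gives the Taylor
  estimate directly, without differentiating under the integral sign, in the shape that
  \<open>bang_quasi_analytic\<close> asks for.\<close>

lemma fourier_moment_taylor: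
  fixes P :: "real measure"
  assumes sets[measurable_cong]: "sets P = sets borel"
    and int: "\<And>k. integrable P (\<lambda>x. x ^ k)"
  defines "G \<equiv> \<lambda>k t. CLINT x|P. (\<i> * of_real x) ^ k * iexp (t * x)"
  shows "cmod (G k t) \<le> (LINT x|P. \<bar>x\<bar> ^ k)"
    and "cmod (G k (t + s) - (\<Sum>j\<le>n. (s ^ j / fact j) *\<^sub>R G (k + j) t))
      \<le> (LINT x|P. \<bar>x\<bar> ^ (k + Suc n)) * \<bar>s\<bar> ^ Suc n / fact (Suc n)"
proof -
  have norm_eq: "cmod ((\<i> * of_real x) ^ k * iexp (t * x)) = \<bar>x\<bar> ^ k" for x t :: real and k
    by (simp add: norm_mult norm_power)
  have int_abs: "integrable P (\<lambda>x. \<bar>x\<bar> ^ k)" for k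
    using integrable_abs[OF int[of k]] by (simp add: power_abs)
  have int_exp: "integrable P (\<lambda>x. (\<i> * of_real x) ^ k * iexp (t * x))" for k t
  proof (rule Bochner_Integration.integrable_bound[OF int_abs[of k]])
    show "AE x in P. cmod ((\<i> * of_real x) ^ k * iexp (t * x)) \<le> norm (\<bar>x\<bar> ^ k)"
      unfolding norm_eq by simp
  qed measurable
  show "cmod (G k t) \<le> (LINT x|P. \<bar>x\<bar> ^ k)"
    unfolding G_def by (rule order_trans[OF integral_norm_bound]) (simp only: norm_eq order_refl)
  have "G k (t + s) - (\<Sum>j\<le>n. (s ^ j / fact j) *\<^sub>R G (k + j) t)
      = (CLINT x|P. (\<i> * of_real x) ^ k * iexp (t * x) * (iexp (s * x) - (\<Sum>j\<le>n. (\<i> * of_real (s * x)) ^ j / fact j)))"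
  proof -
    have "(\<Sum>j\<le>n. (s ^ j / fact j) *\<^sub>R G (k + j) t)
        = (CLINT x|P. (\<Sum>j\<le>n. (s ^ j / fact j) *\<^sub>R ((\<i> * of_real x) ^ (k + j) * iexp (t * x))))"
      unfolding G_def by (subst Bochner_Integration.integral_sum) (rule integrable_scaleR_right int_exp | simp only: integral_scaleR_right)+
    then have "G k (t + s) - (\<Sum>j\<le>n. (s ^ j / fact j) *\<^sub>R G (k + j) t)
        = (CLINT x|P. (\<i> * of_real x) ^ k * iexp ((t + s) * x)
            - (\<Sum>j\<le>n. (s ^ j / fact j) *\<^sub>R ((\<i> * of_real x) ^ (k + j) * iexp (t * x))))"
      unfolding G_def
      by (subst Bochner_Integration.integral_diff)
         (rule int_exp Bochner_Integration.integrable_sum integrable_scaleR_right refl | simp only:)+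
    also have "\<dots> = (CLINT x|P. (\<i> * of_real x) ^ k * iexp (t * x) * (iexp (s * x) - (\<Sum>j\<le>n. (\<i> * of_real (s * x)) ^ j / fact j)))"
    proof (rule Bochner_Integration.integral_cong[OF refl])
      fix x
      have "iexp ((t + s) * x) = iexp (t * x) * iexp (s * x)"
        by (simp add: exp_add[symmetric] ring_distribs)
      moreover have "(s ^ j / fact j) *\<^sub>R ((\<i> * of_real x) ^ (k + j) * iexp (t * x))
          = (\<i> * of_real x) ^ k * iexp (t * x) * ((\<i> * of_real (s * x)) ^ j / fact j)" for j
        by (simp add: scaleR_conv_of_real power_add power_mult_distrib)
      ultimately show "(\<i> * of_real x) ^ k * iexp ((t + s) * x)
            - (\<Sum>j\<le>n. (s ^ j / fact j) *\<^sub>R ((\<i> * of_real x) ^ (k + j) * iexp (t * x)))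
          = (\<i> * of_real x) ^ k * iexp (t * x) * (iexp (s * x) - (\<Sum>j\<le>n. (\<i> * of_real (s * x)) ^ j / fact j))"
        by (simp only: sum_distrib_left right_diff_distrib mult.assoc)
    qed
    finally show ?thesis .
  qed
  also have "cmod \<dots> \<le> (LINT x|P. \<bar>x\<bar> ^ (k + Suc n) * (\<bar>s\<bar> ^ Suc n / fact (Suc n)))"
  proof (rule integral_norm_bound[THEN order_trans], rule integral_mono_AE')
    show "integrable P (\<lambda>x. \<bar>x\<bar> ^ (k + Suc n) * (\<bar>s\<bar> ^ Suc n / fact (Suc n)))"
      by (intro integrable_mult_left int_abs)
    have "cmod ((\<i> * of_real x) ^ k * iexp (t * x) * (iexp (s * x) - (\<Sum>j\<le>n. (\<i> * of_real (s * x)) ^ j / fact j)))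
        \<le> \<bar>x\<bar> ^ k * (\<bar>s * x\<bar> ^ Suc n / fact (Suc n))" for x
      unfolding norm_mult[of "(\<i> * of_real x) ^ k * iexp (t * x)"] norm_eq
      by (intro mult_left_mono iexp_approx1) simp
    then show "AE x in P. cmod ((\<i> * of_real x) ^ k * iexp (t * x) * (iexp (s * x) - (\<Sum>j\<le>n. (\<i> * of_real (s * x)) ^ j / fact j)))
        \<le> \<bar>x\<bar> ^ (k + Suc n) * (\<bar>s\<bar> ^ Suc n / fact (Suc n))"
      by (simp add: abs_mult power_mult_distrib power_add ac_simps)
  qed auto
  also have "\<dots> = (LINT x|P. \<bar>x\<bar> ^ (k + Suc n)) * \<bar>s\<bar> ^ Suc n / fact (Suc n)"
    by (subst integral_mult_left_zero) simp
  finally show "cmod (G k (t + s) - (\<Sum>j\<le>n. (s ^ j / fact j) *\<^sub>R G (k + j) t))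
      \<le> (LINT x|P. \<bar>x\<bar> ^ (k + Suc n)) * \<bar>s\<bar> ^ Suc n / fact (Suc n)" .
qed

text \<open>Levy's uniqueness theorem concerns probability measures. The value of the transform at 0
  is the total mass, so both measures can be divided by the same constant, unless it is 0 and both
  vanish.\<close>

lemma finite_measure_eq_char:
  fixes P Q :: "real measure"
  assumes P: "finite_measure P" "sets P = sets borel" and Q: "finite_measure Q" "sets Q = sets borel"
    and char: "char P = char Q"
  shows "P = Q"
proof -
  interpret P: finite_measure P by fact
  interpret Q: finite_measure Q by fact
  have space: "space P = UNIV" "space Q = UNIV"
    using P(2) Q(2) by (auto dest: sets_eq_imp_space_eq)
  have "char P 0 = char Q 0" by (simp only: char)
  then have mass: "measure P UNIV = measure Q UNIV"
    by (simp add: char_def space)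
  define c where "c = measure P UNIV"
  show ?thesis
  proof (cases "c = 0")
    case True
    have "emeasure P A = 0" "emeasure Q A = 0" for A
      using True mass emeasure_space[of P A] emeasure_space[of Q A]
      by (auto simp: space P.emeasure_eq_measure Q.emeasure_eq_measure c_def)
    then show ?thesis using P(2) Q(2) by (intro measure_eqI) auto
  next
    case False
    then have c: "c > 0" by (simp add: c_def order_less_le)
    define N where "N M = density M (\<lambda>_. ennreal (1 / c))" for M :: "real measure"
    have real_dist: "real_distribution (N M)" "char (N M) t = char M t / c"
      and emeas: "\<And>A. A \<in> sets M \<Longrightarrow> emeasure M A = ennreal c * emeasure (N M) A"
      if M: "finite_measure M" "sets M = sets borel" "measure M UNIV = c" for M t
    proof -
      interpret M: finite_measure M by (rule M)
      have [measurable_cong]: "sets M = sets borel" by (rule M)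
      have sp: "space M = UNIV" using M(2) by (auto dest: sets_eq_imp_space_eq)
      have em: "emeasure (N M) A = ennreal (1 / c) * emeasure M A" if "A \<in> sets M" for A
        using that by (simp add: N_def emeasure_density nn_integral_cmult_indicator)
      have "emeasure (N M) (space (N M)) = 1"
        using c M(3) em[of UNIV] sp by (simp add: N_def M.emeasure_eq_measure ennreal_mult[symmetric] M(2))
      then show "real_distribution (N M)"
        by (auto simp: real_distribution_def real_distribution_axioms_def M N_def intro: prob_spaceI)
      show "char (N M) t = char M t / c"
        unfolding N_def char_def using c by (subst integral_density) (auto simp: scaleR_conv_of_real)
      show "emeasure M A = ennreal c * emeasure (N M) A" if "A \<in> sets M" for A
        using c that by (simp add: em mult.assoc[symmetric] ennreal_mult[symmetric])
    qed
    have "N P = N Q"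
      using real_dist[OF P] real_dist[OF Q] mass char c_def by (intro Levy_uniqueness) auto
    with emeas[OF P] emeas[OF Q] show ?thesis
      using P(2) Q(2) mass c_def by (intro measure_eqI) auto
  qed
qed

text \<open>Bang's argument is applied to the difference of the two Fourier transforms, whose formal
  k-th derivative at 0 is \<open>\<i> ^ k\<close> times the difference of the k-th moments. The
  majorant \<open>M\<close> is left free, since in the applications it stems from a third
  measure.\<close>

lemma moment_determinate_real:
  fixes P Q :: "real measure"
  assumes P: "finite_measure P" "sets P = sets borel" and Q: "finite_measure Q" "sets Q = sets borel"
    and int: "\<And>k. integrable P (\<lambda>x. x ^ k)" "\<And>k. integrable Q (\<lambda>x. x ^ k)"
    and moments: "\<And>k. (LINT x|P. x ^ k) = (LINT x|Q. x ^ k)"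
    and M_pos: "\<And>k. M k > 0"
    and ratio_mono: "\<And>k. M (Suc k) / M k \<le> M (Suc (Suc k)) / M (Suc k)"
    and div: "\<not> summable (\<lambda>k. M k / M (Suc k))"
    and bound: "\<And>k. (LINT x|P. \<bar>x\<bar> ^ k) + (LINT x|Q. \<bar>x\<bar> ^ k) \<le> M k"
  shows "P = Q"
proof -
  define G where "G P k t = (CLINT x|P. (\<i> * of_real x) ^ k * iexp (t * x))" for P :: "real measure" and k t
  define F where "F k t = G P k t - G Q k t" for k t
  note taylorP = fourier_moment_taylor[OF P(2) int(1), folded G_def]
  note taylorQ = fourier_moment_taylor[OF Q(2) int(2), folded G_def]
  have "F 0 t = 0" for t
  proof (rule bang_quasi_analytic[OF M_pos ratio_mono div])
    show "cmod (F k t) \<le> M k" for k t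
      unfolding F_def using taylorP(1)[of k t] taylorQ(1)[of k t] bound[of k]
      by (meson add_mono norm_triangle_ineq4 order_trans)
    show "F k 0 = 0" for k
    proof -
      have "G R k 0 = \<i> ^ k * of_real (LINT x|R. x ^ k)" for R
        by (simp add: G_def power_mult_distrib flip: of_real_power)
      then show ?thesis by (simp add: F_def moments)
    qed
    show "cmod (F k (t + s) - (\<Sum>j\<le>n. (s ^ j / fact j) *\<^sub>R F (k + j) t))
        \<le> M (k + Suc n) * \<bar>s\<bar> ^ Suc n / fact (Suc n)" for k t s n
    proof -
      have "F k (t + s) - (\<Sum>j\<le>n. (s ^ j / fact j) *\<^sub>R F (k + j) t)
          = (G P k (t + s) - (\<Sum>j\<le>n. (s ^ j / fact j) *\<^sub>R G P (k + j) t))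
          - (G Q k (t + s) - (\<Sum>j\<le>n. (s ^ j / fact j) *\<^sub>R G Q (k + j) t))"
        unfolding F_def by (simp add: scaleR_diff_right sum_subtractf)
      also have "cmod \<dots> \<le> (LINT x|P. \<bar>x\<bar> ^ (k + Suc n)) * \<bar>s\<bar> ^ Suc n / fact (Suc n)
          + (LINT x|Q. \<bar>x\<bar> ^ (k + Suc n)) * \<bar>s\<bar> ^ Suc n / fact (Suc n)"
        by (intro order_trans[OF norm_triangle_ineq4] add_mono taylorP(2) taylorQ(2))
      also have "\<dots> = ((LINT x|P. \<bar>x\<bar> ^ (k + Suc n)) + (LINT x|Q. \<bar>x\<bar> ^ (k + Suc n))) * (\<bar>s\<bar> ^ Suc n / fact (Suc n))"
        by (simp add: distrib_right add_divide_distrib del: fact_Suc power_Suc)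
      also have "\<dots> \<le> M (k + Suc n) * (\<bar>s\<bar> ^ Suc n / fact (Suc n))"
        by (intro mult_right_mono bound) simp
      finally show ?thesis by simp
    qed
  qed
  then have "char P = char Q"
    by (intro ext) (simp add: F_def G_def char_def)
  with P Q show ?thesis by (rule finite_measure_eq_char)
qed

section \<open>Carleman's condition for multi-indexed moments\<close>

text \<open>The value at \<open>s = - B / C\<close> gives the claim, and for \<open>C = 0\<close> a
  linear function bounded below has slope 0. With \<open>A = 0\<close> the lemma turns a variational
  inequality into an equation.\<close>

lemma discriminant_le:
  fixes A B C :: real
  assumes "\<And>s. 0 \<le> A + 2 * s * B + s\<^sup>2 * C" and "0 \<le> C"
  shows "B\<^sup>2 \<le> A * C"
proof (cases "C = 0")
  case True
  have "B = 0"
  proof (rule ccontr)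
    assume "B \<noteq> 0"
    then show False
      using assms(1)[of "- (A + 1) / (2 * B)"] by (simp add: True field_simps)
  qed
  then show ?thesis using True by simp
next
  case False
  with assms(2) have C: "C > 0" by simp
  have "0 \<le> A + 2 * (- B / C) * B + (- B / C)\<^sup>2 * C" by (rule assms)
  also have "\<dots> = A - B\<^sup>2 / C" using C by (simp add: power2_eq_square field_simps)
  finally show ?thesis using C by (simp add: field_simps)
qed

lemma integrable_mult_square:
  fixes f g :: "'a \<Rightarrow> real"
  assumes [measurable]: "f \<in> borel_measurable M" "g \<in> borel_measurable M"
    and int: "integrable M (\<lambda>x. (f x)\<^sup>2)" "integrable M (\<lambda>x. (g x)\<^sup>2)"
  shows "integrable M (\<lambda>x. f x * g x)"
proof (rule Bochner_Integration.integrable_bound)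
  show "integrable M (\<lambda>x. (f x)\<^sup>2 + (g x)\<^sup>2)" using int by simp
  have "\<bar>a * b\<bar> \<le> a\<^sup>2 + b\<^sup>2" for a b :: real
    using sum_squares_bound[of "\<bar>a\<bar>" "\<bar>b\<bar>"] mult_nonneg_nonneg[of "\<bar>a\<bar>" "\<bar>b\<bar>"]
    unfolding abs_mult power2_abs by linarith
  then show "AE x in M. norm (f x * g x) \<le> norm ((f x)\<^sup>2 + (g x)\<^sup>2)"
    by simp
qed measurable

lemma Cauchy_Schwarz_integral:
  fixes f g :: "'a \<Rightarrow> real"
  assumes [measurable]: "f \<in> borel_measurable M" "g \<in> borel_measurable M"
    and int: "integrable M (\<lambda>x. (f x)\<^sup>2)" "integrable M (\<lambda>x. (g x)\<^sup>2)"
  shows "(LINT x|M. \<bar>f x\<bar> * \<bar>g x\<bar>)\<^sup>2 \<le> (LINT x|M. (f x)\<^sup>2) * (LINT x|M. (g x)\<^sup>2)"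
proof (rule discriminant_le)
  fix s
  have [simp]: "integrable M (\<lambda>x. \<bar>f x\<bar> * \<bar>g x\<bar>)"
    using int by (intro integrable_mult_square) auto
  have "0 \<le> (LINT x|M. (\<bar>f x\<bar> + s * \<bar>g x\<bar>)\<^sup>2)"
    by simp
  also have "\<dots> = (LINT x|M. (f x)\<^sup>2 + 2 * s * (\<bar>f x\<bar> * \<bar>g x\<bar>) + s\<^sup>2 * (g x)\<^sup>2)"
    by (intro Bochner_Integration.integral_cong) (auto simp: power2_sum power_mult_distrib algebra_simps)
  also have "\<dots> = (LINT x|M. (f x)\<^sup>2) + 2 * s * (LINT x|M. \<bar>f x\<bar> * \<bar>g x\<bar>) + s\<^sup>2 * (LINT x|M. (g x)\<^sup>2)"
    using int by simp
  finally show "0 \<le> (LINT x|M. (f x)\<^sup>2) + 2 * s * (LINT x|M. \<bar>f x\<bar> * \<bar>g x\<bar>) + s\<^sup>2 * (LINT x|M. (g x)\<^sup>2)" .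
qed simp

section \<open>Monomials and moments of measures\<close>

lemma monomial_0 [simp]: "monomial 0 x = 1"
  by (simp add: monomial_def)

lemma monomial_add: "monomial (\<alpha> + \<beta>) x = monomial \<alpha> x * monomial \<beta> x"
  by (simp add: monomial_def lookup_add power_add prod.distrib)

lemma monomial_single [simp]: "monomial (Poly_Mapping.single i k) x = (x $ i) ^ k"
proof -
  have "monomial (Poly_Mapping.single i k) x = (\<Prod>j\<in>UNIV. if j = i then (x $ i) ^ k else 1)"
    unfolding monomial_def by (intro prod.cong) (auto simp: lookup_single when_def)
  then show ?thesis by simp
qed

lemma riesz_poly_var_power: "riesz z (poly_var i ^ m) = z (Poly_Mapping.single i m)"
proof -
  have "poly_var i ^ m = Poly_Mapping.single (Poly_Mapping.single i m) 1"
  proof (induction m)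
    case 0
    show ?case by (simp add: single_one)
  next
    case (Suc m)
    then show ?case by (simp add: poly_var_def mult_single single_add[symmetric])
  qed
  then show ?thesis by (simp add: riesz_def)
qed

context
  fixes M :: "(real ^ 'n::finite) measure"
  assumes finite: "finite_measure M" and moments: "all_moments_finite M"
begin

lemma integrable_monomial: "integrable M (monomial \<alpha>)"
  using moments by (simp add: all_moments_finite_def)

lemma measurable_monomial: "monomial \<alpha> \<in> borel_measurable M"
  using integrable_monomial by (rule borel_measurable_integrable)

lemma measurable_coordinate: "(\<lambda>x. x $ i) \<in> borel_measurable M"
proof -
  have "(\<lambda>x. x $ i) = monomial (Poly_Mapping.single i 1)" by (rule ext) simp
  then show ?thesis by (simp only: measurable_monomial)
qed

lemma integrable_coordinate_power: "integrable M (\<lambda>x. (x $ i) ^ k)"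
proof -
  have "(\<lambda>x. (x $ i) ^ k) = monomial (Poly_Mapping.single i k)" by (rule ext) simp
  then show ?thesis by (simp only: integrable_monomial)
qed

lemma moment_square: "moment M (\<alpha> + \<alpha>) = (LINT x|M. (monomial \<alpha> x)\<^sup>2)"
  by (simp add: moment_def monomial_add power2_eq_square)

lemma moment_square_nonneg: "moment M (\<alpha> + \<alpha>) \<ge> 0"
  by (simp add: moment_square)

lemma integrable_monomial_square: "integrable M (\<lambda>x. (monomial \<alpha> x)\<^sup>2)"
  using integrable_monomial[of "\<alpha> + \<alpha>"]
  by (simp only: monomial_add[abs_def] power2_eq_square)

lemma Cauchy_Schwarz_monomial:
  "(LINT x|M. \<bar>monomial (\<alpha> + \<beta>) x\<bar>)\<^sup>2 \<le> moment M (\<alpha> + \<alpha>) * moment M (\<beta> + \<beta>)"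
  using Cauchy_Schwarz_integral[OF measurable_monomial[of \<alpha>] measurable_monomial[of \<beta>]
      integrable_monomial_square integrable_monomial_square]
  by (simp add: moment_square monomial_add abs_mult)

lemma moment_add_square_le: "(moment M (\<alpha> + \<beta>))\<^sup>2 \<le> moment M (\<alpha> + \<alpha>) * moment M (\<beta> + \<beta>)"
proof -
  have "\<bar>moment M (\<alpha> + \<beta>)\<bar> \<le> (LINT x|M. \<bar>monomial (\<alpha> + \<beta>) x\<bar>)"
    unfolding moment_def by (rule integral_abs_bound)
  from power_mono[OF this, of 2] Cauchy_Schwarz_monomial[of \<alpha> \<beta>] show ?thesis by simp
qed

end

text \<open>The shift by one makes the sequence positive also if the measure lives on a coordinate
  hyperplane; it preserves log-convexity and Carleman's condition.\<close>

definition shifted_moment :: "(real ^ 'n::finite) measure \<Rightarrow> 'n \<Rightarrow> nat \<Rightarrow> real" where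
  "shifted_moment M i n = 1 + moment M (Poly_Mapping.single i (2 * n))"

lemma shifted_moment_eq:
  "shifted_moment M i n = 1 + moment M (Poly_Mapping.single i n + Poly_Mapping.single i n)"
  by (simp add: shifted_moment_def single_add[symmetric] mult_2)

context
  fixes M :: "(real ^ 'n::finite) measure"
  assumes finite: "finite_measure M" and moments: "all_moments_finite M"
begin

lemma shifted_moment_ge_1: "shifted_moment M i n \<ge> 1"
  using moment_square_nonneg[OF finite moments] by (simp add: shifted_moment_eq)

lemma shifted_moment_log_convex:
  "(shifted_moment M i (Suc n))\<^sup>2 \<le> shifted_moment M i n * shifted_moment M i (Suc (Suc n))"
proof -
  \<comment> \<open>The middle moment is split as \<open>n + (n + 2)\<close> rather than
    \<open>(n + 1) + (n + 1)\<close>, so that Cauchy-Schwarz compares it with the even moments of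
    its two neighbours.\<close>
  define a b c where "a = moment M (Poly_Mapping.single i n + Poly_Mapping.single i n)"
    and "b = moment M (Poly_Mapping.single i n + Poly_Mapping.single i (Suc (Suc n)))"
    and "c = moment M (Poly_Mapping.single i (Suc (Suc n)) + Poly_Mapping.single i (Suc (Suc n)))"
  have "b\<^sup>2 \<le> a * c"
    unfolding a_def b_def c_def by (rule moment_add_square_le[OF finite moments])
  moreover have nonneg: "a \<ge> 0" "c \<ge> 0"
    unfolding a_def c_def by (rule moment_square_nonneg[OF finite moments])+
  \<comment> \<open>The shift by one creates the cross term \<open>2 * b\<close>; it is absorbed by
    \<open>a + c\<close> through the arithmetic-geometric mean inequality.\<close>
  moreover have "(2 * b)\<^sup>2 \<le> (a + c)\<^sup>2"
    using \<open>b\<^sup>2 \<le> a * c\<close> sum_squares_bound[of a c] by (simp add: power2_sum power_mult_distrib)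
  then have "2 * b \<le> a + c"
    by (rule power2_le_imp_le) (use nonneg in simp)
  ultimately have "(1 + b)\<^sup>2 \<le> (1 + a) * (1 + c)"
    by (simp add: power2_sum algebra_simps)
  moreover have "shifted_moment M i n = 1 + a" "shifted_moment M i (Suc (Suc n)) = 1 + c"
    "shifted_moment M i (Suc n) = 1 + b"
    by (simp_all add: shifted_moment_def a_def b_def c_def single_add[symmetric] mult_2)
  ultimately show ?thesis by simp
qed

text \<open>Summability would push the terms below 1/2 from some index on. Then
  \<open>1 + s n\<close> is so large that omitting the 1 costs at most a factor 2 in the root, and
  the original Carleman series would converge.\<close>

lemma carleman_not_summable:
  assumes carleman: "carleman (moment M)"
  shows "\<not> summable (\<lambda>n. shifted_moment M i (Suc n) powr (- 1 / (2 * Suc n)))"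
proof
  define s where "s n = moment M (Poly_Mapping.single i (2 * Suc n))" for n
  define f where "f n = (1 + s n) powr (- 1 / (2 * Suc n))" for n
  assume "summable (\<lambda>n. shifted_moment M i (Suc n) powr (- 1 / (2 * Suc n)))"
  then have sum_f: "summable f"
    by (simp add: f_def[abs_def] s_def shifted_moment_def)
  have s_nonneg: "s n \<ge> 0" for n
    using shifted_moment_ge_1[of i "Suc n"] by (simp add: s_def shifted_moment_def)
  have large: "\<exists>N. \<forall>n\<ge>N. f n < 1 / 2"
    using order_tendstoD(2)[OF summable_LIMSEQ_zero[OF sum_f], of "1 / 2"]
    by (simp add: eventually_sequentially)
  \<comment> \<open>A vanishing even moment makes the coordinate zero almost everywhere, so all
    \<open>s m\<close> vanish and \<open>f\<close> is constantly 1, which does not tend to 0. This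
    excludes the infinite terms \<open>inverse 0\<close> of the Carleman series.\<close>
  have s_pos: "s n > 0" for n
  proof (rule ccontr)
    assume "\<not> s n > 0"
    with s_nonneg[of n] have "s n = 0" by simp
    then have "(LINT x|M. (x $ i) ^ (2 * Suc n)) = 0"
      by (simp add: s_def moment_def)
    then have "AE x in M. (x $ i) ^ (2 * Suc n) = 0"
      using integrable_coordinate_power[OF finite moments, of i "2 * Suc n"]
      by (subst (asm) integral_nonneg_eq_0_iff_AE) (auto simp del: mult_Suc_right)
    then have AE0: "AE x in M. x $ i = 0" by (rule eventually_mono) auto
    have "s m = 0" for m
    proof -
      have "s m = (LINT x|M. 0)"
        unfolding s_def moment_def using AE0 integrable_monomial[OF finite moments]
        by (intro integral_cong_AE) (auto intro: borel_measurable_integrable)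
      then show ?thesis by simp
    qed
    then have "f m = 1" for m by (simp add: f_def)
    with large show False by force
  qed
  define r where "r n = inverse (root (2 * Suc n) (s n))" for n
  have r_nonneg: "r n \<ge> 0" for n
    using s_nonneg by (simp add: r_def)
  obtain N where N: "\<And>n. n \<ge> N \<Longrightarrow> f n < 1 / 2"
    using large by blast
  have "summable r"
  proof (rule summable_comparison_test'[where N = N])
    show "summable (\<lambda>n. 2 * f n)" using sum_f by (rule summable_mult)
    fix n assume "n \<ge> N"
    define p where "p = root (2 * Suc n) (1 + s n)"
    have p_pos: "p > 0" using s_nonneg[of n] by (simp add: p_def)
    have f_eq: "f n = inverse p"
      using s_nonneg[of n] by (simp add: f_def p_def root_powr_inverse powr_minus[symmetric] divide_inverse)
    with N[OF \<open>n \<ge> N\<close>] p_pos have "p > 2" by (simp add: field_simps)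
    have p_eq: "p ^ (2 * Suc n) = 1 + s n"
      unfolding p_def using s_nonneg[of n] by (intro real_root_pow_pos2) auto
    \<comment> \<open>\<open>p > 2\<close> forces \<open>1 \<le> s n\<close>, so the added 1 at most
      doubles \<open>s n\<close>, and 2 is below \<open>2 ^ (2 * Suc n)\<close>.\<close>
    have "(p / 2) ^ (2 * Suc n) \<le> s n"
    proof -
      have "p ^ 1 \<le> p ^ (2 * Suc n)" using \<open>p > 2\<close> by (intro power_increasing) auto
      then have "1 \<le> s n" using \<open>p > 2\<close> unfolding p_eq by simp
      have "(2::real) ^ 1 \<le> 2 ^ (2 * Suc n)" by (intro power_increasing) auto
      then have "s n * 2 \<le> s n * 2 ^ (2 * Suc n)" using s_nonneg[of n] by (intro mult_left_mono) auto
      with \<open>1 \<le> s n\<close> have "1 + s n \<le> s n * 2 ^ (2 * Suc n)" by linarith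
      then show ?thesis unfolding power_divide p_eq by (simp add: field_simps del: power_Suc mult_Suc_right)
    qed
    then have "root (2 * Suc n) ((p / 2) ^ (2 * Suc n)) \<le> root (2 * Suc n) (s n)"
      by (intro real_root_le_mono) auto
    then have "p / 2 \<le> root (2 * Suc n) (s n)"
      using p_pos by (subst (asm) real_root_power_cancel) auto
    then have "r n \<le> inverse (p / 2)"
      unfolding r_def using p_pos by (intro le_imp_inverse_le) auto
    then show "norm (r n) \<le> 2 * f n"
      using r_nonneg[of n] by (simp add: f_eq inverse_eq_divide)
  qed
  then have "suminf (\<lambda>n. ennreal (r n)) \<noteq> top"
    using r_nonneg by (intro ennreal_suminf_neq_top) auto
  moreover have "suminf (\<lambda>n. ennreal (r n)) = \<infinity>"
  proof -
    have "ennreal (r n) = inverse (ennreal (root (2 * Suc n) (riesz (moment M) (poly_var i ^ (2 * Suc n)))))" for n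
      unfolding riesz_poly_var_power r_def s_def[symmetric] using s_pos[of n]
      by (subst inverse_ennreal) auto
    then show ?thesis using carleman unfolding carleman_def by simp
  qed
  ultimately show False by simp
qed

text \<open>\<open>R k\<close> measures the size of a moment of order \<open>k\<close> by one of
  order \<open>8 * k\<close>. Its consecutive ratio is the eighth root of a product of four
  increasing ratios \<open>q\<close>, which gives monotonicity. Bounding that product by the fourth
  power of its last factor gives
  \<open>R k / R (Suc k) \<ge> sqrt (inverse (q (4 * k + 3)))\<close>, a subsample of a divergent
  monotone series.\<close>

lemma carleman_root_8:
  fixes i :: 'n
  assumes carleman: "carleman (moment M)" and K: "K > 0"
  defines "R \<equiv> \<lambda>k. root 8 (K * shifted_moment M i (4 * k))"
  shows "R k > 0" "R (Suc k) / R k \<le> R (Suc (Suc k)) / R (Suc k)"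
    and "\<not> summable (\<lambda>k. R k / R (Suc k))"
proof -
  define t where "t = shifted_moment M i"
  define q where "q n = t (Suc n) / t n" for n
  have t_pos: "t n > 0" for n
    using shifted_moment_ge_1[of i n] by (simp add: t_def)
  have q_pos: "q n > 0" for n using t_pos by (simp add: q_def)
  have q_mono: "incseq q"
  proof (rule incseq_SucI)
    fix n show "q n \<le> q (Suc n)"
      using shifted_moment_log_convex[of i n] t_pos[of n] t_pos[of "Suc n"]
      by (simp add: q_def t_def field_simps power2_eq_square)
  qed
  show "R k > 0" for k
    using t_pos[of "4 * k"] K by (simp add: R_def t_def)
  have four: "t (4 * Suc k) / t (4 * k) = q (4 * k) * q (4 * k + 1) * q (4 * k + 2) * q (4 * k + 3)" for k
  proof -
    have e: "4 * Suc k = Suc (Suc (Suc (Suc (4 * k))))" by simp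
    have "t (4 * k) \<noteq> 0" "t (Suc (4 * k)) \<noteq> 0" "t (Suc (Suc (4 * k))) \<noteq> 0" "t (Suc (Suc (Suc (4 * k)))) \<noteq> 0"
      using t_pos by (auto simp: less_le)
    then show ?thesis unfolding e q_def by (simp add: numeral_2_eq_2 numeral_3_eq_3)
  qed
  have ratio: "R (Suc k) / R k = root 8 (q (4 * k) * q (4 * k + 1) * q (4 * k + 2) * q (4 * k + 3))" for k
    unfolding R_def t_def[symmetric] four[symmetric] using K by (simp add: real_root_divide[symmetric])
  show "R (Suc k) / R k \<le> R (Suc (Suc k)) / R (Suc k)"
    unfolding ratio using q_pos
    by (intro real_root_le_mono mult_mono incseqD[OF q_mono]) (auto intro: less_imp_le mult_nonneg_nonneg)
  have "\<not> summable (\<lambda>n. sqrt (t n / t (Suc n)))"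
    using t_pos carleman_not_summable[OF carleman] shifted_moment_ge_1
    by (intro not_summable_sqrt_ratio) (auto simp: t_def)
  moreover have "t n / t (Suc n) = inverse (q n)" for n by (simp add: q_def)
  moreover have "decseq (\<lambda>n. sqrt (inverse (q n)))"
    using incseqD[OF q_mono] q_pos by (auto simp: decseq_def intro!: le_imp_inverse_le)
  ultimately have not_summable: "\<not> summable (\<lambda>k. sqrt (inverse (q (4 * k + 3))))"
    using q_pos by (intro not_summable_subsample) (auto intro: less_imp_le)
  show "\<not> summable (\<lambda>k. R k / R (Suc k))"
  proof
    assume "summable (\<lambda>k. R k / R (Suc k))"
    moreover have "sqrt (inverse (q (4 * k + 3))) \<le> R k / R (Suc k)" for k
    proof -
      have "q (4 * k) * q (4 * k + 1) * q (4 * k + 2) * q (4 * k + 3)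
          \<le> q (4 * k + 3) * q (4 * k + 3) * q (4 * k + 3) * q (4 * k + 3)"
        using q_pos by (intro mult_mono incseqD[OF q_mono]) (auto intro: less_imp_le mult_nonneg_nonneg)
      also have "\<dots> = sqrt (q (4 * k + 3)) ^ 8"
      proof -
        have "q (4 * k + 3) = sqrt (q (4 * k + 3)) ^ 2" using q_pos[of "4 * k + 3"] by simp
        then have "q (4 * k + 3) ^ 4 = (sqrt (q (4 * k + 3)) ^ 2) ^ 4" by (rule arg_cong)
        also have "\<dots> = sqrt (q (4 * k + 3)) ^ 8" by (simp only: power_mult[symmetric]) simp
        finally show ?thesis by (simp add: power4_eq_xxxx)
      qed
      finally have "R (Suc k) / R k \<le> root 8 (sqrt (q (4 * k + 3)) ^ 8)"
        unfolding ratio by (intro real_root_le_mono) auto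
      also have "\<dots> = sqrt (q (4 * k + 3))"
        using q_pos[of "4 * k + 3"] by (intro real_root_power_cancel) auto
      finally have "inverse (sqrt (q (4 * k + 3))) \<le> inverse (R (Suc k) / R k)"
        using \<open>\<And>k. R k > 0\<close> by (intro le_imp_inverse_le) auto
      then show ?thesis by (simp add: real_sqrt_inverse)
    qed
    ultimately have "summable (\<lambda>k. sqrt (inverse (q (4 * k + 3))))"
      using q_pos by (elim summable_comparison_test'[where N = 0]) (simp add: less_imp_le)
    with not_summable show False by contradiction
  qed
qed

end

section \<open>Determinacy in several variables\<close>

text \<open>The fourth power below is what two applications of the Cauchy-Schwarz inequality cost when densities
  are taken in \<open>L\<^sub>2\<close>, see \<open>density_nonneg_of_squares\<close>; separating the coordinate costs one more.\<close>

lemma dominated_root_8: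
  fixes \<nu> \<mu> :: "(real ^ 'n::finite) measure"
  assumes \<mu>: "finite_measure \<mu>" "all_moments_finite \<mu>"
    and dom: "\<And>\<alpha>. (LINT x|\<nu>. \<bar>monomial \<alpha> x\<bar>) ^ 4 \<le> C * moment \<mu> (\<alpha> + \<alpha> + (\<alpha> + \<alpha>))"
  shows "\<exists>K>0. \<forall>k. (LINT x|\<nu>. \<bar>monomial (\<alpha> + Poly_Mapping.single i k) x\<bar>) \<le> root 8 (K * shifted_moment \<mu> i (4 * k))"
proof -
  define \<alpha>4 where "\<alpha>4 = \<alpha> + \<alpha> + (\<alpha> + \<alpha>)"
  \<comment> \<open>Cauchy-Schwarz separates \<open>\<alpha>4\<close> from the power of the
    coordinate, and \<open>C\<close> is squared on the way; the summand 1 keeps \<open>K\<close>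
    positive when the first term vanishes.\<close>
  define K where "K = C\<^sup>2 * moment \<mu> (\<alpha>4 + \<alpha>4) + 1"
  have D: "moment \<mu> (\<alpha>4 + \<alpha>4) \<ge> 0"
    by (rule moment_square_nonneg[OF \<mu>])
  have K: "K > 0" using D by (simp add: K_def add_nonneg_pos)
  have "(LINT x|\<nu>. \<bar>monomial (\<alpha> + Poly_Mapping.single i k) x\<bar>) \<le> root 8 (K * shifted_moment \<mu> i (4 * k))" for k
  proof -
    define I where "I = (LINT x|\<nu>. \<bar>monomial (\<alpha> + Poly_Mapping.single i k) x\<bar>)"
    define s where "s = moment \<mu> (Poly_Mapping.single i (4 * k) + Poly_Mapping.single i (4 * k))"
    have I: "I \<ge> 0" by (simp add: I_def)
    have four: "(\<alpha> + Poly_Mapping.single i k) + (\<alpha> + Poly_Mapping.single i k)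
        + ((\<alpha> + Poly_Mapping.single i k) + (\<alpha> + Poly_Mapping.single i k)) = \<alpha>4 + Poly_Mapping.single i (4 * k)"
    proof -
      have e: "4 * k = k + k + (k + k)" by simp
      show ?thesis unfolding \<alpha>4_def e single_add by (simp add: ac_simps)
    qed
    have I4: "I ^ 4 \<le> C * moment \<mu> (\<alpha>4 + Poly_Mapping.single i (4 * k))"
      using dom[of "\<alpha> + Poly_Mapping.single i k"] unfolding four I_def .
    have "I ^ 8 = (I ^ 4)\<^sup>2" by (simp flip: power_mult)
    also have "\<dots> \<le> (C * moment \<mu> (\<alpha>4 + Poly_Mapping.single i (4 * k)))\<^sup>2"
      using I4 I by (intro power_mono) auto
    also have "\<dots> \<le> C\<^sup>2 * (moment \<mu> (\<alpha>4 + \<alpha>4) * s)"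
      unfolding power_mult_distrib s_def by (intro mult_left_mono moment_add_square_le \<mu>) auto
    also have "\<dots> \<le> K * (1 + s)"
    proof -
      have "s \<ge> 0" unfolding s_def by (rule moment_square_nonneg[OF \<mu>])
      then show ?thesis using D by (simp add: K_def algebra_simps)
    qed
    also have "1 + s = shifted_moment \<mu> i (4 * k)"
      unfolding s_def shifted_moment_eq ..
    finally have "root 8 (I ^ 8) \<le> root 8 (K * shifted_moment \<mu> i (4 * k))"
      by (intro real_root_le_mono) auto
    then show ?thesis using I by (simp add: I_def[symmetric] real_root_power_cancel)
  qed
  with K show ?thesis by blast
qed

text \<open>Carleman's condition is imposed on \<open>\<mu>\<close> and reaches
  \<open>\<nu>1\<close> and \<open>\<nu>2\<close> through \<open>dom1\<close> and
  \<open>dom2\<close>. These compare all absolute moments, including odd ones, with moments whose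
  exponents are multiples of four.\<close>

locale carleman_dominated =
  fixes \<nu>1 \<nu>2 \<mu> :: "(real ^ 'n::finite) measure" and C :: real
  assumes sets_eq: "sets \<nu>1 = sets \<nu>2"
    and \<nu>1: "finite_measure \<nu>1" "all_moments_finite \<nu>1"
    and \<nu>2: "finite_measure \<nu>2" "all_moments_finite \<nu>2"
    and \<mu>: "finite_measure \<mu>" "all_moments_finite \<mu>" "carleman (moment \<mu>)"
    and moment_eq: "moment \<nu>1 = moment \<nu>2"
    and dom1: "\<And>\<alpha>. (LINT x|\<nu>1. \<bar>monomial \<alpha> x\<bar>) ^ 4 \<le> C * moment \<mu> (\<alpha> + \<alpha> + (\<alpha> + \<alpha>))"
    and dom2: "\<And>\<alpha>. (LINT x|\<nu>2. \<bar>monomial \<alpha> x\<bar>) ^ 4 \<le> C * moment \<mu> (\<alpha> + \<alpha> + (\<alpha> + \<alpha>))"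
begin

text \<open>The weighted measures are projected to one coordinate, where by hypothesis they have
  equal moments. As \<open>w\<close> is bounded by a polynomial in a single even monomial,
  \<open>dominated_root_8\<close> at the multi-indices 0 and \<open>\<alpha> + \<alpha>\<close>
  controls the absolute moments of the projections, and determinacy on the line applies.\<close>

lemma weighted_marginal_eq:
  fixes w :: "real ^ 'n \<Rightarrow> real"
  assumes meas: "w \<in> borel_measurable \<nu>1"
    and w: "\<And>x. 0 \<le> w x" "\<And>x. w x \<le> 2 * (1 + monomial (\<alpha> + \<alpha>) x)"
    and eq: "\<And>k. (LINT x|\<nu>1. w x * (x $ j) ^ k) = (LINT x|\<nu>2. w x * (x $ j) ^ k)"
  shows "(LINT x|\<nu>1. w x * indicator {..a} (x $ j)) = (LINT x|\<nu>2. w x * indicator {..a} (x $ j))"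
proof -
  define P where "P \<nu> = distr (density \<nu> (\<lambda>x. ennreal (w x))) borel (\<lambda>x. x $ j)" for \<nu> :: "(real ^ 'n) measure"
  define t where "t = shifted_moment \<mu> j"
  note root_8 = dominated_root_8[OF \<mu>(1,2), of _ C _ j]
  have props: "finite_measure (P \<nu>)" "integrable (P \<nu>) (\<lambda>x. x ^ k)"
      "(LINT x|P \<nu>. f x) = (LINT x|\<nu>. w x * f (x $ j))"
      "\<exists>K>0. \<forall>k. (LINT x|P \<nu>. \<bar>x\<bar> ^ k) \<le> 4 * root 8 (K * t (4 * k))"
    if \<nu>: "finite_measure \<nu>" "all_moments_finite \<nu>" and wm[measurable]: "w \<in> borel_measurable \<nu>"
      and dom: "\<And>\<alpha>. (LINT x|\<nu>. \<bar>monomial \<alpha> x\<bar>) ^ 4 \<le> C * moment \<mu> (\<alpha> + \<alpha> + (\<alpha> + \<alpha>))"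
      and f[measurable]: "f \<in> borel_measurable borel"
    for \<nu> and f :: "real \<Rightarrow> real" and k
  proof -
    have xj[measurable]: "(\<lambda>x. x $ j) \<in> borel_measurable \<nu>"
      by (rule measurable_coordinate[OF \<nu>])
    have [measurable]: "(\<lambda>x. x $ j) \<in> borel_measurable (density \<nu> (\<lambda>x. ennreal (w x)))"
      by simp
    have sum_bound: "integrable \<nu> (\<lambda>x. 2 * (\<bar>monomial (0 + Poly_Mapping.single j k) x\<bar> + \<bar>monomial (\<alpha> + \<alpha> + Poly_Mapping.single j k) x\<bar>))" for k
      using integrable_monomial[OF \<nu>] by (intro integrable_mult_right Bochner_Integration.integrable_add integrable_abs)
    have pointwise: "w x * \<bar>x $ j\<bar> ^ k \<le> 2 * (\<bar>monomial (0 + Poly_Mapping.single j k) x\<bar> + \<bar>monomial (\<alpha> + \<alpha> + Poly_Mapping.single j k) x\<bar>)" for k x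
    proof -
      have "w x * \<bar>x $ j\<bar> ^ k \<le> 2 * (1 + monomial (\<alpha> + \<alpha>) x) * \<bar>x $ j\<bar> ^ k"
        by (intro mult_right_mono w) simp
      also have "monomial (\<alpha> + \<alpha>) x \<ge> 0" by (simp add: monomial_add)
      then have "2 * (1 + monomial (\<alpha> + \<alpha>) x) * \<bar>x $ j\<bar> ^ k
          = 2 * (\<bar>monomial (0 + Poly_Mapping.single j k) x\<bar> + \<bar>monomial (\<alpha> + \<alpha> + Poly_Mapping.single j k) x\<bar>)"
        unfolding monomial_add[of "\<alpha> + \<alpha>"] abs_mult by (simp add: power_abs distrib_left distrib_right)
      finally show ?thesis .
    qed
    have int_w: "integrable \<nu> (\<lambda>x. w x * (x $ j) ^ k)" for k
      by (rule Bochner_Integration.integrable_bound[OF sum_bound[of k]])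
         (use pointwise[of _ k] w(1) in \<open>auto simp: abs_mult power_abs\<close>)
    have int_w_abs: "integrable \<nu> (\<lambda>x. w x * \<bar>x $ j\<bar> ^ k)" for k
      using integrable_abs[OF int_w[of k]] w(1) by (simp add: abs_mult power_abs)
    show "finite_measure (P \<nu>)"
    proof (rule finite_measureI)
      have "emeasure (P \<nu>) (space (P \<nu>)) = (\<integral>\<^sup>+x. ennreal (w x) \<partial>\<nu>)"
        by (auto simp: P_def emeasure_distr emeasure_density intro!: nn_integral_cong split: split_indicator)
      also have "\<dots> < \<infinity>"
        using int_w[of 0] w(1) by (simp add: nn_integral_eq_integral)
      finally show "emeasure (P \<nu>) (space (P \<nu>)) \<noteq> \<infinity>" by simp
    qed
    show "integrable (P \<nu>) (\<lambda>x. x ^ k)"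
      unfolding P_def using w(1) int_w[of k]
      by (subst integrable_distr_eq) (auto simp: integrable_density)
    have LINT_P: "(LINT x|P \<nu>. g x) = (LINT x|\<nu>. w x * g (x $ j))"
      if [measurable]: "g \<in> borel_measurable borel" for g :: "real \<Rightarrow> real"
      unfolding P_def using w(1) by (subst integral_distr) (auto simp: integral_density)
    from LINT_P[OF f] show "(LINT x|P \<nu>. f x) = (LINT x|\<nu>. w x * f (x $ j))" .
    obtain K1 where K1: "K1 > 0"
      "\<And>k. (LINT x|\<nu>. \<bar>monomial (0 + Poly_Mapping.single j k) x\<bar>) \<le> root 8 (K1 * t (4 * k))"
      using root_8[of \<nu> 0, OF dom] unfolding t_def by blast
    obtain K2 where K2: "K2 > 0"
      "\<And>k. (LINT x|\<nu>. \<bar>monomial (\<alpha> + \<alpha> + Poly_Mapping.single j k) x\<bar>) \<le> root 8 (K2 * t (4 * k))"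
      using root_8[of \<nu> "\<alpha> + \<alpha>", OF dom] unfolding t_def by blast
    \<comment> \<open>The factor 4 is the 2 from the bound on \<open>w\<close> times the two
      monomials.\<close>
    have "(LINT x|P \<nu>. \<bar>x\<bar> ^ k) \<le> 4 * root 8 ((K1 + K2) * t (4 * k))" for k
    proof -
      have t: "t (4 * k) \<ge> 0"
        unfolding t_def using shifted_moment_ge_1[OF \<mu>(1,2), of j "4 * k"] by simp
      have "(LINT x|P \<nu>. \<bar>x\<bar> ^ k) = (LINT x|\<nu>. w x * \<bar>x $ j\<bar> ^ k)"
        by (rule LINT_P) measurable
      also have "\<dots> \<le> (LINT x|\<nu>. 2 * (\<bar>monomial (0 + Poly_Mapping.single j k) x\<bar> + \<bar>monomial (\<alpha> + \<alpha> + Poly_Mapping.single j k) x\<bar>))"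
        by (intro integral_mono int_w_abs sum_bound pointwise)
      also have "\<dots> = 2 * ((LINT x|\<nu>. \<bar>monomial (0 + Poly_Mapping.single j k) x\<bar>) + (LINT x|\<nu>. \<bar>monomial (\<alpha> + \<alpha> + Poly_Mapping.single j k) x\<bar>))"
        by (subst integral_mult_right_zero, subst Bochner_Integration.integral_add)
           (auto intro!: integrable_abs integrable_monomial[OF \<nu>] simp del: add_0)
      also have "\<dots> \<le> 2 * (root 8 ((K1 + K2) * t (4 * k)) + root 8 ((K1 + K2) * t (4 * k)))"
        using K1(1) K2(1) t
        by (intro mult_left_mono add_mono order_trans[OF K1(2)] order_trans[OF K2(2)]
              real_root_le_mono mult_right_mono) auto
      finally show ?thesis by simp
    qed
    with K1(1) K2(1) show "\<exists>K>0. \<forall>k. (LINT x|P \<nu>. \<bar>x\<bar> ^ k) \<le> 4 * root 8 (K * t (4 * k))"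
      by (intro exI[of _ "K1 + K2"]) auto
  qed
  have meas2: "w \<in> borel_measurable \<nu>2"
    using meas sets_eq by (simp cong: measurable_cong_sets)
  note props1 = props[OF \<nu>1 meas dom1] and props2 = props[OF \<nu>2 meas2 dom2]
  obtain K1 where K1: "K1 > 0" "\<And>k. (LINT x|P \<nu>1. \<bar>x\<bar> ^ k) \<le> 4 * root 8 (K1 * t (4 * k))"
    using props1(4)[of "\<lambda>x. x"] by auto
  obtain K2 where K2: "K2 > 0" "\<And>k. (LINT x|P \<nu>2. \<bar>x\<bar> ^ k) \<le> 4 * root 8 (K2 * t (4 * k))"
    using props2(4)[of "\<lambda>x. x"] by auto
  \<comment> \<open>The two projections contribute a factor 4 each, and their sum moves under the
    eighth root as \<open>8 ^ 8\<close>.\<close>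
  define K where "K = 8 ^ 8 * (K1 + K2)"
  have K: "K > 0" using K1(1) K2(1) by (simp add: K_def)
  have "P \<nu>1 = P \<nu>2"
  proof (rule moment_determinate_real)
    show "finite_measure (P \<nu>1)" "finite_measure (P \<nu>2)"
      by (rule props1(1)[OF borel_measurable_const] props2(1)[OF borel_measurable_const])+
    show "sets (P \<nu>1) = sets borel" "sets (P \<nu>2) = sets borel"
      by (simp_all add: P_def)
    show "integrable (P \<nu>1) (\<lambda>x. x ^ k)" "integrable (P \<nu>2) (\<lambda>x. x ^ k)" for k
      by (rule props1(2)[OF borel_measurable_const] props2(2)[OF borel_measurable_const])+
    show "(LINT x|P \<nu>1. x ^ k) = (LINT x|P \<nu>2. x ^ k)" for k
      using eq by (simp add: props1(3) props2(3))
    show "root 8 (K * shifted_moment \<mu> j (4 * k)) > 0" for k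
      by (rule carleman_root_8(1)[OF \<mu> K])
    show "root 8 (K * shifted_moment \<mu> j (4 * Suc k)) / root 8 (K * shifted_moment \<mu> j (4 * k))
        \<le> root 8 (K * shifted_moment \<mu> j (4 * Suc (Suc k))) / root 8 (K * shifted_moment \<mu> j (4 * Suc k))" for k
      by (rule carleman_root_8(2)[OF \<mu> K])
    show "\<not> summable (\<lambda>k. root 8 (K * shifted_moment \<mu> j (4 * k)) / root 8 (K * shifted_moment \<mu> j (4 * Suc k)))"
      by (rule carleman_root_8(3)[OF \<mu> K])
    show "(LINT x|P \<nu>1. \<bar>x\<bar> ^ k) + (LINT x|P \<nu>2. \<bar>x\<bar> ^ k) \<le> root 8 (K * shifted_moment \<mu> j (4 * k))" for k
    proof -
      have t: "t (4 * k) \<ge> 0"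
        unfolding t_def using shifted_moment_ge_1[OF \<mu>(1,2), of j "4 * k"] by simp
      have "(LINT x|P \<nu>1. \<bar>x\<bar> ^ k) + (LINT x|P \<nu>2. \<bar>x\<bar> ^ k)
          \<le> 4 * root 8 ((K1 + K2) * t (4 * k)) + 4 * root 8 ((K1 + K2) * t (4 * k))"
        using K1(1) K2(1) t
        by (intro add_mono order_trans[OF K1(2)] order_trans[OF K2(2)] mult_left_mono
              real_root_le_mono mult_right_mono) auto
      also have "\<dots> = root 8 (8 ^ 8) * root 8 ((K1 + K2) * t (4 * k))"
        by (subst real_root_power_cancel) auto
      also have "\<dots> = root 8 (K * t (4 * k))"
        unfolding K_def by (simp only: real_root_mult mult.assoc)
      finally show ?thesis unfolding t_def .
    qed
  qed
  then have "(LINT x|P \<nu>1. indicator {..a} x) = (LINT x|P \<nu>2. indicator {..a} x :: real)" by simp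
  then show ?thesis
    by (subst (asm) props1(3), simp, subst (asm) props2(3)) simp_all
qed

text \<open>Induction over the coordinates already cut off by half-lines. The monomial stays
  arbitrary, so the induction hypothesis provides all moments in the next coordinate
  \<open>j\<close>, and determinacy there turns powers of \<open>x $ j\<close> into an
  indicator.\<close>

lemma box_moment_eq:
  assumes "finite I"
  shows "(LINT x|\<nu>1. (\<Prod>i\<in>I. indicator {..a $ i} (x $ i)) * monomial \<alpha> x)
       = (LINT x|\<nu>2. (\<Prod>i\<in>I. indicator {..a $ i} (x $ i)) * monomial \<alpha> x)"
  using assms
proof (induction I arbitrary: \<alpha> rule: finite_induct)
  case empty
  then show ?case using fun_cong[OF moment_eq, of \<alpha>] by (simp add: moment_def)
next
  case (insert j I)
  define b :: "real ^ 'n \<Rightarrow> real" where "b x = (\<Prod>i\<in>I. indicator {..a $ i} (x $ i))" for x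
  have b: "0 \<le> b x" "b x \<le> 1" for x
    by (auto simp: b_def intro!: prod_nonneg prod_le_1)
  \<comment> \<open>Both weights are nonnegative and their difference is the signed weight \<open>b \<cdot> monomial \<alpha>\<close>.\<close>
  define w where "w c x = b x * (1 + monomial (\<alpha> + \<alpha>) x + c * monomial \<alpha> x)" for c x
  have meas: "b \<in> borel_measurable \<nu>" "(\<lambda>x. b x * indicator {..a $ j} (x $ j)) \<in> borel_measurable \<nu>"
    if "finite_measure \<nu>" "all_moments_finite \<nu>" for \<nu>
  proof -
    note [measurable] = measurable_coordinate[OF that]
    show "b \<in> borel_measurable \<nu>" "(\<lambda>x. b x * indicator {..a $ j} (x $ j)) \<in> borel_measurable \<nu>"
      unfolding b_def[abs_def] by measurable
  qed
  have integrable: "integrable \<nu> (\<lambda>x. h x * monomial \<beta> x)"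
    if \<nu>: "finite_measure \<nu>" "all_moments_finite \<nu>"
      and h: "h \<in> borel_measurable \<nu>" "\<And>x. 0 \<le> h x" "\<And>x. h x \<le> (1::real)" for \<nu> h \<beta>
    using h measurable_monomial[OF \<nu>] mult_right_mono[OF h(3)]
    by (intro Bochner_Integration.integrable_bound[OF integrable_monomial[OF \<nu>, of \<beta>]])
       (auto simp: abs_mult)
  have w_eq: "(LINT x|\<nu>1. w c x * indicator {..a $ j} (x $ j)) = (LINT x|\<nu>2. w c x * indicator {..a $ j} (x $ j))"
    if "c = 0 \<or> c = 1" for c
  proof (rule weighted_marginal_eq[where \<alpha> = \<alpha>])
    show "w c \<in> borel_measurable \<nu>1"
      unfolding w_def[abs_def] using meas[OF \<nu>1] measurable_monomial[OF \<nu>1] by measurable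
    have "0 \<le> 1 + monomial (\<alpha> + \<alpha>) x + c * monomial \<alpha> x \<and>
        1 + monomial (\<alpha> + \<alpha>) x + c * monomial \<alpha> x \<le> 2 * (1 + monomial (\<alpha> + \<alpha>) x)" for x
    proof -
      \<comment> \<open>From \<open>2 * \<bar>m\<bar> \<le> 1 + m * m\<close>: adding
        \<open>m\<close> keeps \<open>1 + m * m\<close> nonnegative and at most doubles it.\<close>
      have "0 \<le> 1 + m * m + c * m \<and> 1 + m * m + c * m \<le> 2 * (1 + m * m)" for m :: real
      proof -
        have "0 \<le> (m + 1)\<^sup>2" "0 \<le> (m - 1)\<^sup>2" "0 \<le> m * m" by simp_all
        then have "2 * m \<le> 1 + m * m" "- 2 * m \<le> 1 + m * m" "0 \<le> m * m"
          by (simp_all add: power2_eq_square algebra_simps)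
        with that show ?thesis by (elim disjE) (simp_all add: algebra_simps)
      qed
      then show ?thesis by (simp add: monomial_add)
    qed
    moreover have "monomial (\<alpha> + \<alpha>) x \<ge> 0" for x by (simp add: monomial_add)
    ultimately show "0 \<le> w c x" "w c x \<le> 2 * (1 + monomial (\<alpha> + \<alpha>) x)" for x
      using b[of x] by (auto simp: w_def intro!: mult_nonneg_nonneg order_trans[OF mult_right_mono[of "b x" 1]])
    fix k
    define \<kappa> where "\<kappa> = (Poly_Mapping.single j k :: 'n mindex)"
    \<comment> \<open>Each of the three integrals on the right is covered by the induction
      hypothesis.\<close>
    have "(LINT x|\<nu>. w c x * (x $ j) ^ k) = (LINT x|\<nu>. b x * monomial \<kappa> x)
        + (LINT x|\<nu>. b x * monomial (\<alpha> + \<alpha> + \<kappa>) x) + c * (LINT x|\<nu>. b x * monomial (\<alpha> + \<kappa>) x)"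
      if \<nu>: "finite_measure \<nu>" "all_moments_finite \<nu>" for \<nu>
    proof -
      note [simp] = integrable[OF \<nu> meas(1)[OF \<nu>] b]
      have "(LINT x|\<nu>. w c x * (x $ j) ^ k) = (LINT x|\<nu>. b x * monomial \<kappa> x
          + b x * monomial (\<alpha> + \<alpha> + \<kappa>) x + c * (b x * monomial (\<alpha> + \<kappa>) x))"
        unfolding w_def monomial_add[of _ \<kappa>] by (simp add: \<kappa>_def algebra_simps)
      then show ?thesis by simp
    qed
    from this[OF \<nu>1] this[OF \<nu>2]
    show "(LINT x|\<nu>1. w c x * (x $ j) ^ k) = (LINT x|\<nu>2. w c x * (x $ j) ^ k)"
      using insert.IH unfolding b_def by simp
  qed
  have split: "(LINT x|\<nu>. (b x * indicator {..a $ j} (x $ j)) * monomial \<alpha> x)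
      = (LINT x|\<nu>. w 1 x * indicator {..a $ j} (x $ j)) - (LINT x|\<nu>. w 0 x * indicator {..a $ j} (x $ j))"
    if \<nu>: "finite_measure \<nu>" "all_moments_finite \<nu>" for \<nu>
  proof -
    define h where "h x = b x * indicator {..a $ j} (x $ j)" for x
    have h: "h \<in> borel_measurable \<nu>" "\<And>x. 0 \<le> h x" "\<And>x. h x \<le> 1"
      using meas(2)[OF \<nu>] b by (auto simp: h_def[abs_def] split: split_indicator)
    have eq: "w c x * indicator {..a $ j} (x $ j) = h x * monomial 0 x + h x * monomial (\<alpha> + \<alpha>) x + c * (h x * monomial \<alpha> x)" for c x
      by (simp add: w_def h_def algebra_simps)
    show ?thesis
      unfolding eq h_def[symmetric] using integrable[OF \<nu> h] by (simp del: monomial_0)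
  qed
  have "(\<Prod>i\<in>insert j I. indicator {..a $ i} (x $ i)) = b x * indicator {..a $ j} (x $ j)" for x
    using insert.hyps by (simp add: b_def)
  then show ?case
    using split[OF \<nu>1] split[OF \<nu>2] w_eq[of 0] w_eq[of 1] by simp
qed

theorem moment_determinate:
  assumes sets: "sets \<nu>1 = sets (restrict_space borel X)" and X: "X \<in> sets borel"
  shows "\<nu>1 = \<nu>2"
proof -
  \<comment> \<open>The boxes generate the Borel sets of the whole space, while the measures live on
    \<open>X\<close>. The image under the inclusion bridges the two, since measurable subsets of the
    Borel set \<open>X\<close> are themselves Borel.\<close>
  define E where "E \<nu> = distr \<nu> borel (\<lambda>x. x)" for \<nu> :: "(real ^ 'n) measure"
  have sets2: "sets \<nu>2 = sets (restrict_space borel X)" using sets sets_eq by simp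
  have id_meas: "(\<lambda>x. x) \<in> measurable \<nu> borel" if "sets \<nu> = sets (restrict_space borel X)" for \<nu>
    using measurable_restrict_space1[of "\<lambda>x. x" borel borel X] that
    by (simp cong: measurable_cong_sets)
  \<comment> \<open>With all coordinates cut off and the monomial 1, the box moment is the mass of a
    box.\<close>
  have box: "emeasure (E \<nu>) {..a} = ennreal (LINT x|\<nu>. (\<Prod>i\<in>UNIV. indicator {..a $ i} (x $ i)) * monomial 0 x)"
    if \<nu>: "finite_measure \<nu>" "sets \<nu> = sets (restrict_space borel X)" for \<nu> a
  proof -
    have *: "{..a} \<inter> space \<nu> \<in> sets \<nu>"
      using measurable_sets[OF id_meas[OF \<nu>(2)], of "{..a}"] by (simp add: vimage_def atMost_def Int_def conj_commute)
    have "(\<Prod>i\<in>UNIV. indicator {..a $ i} (x $ i)) = (indicator {..a} x :: real)" for x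
      by (auto simp: indicator_def less_eq_vec_def prod_zero_iff)
    then have "(LINT x|\<nu>. (\<Prod>i\<in>UNIV. indicator {..a $ i} (x $ i)) * monomial 0 x) = (LINT x|\<nu>. indicator {..a} x)"
      by simp
    also have "\<dots> = measure \<nu> ({..a} \<inter> space \<nu>)"
      by simp
    finally show ?thesis
      using id_meas[OF \<nu>(2)] finite_measure.emeasure_eq_measure[OF \<nu>(1)]
      by (simp add: E_def emeasure_distr)
  qed
  have "E \<nu>1 = E \<nu>2"
  proof (rule measure_eqI_generator_eq)
    show "Int_stable (range (\<lambda>a::real ^ 'n. {..a}))"
    proof (rule Int_stableI_image)
      fix a b :: "real ^ 'n"
      show "\<exists>c\<in>UNIV. {..a} \<inter> {..b} = {..c}"
        by (rule bexI[of _ "inf a b"]) auto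
    qed
    show "range (\<lambda>a::real ^ 'n. {..a}) \<subseteq> Pow UNIV" by simp
    show "emeasure (E \<nu>1) Y = emeasure (E \<nu>2) Y" if "Y \<in> range (\<lambda>a. {..a})" for Y
      using that box[OF \<nu>1(1) sets] box[OF \<nu>2(1) sets2] box_moment_eq[of UNIV _ 0] by auto
    show "sets (E \<nu>1) = sigma_sets UNIV (range (\<lambda>a. {..a}))" "sets (E \<nu>2) = sigma_sets UNIV (range (\<lambda>a. {..a}))"
      by (simp_all add: E_def borel_eq_atMost)
    show "range (\<lambda>n::nat. {..(\<chi> i. real n) :: real ^ 'n}) \<subseteq> range (\<lambda>a. {..a})" by auto
    show "(\<Union>n::nat. {..(\<chi> i. real n) :: real ^ 'n}) = UNIV"
    proof safe
      fix x :: "real ^ 'n"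
      obtain n :: nat where n: "norm x \<le> real n" using real_arch_simple by blast
      have "x $ i \<le> real n" for i using component_le_norm_cart[of x i] n by linarith
      then show "x \<in> (\<Union>n::nat. {..(\<chi> i. real n)})" by (auto simp: less_eq_vec_def)
    qed simp
    show "emeasure (E \<nu>1) {..(\<chi> i. real n)} \<noteq> \<infinity>" for n :: nat
      unfolding box[OF \<nu>1(1) sets] by simp
  qed
  show ?thesis
  proof (rule measure_eqI[OF sets_eq])
    fix A assume "A \<in> sets \<nu>1"
    then obtain B where B: "B \<in> sets borel" "A = X \<inter> B"
      using sets by (auto simp: sets_restrict_space)
    have A: "A \<in> sets borel" using B X by simp
    have "A \<subseteq> X" using B by simp
    moreover have "space \<nu>1 = X" "space \<nu>2 = X"
      using sets_eq_imp_space_eq[OF sets] sets_eq_imp_space_eq[OF sets2] by (simp_all add: space_restrict_space)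
    ultimately have "(\<lambda>x. x) -` A \<inter> space \<nu>1 = A" "(\<lambda>x. x) -` A \<inter> space \<nu>2 = A"
      by auto
    then show "emeasure \<nu>1 A = emeasure \<nu>2 A"
      using arg_cong[OF \<open>E \<nu>1 = E \<nu>2\<close>, of "\<lambda>M. emeasure M A"] A id_meas[OF sets] id_meas[OF sets2]
      by (simp add: E_def emeasure_distr)
  qed
qed

end

section \<open>Riesz representation\<close>

text \<open>Used with \<open>t = 2 ^ n\<close> to turn summability of weighted squared increments
  into absolute summability of the increments.\<close>

lemma abs_le_weighted_square:
  fixes a :: real
  assumes "t > 0"
  shows "\<bar>a\<bar> \<le> t * a\<^sup>2 + 1 / t"
proof -
  have "0 \<le> (t * \<bar>a\<bar> - 1)\<^sup>2" by simp
  also have "\<dots> = t * (t * a\<^sup>2 + 1 / t - 2 * \<bar>a\<bar>)"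
    using assms by (simp add: power2_diff power_mult_distrib algebra_simps power2_eq_square)
  finally have "0 \<le> t * a\<^sup>2 + 1 / t - 2 * \<bar>a\<bar>"
    using assms by (simp add: zero_le_mult_iff)
  then show ?thesis by linarith
qed

text \<open>Squared norms of order \<open>(1 / 4) ^ n\<close> leave room for the weight
  \<open>2 ^ n\<close>, so the increments are summable almost everywhere; Fatou's lemma transfers
  the Cauchy bound to the limit.\<close>

lemma riesz_fischer:
  fixes p :: "nat \<Rightarrow> 'a \<Rightarrow> real"
  assumes [measurable]: "\<And>n. p n \<in> borel_measurable M"
    and int: "\<And>n. integrable M (\<lambda>x. (p n x)\<^sup>2)"
    and cauchy: "\<And>m n. m \<le> n \<Longrightarrow> (LINT x|M. (p m x - p n x)\<^sup>2) \<le> 4 * (1 / 4) ^ m"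
  shows "\<exists>g. g \<in> borel_measurable M \<and> integrable M (\<lambda>x. (g x)\<^sup>2)
    \<and> (\<forall>n. integrable M (\<lambda>x. (p n x - g x)\<^sup>2) \<and> (LINT x|M. (p n x - g x)\<^sup>2) \<le> 4 * (1 / 4) ^ n)"
proof -
  have int_diff: "integrable M (\<lambda>x. (p m x - p n x)\<^sup>2)" for m n
    unfolding power2_diff using int integrable_mult_square[of "p m" M "p n"]
    by (auto simp: mult.assoc)
  have nn: "(\<integral>\<^sup>+x. ennreal ((p m x - p n x)\<^sup>2) \<partial>M) \<le> ennreal (4 * (1 / 4) ^ m)" if "m \<le> n" for m n
    by (subst nn_integral_eq_integral[OF int_diff]) (auto intro!: ennreal_leI cauchy that)
  define D where "D n x = 2 ^ n * (p n x - p (Suc n) x)\<^sup>2" for n x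
  have [measurable]: "D n \<in> borel_measurable M" for n unfolding D_def[abs_def] by measurable
  have "(\<integral>\<^sup>+x. suminf (\<lambda>n. ennreal (D n x)) \<partial>M) = suminf (\<lambda>n. \<integral>\<^sup>+x. ennreal (D n x) \<partial>M)"
    by (rule nn_integral_suminf) measurable
  also have "\<dots> \<le> suminf (\<lambda>n. ennreal (4 * (1 / 2) ^ n))"
  proof (rule suminf_le)
    fix n
    have "(\<integral>\<^sup>+x. ennreal (D n x) \<partial>M) = ennreal (2 ^ n) * (\<integral>\<^sup>+x. ennreal ((p n x - p (Suc n) x)\<^sup>2) \<partial>M)"
      unfolding D_def by (subst nn_integral_cmult[symmetric]) (auto simp: ennreal_mult)
    also have "\<dots> \<le> ennreal (2 ^ n) * ennreal (4 * (1 / 4) ^ n)"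
      by (intro mult_left_mono nn) auto
    also have "\<dots> = ennreal (4 * (1 / 2) ^ n)"
    proof -
      have "(2::real) ^ n * (1 / 4) ^ n = (1 / 2) ^ n" by (simp flip: power_mult_distrib)
      then have "(2::real) ^ n * (4 * (1 / 4) ^ n) = 4 * (1 / 2) ^ n" by simp
      then show ?thesis by (subst ennreal_mult[symmetric]) auto
    qed
    finally show "(\<integral>\<^sup>+x. ennreal (D n x) \<partial>M) \<le> ennreal (4 * (1 / 2) ^ n)" .
  qed auto
  also have "\<dots> < \<infinity>"
  proof -
    have "summable (\<lambda>n. 4 * (1 / 2 :: real) ^ n)" by (intro summable_mult summable_geometric) auto
    then have "suminf (\<lambda>n. ennreal (4 * (1 / 2) ^ n)) \<noteq> top"
      by (intro ennreal_suminf_neq_top) auto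
    then show ?thesis by (simp add: less_top)
  qed
  finally have "AE x in M. suminf (\<lambda>n. ennreal (D n x)) \<noteq> \<infinity>"
    by (intro nn_integral_PInf_AE) (auto simp: less_top)
  then have "AE x in M. convergent (\<lambda>n. p n x)"
  proof (rule eventually_mono)
    fix x assume "suminf (\<lambda>n. ennreal (D n x)) \<noteq> \<infinity>"
    then have "summable (\<lambda>n. D n x)"
      by (intro summable_suminf_not_top) (auto simp: D_def)
    then have "summable (\<lambda>n. D n x + (1 / 2) ^ n)"
      by (intro summable_add summable_geometric) auto
    then have "summable (\<lambda>n. p (Suc n) x - p n x)"
    proof (rule summable_comparison_test'[where N = 0])
      fix n
      have "\<bar>p (Suc n) x - p n x\<bar> \<le> 2 ^ n * (p (Suc n) x - p n x)\<^sup>2 + 1 / 2 ^ n"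
        by (rule abs_le_weighted_square) simp
      then show "norm (p (Suc n) x - p n x) \<le> D n x + (1 / 2) ^ n"
        by (simp add: D_def power2_commute power_divide)
    qed
    then have "convergent (\<lambda>n. (\<Sum>i<n. p (Suc i) x - p i x))"
      by (simp add: summable_iff_convergent)
    then have "convergent (\<lambda>n. p n x - p 0 x)"
      by (simp only: sum_lessThan_telescope[of "\<lambda>n. p n x"])
    then show "convergent (\<lambda>n. p n x)"
      using convergent_add[OF _ convergent_const[of "p 0 x"]] by fastforce
  qed
  then have lim: "AE x in M. (\<lambda>n. p n x) \<longlonglongrightarrow> lim (\<lambda>n. p n x)"
    by (simp add: convergent_LIMSEQ_iff)
  \<comment> \<open>On the null set where the sequence diverges, \<open>lim\<close> supplies an
    arbitrary value.\<close>
  define g where "g x = lim (\<lambda>n. p n x)" for x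
  have g[measurable]: "g \<in> borel_measurable M"
    unfolding g_def[abs_def] by (rule borel_measurable_lim_metric) measurable
  have fatou: "(\<integral>\<^sup>+x. ennreal ((p m x - g x)\<^sup>2) \<partial>M) \<le> ennreal (4 * (1 / 4) ^ m)" for m
  proof -
    have "(\<integral>\<^sup>+x. ennreal ((p m x - g x)\<^sup>2) \<partial>M) = (\<integral>\<^sup>+x. liminf (\<lambda>n. ennreal ((p m x - p n x)\<^sup>2)) \<partial>M)"
    proof (rule nn_integral_cong_AE, use lim in eventually_elim)
      fix x assume "(\<lambda>n. p n x) \<longlonglongrightarrow> lim (\<lambda>n. p n x)"
      then have "(\<lambda>n. ennreal ((p m x - p n x)\<^sup>2)) \<longlonglongrightarrow> ennreal ((p m x - g x)\<^sup>2)"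
        unfolding g_def by (intro tendsto_ennrealI tendsto_intros)
      then show "ennreal ((p m x - g x)\<^sup>2) = liminf (\<lambda>n. ennreal ((p m x - p n x)\<^sup>2))"
        by (intro lim_imp_Liminf[symmetric]) auto
    qed
    also have "\<dots> \<le> liminf (\<lambda>n. \<integral>\<^sup>+x. ennreal ((p m x - p n x)\<^sup>2) \<partial>M)"
      by (rule nn_integral_liminf) measurable
    also have "\<dots> \<le> liminf (\<lambda>n. ennreal (4 * (1 / 4) ^ m))"
      by (rule Liminf_mono, rule eventually_sequentiallyI[of m]) (rule nn)
    finally show ?thesis by (simp add: Liminf_const)
  qed
  have int_g: "integrable M (\<lambda>x. (p m x - g x)\<^sup>2)" for m
    using fatou[of m] by (intro integrableI_nonneg) (auto simp: le_less_trans)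
  have "(LINT x|M. (p m x - g x)\<^sup>2) \<le> 4 * (1 / 4) ^ m" for m
    using fatou[of m] by (simp add: nn_integral_eq_integral[OF int_g])
  moreover have "integrable M (\<lambda>x. (g x)\<^sup>2)"
  proof (rule Bochner_Integration.integrable_bound)
    show "integrable M (\<lambda>x. 2 * (p 0 x - g x)\<^sup>2 + 2 * (p 0 x)\<^sup>2)"
      using int_g int by simp
    have "b\<^sup>2 \<le> 2 * (a - b)\<^sup>2 + 2 * a\<^sup>2" for a b :: real
      using zero_le_power2[of "b - 2 * a"] by (simp add: power2_eq_square algebra_simps)
    then show "AE x in M. norm ((g x)\<^sup>2) \<le> norm (2 * (p 0 x - g x)\<^sup>2 + 2 * (p 0 x)\<^sup>2)"
      by simp
  qed measurable
  ultimately show ?thesis using g int_g by blast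
qed

text \<open>Riesz representation on the \<open>L\<^sup>2\<close>-closure of a subspace, by minimising
  \<open>\<integral>p\<^sup>2 - 2 L p\<close>. The functional \<open>L\<close> is given by its graph \<open>V\<close>, so that it need not be known
  beforehand that it respects equality almost everywhere.\<close>

lemma riesz_representation_graph:
  fixes V :: "(('a \<Rightarrow> real) \<times> real) set"
  assumes meas: "\<And>p l. (p, l) \<in> V \<Longrightarrow> p \<in> borel_measurable M"
    and int: "\<And>p l. (p, l) \<in> V \<Longrightarrow> integrable M (\<lambda>x. (p x)\<^sup>2)"
    and add: "\<And>p l q k. (p, l) \<in> V \<Longrightarrow> (q, k) \<in> V \<Longrightarrow> (\<lambda>x. p x + q x, l + k) \<in> V"
    and scale: "\<And>p l c. (p, l) \<in> V \<Longrightarrow> (\<lambda>x. c * p x, c * l) \<in> V"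
    and ne: "V \<noteq> {}"
    and bdd: "\<And>p l. (p, l) \<in> V \<Longrightarrow> - C \<le> (LINT x|M. (p x)\<^sup>2) - 2 * l"
  shows "\<exists>g p. g \<in> borel_measurable M \<and> integrable M (\<lambda>x. (g x)\<^sup>2)
    \<and> (\<forall>n. \<exists>l. (p n, l) \<in> V) \<and> (\<forall>n. integrable M (\<lambda>x. (p n x - g x)\<^sup>2))
    \<and> (\<lambda>n. LINT x|M. (p n x - g x)\<^sup>2) \<longlonglongrightarrow> 0
    \<and> (\<forall>(q, l) \<in> V. (LINT x|M. g x * q x) = l)"
proof -
  define J :: "('a \<Rightarrow> real) \<times> real \<Rightarrow> real" where "J = (\<lambda>(p, l). (LINT x|M. (p x)\<^sup>2) - 2 * l)"
  define m where "m = Inf (J ` V)"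
  have bdd_below: "bdd_below (J ` V)"
    using bdd by (intro bdd_belowI[of _ "- C"]) (auto simp: J_def)
  have m_le: "m \<le> (LINT x|M. (p x)\<^sup>2) - 2 * l" if "(p, l) \<in> V" for p l
    using cInf_lower[OF imageI[OF that] bdd_below] by (simp add: m_def J_def)
  have "\<exists>v\<in>V. J v < m + (1 / 4) ^ n" for n
    using cInf_lessD[of "J ` V" "m + (1 / 4) ^ n"] ne by (auto simp: m_def)
  then obtain v where v: "\<And>n. v n \<in> V" "\<And>n. J (v n) < m + (1 / 4) ^ n"
    by metis
  define p where "p n = fst (v n)" for n
  define l where "l n = snd (v n)" for n
  have V: "(p n, l n) \<in> V" for n
    using v(1) by (simp add: p_def l_def)
  have almost_min: "(LINT x|M. (p n x)\<^sup>2) - 2 * l n \<le> m + (1 / 4) ^ n" for n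
    using v(2)[of n] by (simp add: J_def p_def l_def split_beta)
  note [measurable] = meas[OF V]
  note [simp] = int[OF V]
  have int_mult: "integrable M (\<lambda>x. p n x * q x)" if "(q, k) \<in> V" for n q k
    using meas[OF that] int[OF that] by (intro integrable_mult_square) auto
  have "(LINT x|M. (p i x - p n x)\<^sup>2) \<le> 4 * (1 / 4) ^ i" if "i \<le> n" for i n
  proof -
    note [simp] = int_mult[OF V[of n], of i]
    \<comment> \<open>Parallelogram law: the midpoint is admissible, so its value is at least the
      infimum \<open>m\<close>, and two almost minimisers must be close. Their squared distance is
      at most \<open>2 * (1 / 4) ^ i + 2 * (1 / 4) ^ n\<close>, whence the factor 4.\<close>
    have "(\<lambda>x. (1/2) * (p i x + p n x), (1/2) * (l i + l n)) \<in> V"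
      by (intro scale add V)
    from m_le[OF this] have "m \<le> (LINT x|M. (1/4) * (p i x)\<^sup>2 + (1/4) * (p n x)\<^sup>2 + (1/2) * (p i x * p n x)) - (l i + l n)"
      by (simp add: power2_eq_square algebra_simps add_divide_distrib)
    then have "4 * m \<le> (LINT x|M. (p i x)\<^sup>2) + (LINT x|M. (p n x)\<^sup>2) + 2 * (LINT x|M. p i x * p n x) - 4 * (l i + l n)"
      by simp
    moreover have "(LINT x|M. (p i x - p n x)\<^sup>2)
        = (LINT x|M. (p i x)\<^sup>2) + (LINT x|M. (p n x)\<^sup>2) - 2 * (LINT x|M. p i x * p n x)"
      unfolding power2_diff by (simp add: mult.assoc)
    moreover have "(1 / 4 :: real) ^ n \<le> (1 / 4) ^ i" using that by (intro power_decreasing) auto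
    ultimately show ?thesis using almost_min[of i] almost_min[of n] by argo
  qed
  then obtain g where g: "g \<in> borel_measurable M" "integrable M (\<lambda>x. (g x)\<^sup>2)"
    and int_pg: "\<And>n. integrable M (\<lambda>x. (p n x - g x)\<^sup>2)"
    and pg: "\<And>n. (LINT x|M. (p n x - g x)\<^sup>2) \<le> 4 * (1 / 4) ^ n"
    using riesz_fischer[of p M] by auto
  note g(1)[measurable]
  have geom: "(\<lambda>n. 4 * (1 / 4 :: real) ^ n) \<longlonglongrightarrow> 0"
    by (intro tendsto_mult_right_zero LIMSEQ_realpow_zero) auto
  have conv: "(\<lambda>n. LINT x|M. (p n x - g x)\<^sup>2) \<longlonglongrightarrow> 0"
    by (rule tendsto_sandwich[OF _ _ tendsto_const geom]) (auto intro!: always_eventually pg)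
  have "(LINT x|M. g x * q x) = k" if q: "(q, k) \<in> V" for q k
  proof -
    note [measurable] = meas[OF q] and [simp] = int[OF q]
    have int_gq: "integrable M (\<lambda>x. g x * q x)"
      using g by (intro integrable_mult_square) auto
    define Q where "Q = (LINT x|M. (q x)\<^sup>2)"
    have lim: "(\<lambda>n. LINT x|M. p n x * q x) \<longlonglongrightarrow> (LINT x|M. g x * q x)"
    proof (rule LIM_zero_cancel, rule tendsto_rabs_zero_cancel, rule tendsto_sandwich[OF _ _ tendsto_const])
      have "\<bar>(LINT x|M. p n x * q x) - (LINT x|M. g x * q x)\<bar> \<le> sqrt ((LINT x|M. (p n x - g x)\<^sup>2) * Q)" for n
      proof (rule real_le_rsqrt)
        have "\<bar>(LINT x|M. p n x * q x) - (LINT x|M. g x * q x)\<bar> = \<bar>LINT x|M. (p n x - g x) * q x\<bar>"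
          using int_mult[OF q] int_gq by (simp add: left_diff_distrib)
        also have "\<dots> \<le> (LINT x|M. \<bar>p n x - g x\<bar> * \<bar>q x\<bar>)"
          unfolding abs_mult[symmetric] by (rule integral_abs_bound)
        finally have "\<bar>(LINT x|M. p n x * q x) - (LINT x|M. g x * q x)\<bar>\<^sup>2 \<le> (LINT x|M. \<bar>p n x - g x\<bar> * \<bar>q x\<bar>)\<^sup>2"
          by (intro power_mono) auto
        also have "\<dots> \<le> (LINT x|M. (p n x - g x)\<^sup>2) * Q"
          unfolding Q_def by (intro Cauchy_Schwarz_integral int_pg) auto
        finally show "\<bar>(LINT x|M. p n x * q x) - (LINT x|M. g x * q x)\<bar>\<^sup>2 \<le> (LINT x|M. (p n x - g x)\<^sup>2) * Q" .
      qed
      then show "\<forall>\<^sub>F n in sequentially. \<bar>(LINT x|M. p n x * q x) - (LINT x|M. g x * q x)\<bar>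
          \<le> sqrt ((LINT x|M. (p n x - g x)\<^sup>2) * Q)"
        by simp
      have "(\<lambda>n. sqrt ((LINT x|M. (p n x - g x)\<^sup>2) * Q)) \<longlonglongrightarrow> sqrt (0 * Q)"
        by (intro tendsto_intros conv)
      then show "(\<lambda>n. sqrt ((LINT x|M. (p n x - g x)\<^sup>2) * Q)) \<longlonglongrightarrow> 0" by simp
    qed simp
    \<comment> \<open>First-order condition at the minimum: a quadratic in \<open>s\<close> without
      constant term that is never negative has no linear term.\<close>
    have "((LINT x|M. g x * q x) - k)\<^sup>2 \<le> 0 * Q"
    proof (rule discriminant_le)
      fix s
      \<comment> \<open>The variation is carried out at \<open>p n\<close>, which lies in
        \<open>V\<close>, since the limit \<open>g\<close> need not; the price is the defect
        \<open>(1 / 4) ^ n\<close> of the infimum.\<close>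
      have step: "- ((1 / 4) ^ n) \<le> 2 * s * ((LINT x|M. p n x * q x) - k) + s\<^sup>2 * Q" for n
      proof -
        have "(\<lambda>x. p n x + s * q x, l n + s * k) \<in> V"
          by (intro add scale V q)
        from m_le[OF this] have "m \<le> (LINT x|M. (p n x)\<^sup>2 + 2 * s * (p n x * q x) + s\<^sup>2 * (q x)\<^sup>2) - 2 * (l n + s * k)"
          by (simp add: power2_sum power_mult_distrib algebra_simps)
        also have "(LINT x|M. (p n x)\<^sup>2 + 2 * s * (p n x * q x) + s\<^sup>2 * (q x)\<^sup>2)
            = (LINT x|M. (p n x)\<^sup>2) + 2 * s * (LINT x|M. p n x * q x) + s\<^sup>2 * Q"
          using int_mult[OF q] by (simp add: Q_def)
        finally show ?thesis using almost_min[of n] by (simp add: algebra_simps)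
      qed
      have "- 0 \<le> 2 * s * ((LINT x|M. g x * q x) - k) + s\<^sup>2 * Q"
      proof (rule tendsto_le[OF sequentially_bot])
        show "(\<lambda>n. 2 * s * ((LINT x|M. p n x * q x) - k) + s\<^sup>2 * Q)
            \<longlonglongrightarrow> 2 * s * ((LINT x|M. g x * q x) - k) + s\<^sup>2 * Q"
          by (intro tendsto_intros lim)
        show "(\<lambda>n. - ((1 / 4 :: real) ^ n)) \<longlonglongrightarrow> - 0"
          by (intro tendsto_minus LIMSEQ_realpow_zero) auto
      qed (simp add: step)
      then show "0 \<le> 0 + 2 * s * ((LINT x|M. g x * q x) - k) + s\<^sup>2 * Q" by simp
    qed (simp add: Q_def)
    then show ?thesis by simp
  qed
  then show ?thesis
    using g int_pg conv V by (intro exI[of _ g] exI[of _ p]) blast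
qed

section \<open>Positive polynomial functionals\<close>

definition poly_fun :: "nat \<Rightarrow> ('n::finite mindex \<Rightarrow> real) \<Rightarrow> real ^ 'n \<Rightarrow> real" where
  "poly_fun d c x = (\<Sum>\<alpha>\<in>mindices_le d. c \<alpha> * monomial \<alpha> x)"

lemma mindices_le_mono: "d \<le> e \<Longrightarrow> mindices_le d \<subseteq> mindices_le e"
  by (auto simp: mindices_le_def)

lemma zero_in_mindices_le: "0 \<in> mindices_le d"
  by (simp add: mindices_le_def)

lemma add_in_mindices_le: "\<alpha> \<in> mindices_le d \<Longrightarrow> \<beta> \<in> mindices_le e \<Longrightarrow> \<alpha> + \<beta> \<in> mindices_le (d + e)"
  by (simp add: mindices_le_def lookup_add sum.distrib)

lemma ex_in_mindices_le: "\<exists>d. \<alpha> \<in> mindices_le d"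
  by (auto simp: mindices_le_def)

lemma sum_mindices_le_eq:
  fixes f :: "'n::finite mindex \<Rightarrow> real"
  assumes "d \<le> e" "\<And>\<alpha>. \<alpha> \<notin> mindices_le d \<Longrightarrow> f \<alpha> = 0"
  shows "(\<Sum>\<alpha>\<in>mindices_le d. f \<alpha>) = (\<Sum>\<alpha>\<in>mindices_le e. f \<alpha>)"
  using assms mindices_le_mono[OF assms(1)] by (intro sum.mono_neutral_left finite_mindices_le) auto

lemma
  fixes f :: "real ^ 'n::finite \<Rightarrow> real"
  assumes int: "\<And>\<alpha>. integrable M (\<lambda>x. f x * monomial \<alpha> x)"
  shows integrable_mult_poly_square: "integrable M (\<lambda>x. f x * (poly_fun d c x)\<^sup>2)"
    and integral_mult_poly_square: "(LINT x|M. f x * (poly_fun d c x)\<^sup>2)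
      = (\<Sum>\<alpha>\<in>mindices_le d. \<Sum>\<beta>\<in>mindices_le d. c \<alpha> * (LINT x|M. f x * monomial (\<alpha> + \<beta>) x) * c \<beta>)"
proof -
  have eq: "(\<lambda>x. f x * (poly_fun d c x)\<^sup>2)
      = (\<lambda>x. \<Sum>\<alpha>\<in>mindices_le d. \<Sum>\<beta>\<in>mindices_le d. c \<alpha> * (f x * monomial (\<alpha> + \<beta>) x) * c \<beta>)"
  proof
    fix x
    have "f x * (poly_fun d c x)\<^sup>2
        = f x * (\<Sum>\<alpha>\<in>mindices_le d. \<Sum>\<beta>\<in>mindices_le d. (c \<alpha> * monomial \<alpha> x) * (c \<beta> * monomial \<beta> x))"
      by (simp only: poly_fun_def power2_eq_square sum_product)
    then show "f x * (poly_fun d c x)\<^sup>2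
        = (\<Sum>\<alpha>\<in>mindices_le d. \<Sum>\<beta>\<in>mindices_le d. c \<alpha> * (f x * monomial (\<alpha> + \<beta>) x) * c \<beta>)"
      by (simp add: sum_distrib_left monomial_add ac_simps)
  qed
  show "integrable M (\<lambda>x. f x * (poly_fun d c x)\<^sup>2)"
    unfolding eq using int by simp
  show "(LINT x|M. f x * (poly_fun d c x)\<^sup>2)
      = (\<Sum>\<alpha>\<in>mindices_le d. \<Sum>\<beta>\<in>mindices_le d. c \<alpha> * (LINT x|M. f x * monomial (\<alpha> + \<beta>) x) * c \<beta>)"
    unfolding eq using int by simp
qed

lemma
  assumes M: "finite_measure M" "all_moments_finite M"
  shows measurable_poly_fun: "poly_fun d c \<in> borel_measurable M"
    and integrable_poly_square: "integrable M (\<lambda>x. (poly_fun d c x)\<^sup>2)"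
    and integral_poly_square: "(LINT x|M. (poly_fun d c x)\<^sup>2)
      = (\<Sum>\<alpha>\<in>mindices_le d. \<Sum>\<beta>\<in>mindices_le d. c \<alpha> * moment_matrix (moment M) \<alpha> \<beta> * c \<beta>)"
proof -
  show "poly_fun d c \<in> borel_measurable M"
    unfolding poly_fun_def[abs_def] using measurable_monomial[OF M] by simp
  have 1: "integrable M (\<lambda>x. 1 * monomial \<alpha> x)" for \<alpha>
    using integrable_monomial[OF M] by simp
  show "integrable M (\<lambda>x. (poly_fun d c x)\<^sup>2)"
    using integrable_mult_poly_square[OF 1] by simp
  show "(LINT x|M. (poly_fun d c x)\<^sup>2)
      = (\<Sum>\<alpha>\<in>mindices_le d. \<Sum>\<beta>\<in>mindices_le d. c \<alpha> * moment_matrix (moment M) \<alpha> \<beta> * c \<beta>)"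
    using integral_mult_poly_square[OF 1] by (simp add: moment_matrix_def moment_def)
qed

text \<open>Besides \<open>g\<close> the conclusion keeps polynomials converging to it in L2,
  because \<open>density_nonneg_of_squares\<close> has to square them.\<close>

lemma riesz_polynomials:
  fixes M :: "(real ^ 'n::finite) measure"
  assumes M: "finite_measure M" "all_moments_finite M"
    and bdd: "\<And>d c. - C \<le> (LINT x|M. (poly_fun d c x)\<^sup>2) - 2 * (\<Sum>\<alpha>\<in>mindices_le d. c \<alpha> * z \<alpha>)"
  shows "\<exists>g d c. g \<in> borel_measurable M \<and> integrable M (\<lambda>x. (g x)\<^sup>2)
    \<and> (\<forall>n. integrable M (\<lambda>x. (poly_fun (d n) (c n) x - g x)\<^sup>2))
    \<and> (\<lambda>n::nat. LINT x|M. (poly_fun (d n) (c n) x - g x)\<^sup>2) \<longlonglongrightarrow> 0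
    \<and> (\<forall>\<alpha>. (LINT x|M. g x * monomial \<alpha> x) = z \<alpha>)"
proof -
  \<comment> \<open>Coefficients beyond the degree bound are set to 0, so that two polynomials can
    be padded to a common bound and added.\<close>
  define V where "V = {(poly_fun d c, \<Sum>\<alpha>\<in>mindices_le d. c \<alpha> * z \<alpha>) | d c. \<forall>\<alpha>. \<alpha> \<notin> mindices_le d \<longrightarrow> c \<alpha> = 0}"
  have V_I: "(p, l) \<in> V" if "p = poly_fun d c" "l = (\<Sum>\<alpha>\<in>mindices_le d. c \<alpha> * z \<alpha>)"
    "\<And>\<alpha>. \<alpha> \<notin> mindices_le d \<Longrightarrow> c \<alpha> = 0" for p l d c
    using that unfolding V_def by blast
  have "\<exists>g p. g \<in> borel_measurable M \<and> integrable M (\<lambda>x. (g x)\<^sup>2)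
    \<and> (\<forall>n. \<exists>l. (p n, l) \<in> V) \<and> (\<forall>n. integrable M (\<lambda>x. (p n x - g x)\<^sup>2))
    \<and> (\<lambda>n. LINT x|M. (p n x - g x)\<^sup>2) \<longlonglongrightarrow> 0
    \<and> (\<forall>(q, l) \<in> V. (LINT x|M. g x * q x) = l)"
  proof (rule riesz_representation_graph)
    show "p \<in> borel_measurable M" "integrable M (\<lambda>x. (p x)\<^sup>2)"
      "- C \<le> (LINT x|M. (p x)\<^sup>2) - 2 * l" if "(p, l) \<in> V" for p l
      using that measurable_poly_fun[OF M] integrable_poly_square[OF M] bdd by (auto simp: V_def)
    show "(\<lambda>x. r * p x, r * l) \<in> V" if "(p, l) \<in> V" for p l r
    proof -
      from that obtain d c where "p = poly_fun d c" "l = (\<Sum>\<alpha>\<in>mindices_le d. c \<alpha> * z \<alpha>)"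
        "\<forall>\<alpha>. \<alpha> \<notin> mindices_le d \<longrightarrow> c \<alpha> = 0" unfolding V_def by blast
      then show ?thesis
        by (intro V_I[of _ d "\<lambda>\<alpha>. r * c \<alpha>"]) (auto simp: poly_fun_def sum_distrib_left mult.assoc)
    qed
    show "(\<lambda>x. p x + q x, l + k) \<in> V" if "(p, l) \<in> V" "(q, k) \<in> V" for p l q k
    proof -
      from that(1) obtain d c where p: "p = poly_fun d c" "l = (\<Sum>\<alpha>\<in>mindices_le d. c \<alpha> * z \<alpha>)"
        and c: "\<And>\<alpha>. \<alpha> \<notin> mindices_le d \<Longrightarrow> c \<alpha> = 0" unfolding V_def by blast
      from that(2) obtain e b where q: "q = poly_fun e b" "k = (\<Sum>\<alpha>\<in>mindices_le e. b \<alpha> * z \<alpha>)"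
        and b: "\<And>\<alpha>. \<alpha> \<notin> mindices_le e \<Longrightarrow> b \<alpha> = 0" unfolding V_def by blast
      define N where "N = max d e"
      have extend: "(\<Sum>\<alpha>\<in>mindices_le d. c \<alpha> * f \<alpha>) = (\<Sum>\<alpha>\<in>mindices_le N. c \<alpha> * f \<alpha>)"
        "(\<Sum>\<alpha>\<in>mindices_le e. b \<alpha> * f \<alpha>) = (\<Sum>\<alpha>\<in>mindices_le N. b \<alpha> * f \<alpha>)" for f
        using b c by (auto intro!: sum_mindices_le_eq simp: N_def)
      have outside: "c \<alpha> + b \<alpha> = 0" if "\<alpha> \<notin> mindices_le N" for \<alpha>
      proof -
        have "mindices_le d \<subseteq> (mindices_le N :: 'n mindex set)" "mindices_le e \<subseteq> (mindices_le N :: 'n mindex set)"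
          by (auto simp: N_def intro!: mindices_le_mono)
        with that have "\<alpha> \<notin> mindices_le d" "\<alpha> \<notin> mindices_le e" by auto
        then show ?thesis by (simp add: b c)
      qed
      show ?thesis
        by (rule V_I[of _ N "\<lambda>\<alpha>. c \<alpha> + b \<alpha>"])
           (auto simp: p q poly_fun_def extend distrib_right sum.distrib outside)
    qed
    show "V \<noteq> {}" using V_I[of _ 0 "\<lambda>_. 0"] by auto
  qed
  then obtain g p where g: "g \<in> borel_measurable M" "integrable M (\<lambda>x. (g x)\<^sup>2)"
    and pV: "\<And>n. \<exists>l. (p n, l) \<in> V" and p: "\<And>n. integrable M (\<lambda>x. (p n x - g x)\<^sup>2)"
      "(\<lambda>n. LINT x|M. (p n x - g x)\<^sup>2) \<longlonglongrightarrow> 0"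
    and eq: "\<And>q l. (q, l) \<in> V \<Longrightarrow> (LINT x|M. g x * q x) = l"
    by (elim exE conjE)
       (rule that, assumption, assumption, erule spec, erule spec, assumption, drule bspec, assumption, simp)
  have "\<exists>d c. p n = poly_fun d c" for n
    using pV[of n] by (auto simp: V_def)
  then obtain d c where dc: "\<And>n. p n = poly_fun (d n) (c n)"
    by metis
  have "(LINT x|M. g x * monomial \<alpha> x) = z \<alpha>" for \<alpha>
  proof -
    obtain e where e: "\<alpha> \<in> mindices_le e" using ex_in_mindices_le by blast
    have delta: "(\<Sum>\<beta>\<in>mindices_le e. (if \<beta> = \<alpha> then 1 else 0) * f \<beta>) = f \<alpha>" for f :: "_ \<Rightarrow> real"
      using e by (simp add: if_distrib[of "\<lambda>a. a * _"] finite_mindices_le cong: if_cong)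
    have "(monomial \<alpha>, z \<alpha>) \<in> V"
      using e by (intro V_I[of _ e "\<lambda>\<beta>. if \<beta> = \<alpha> then 1 else 0"]) (auto simp: poly_fun_def delta)
    then show ?thesis by (rule eq)
  qed
  with g p show ?thesis unfolding dc by blast
qed

text \<open>With \<open>A = {\<psi> < 0}\<close> and polynomials \<open>p\<close> approximating the indicator of \<open>A\<close> in \<open>L\<^sub>2(|\<psi>|\<mu>)\<close>, the
  integrals \<open>\<integral>\<psi>p\<^sup>2 d\<mu>\<close> tend to \<open>\<integral>\<^sub>A \<psi> d\<mu>\<close>. Such polynomials exist since the projection of the indicator
  onto the closure of the polynomials has the same moments.\<close>

lemma density_nonneg_of_squares:
  fixes \<mu> :: "(real ^ 'n::finite) measure"
  assumes X: "X \<in> sets borel" and sets: "sets \<mu> = sets (restrict_space borel X)"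
    and \<mu>: "finite_measure \<mu>" "all_moments_finite \<mu>" "carleman (moment \<mu>)"
    and \<psi>[measurable]: "\<psi> \<in> borel_measurable \<mu>" and int_\<psi>: "integrable \<mu> (\<lambda>x. (\<psi> x)\<^sup>2)"
    and nonneg: "\<And>d c. 0 \<le> (LINT x|\<mu>. \<psi> x * (poly_fun d c x)\<^sup>2)"
  shows "AE x in \<mu>. 0 \<le> \<psi> x"
proof -
  interpret \<mu>: finite_measure \<mu> by (rule \<mu>)
  note [measurable] = measurable_monomial[OF \<mu>(1,2)]
  define A where "A = {x. \<psi> x < 0}"
  have A[measurable]: "(\<lambda>x. indicator A x :: real) \<in> borel_measurable \<mu>"
  proof -
    have "indicator A = (\<lambda>x. if \<psi> x < 0 then 1 else 0 :: real)"
      by (auto simp: A_def split: split_indicator)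
    then show ?thesis by simp
  qed
  define \<sigma> where "\<sigma> = density \<mu> (\<lambda>x. ennreal \<bar>\<psi> x\<bar>)"
  have sets_\<sigma>[measurable_cong]: "sets \<sigma> = sets \<mu>" by (simp add: \<sigma>_def)
  have int_\<psi>_mono: "integrable \<mu> (\<lambda>x. \<psi> x * monomial \<alpha> x)" for \<alpha>
    by (intro integrable_mult_square int_\<psi> integrable_monomial_square \<mu>) auto
  have int_abs\<psi>: "integrable \<mu> (\<lambda>x. \<bar>\<psi> x\<bar> * monomial \<alpha> x)" for \<alpha>
    by (rule Bochner_Integration.integrable_bound[OF int_\<psi>_mono[of \<alpha>]]) (auto simp: abs_mult)
  have int_\<sigma>: "integrable \<sigma> f \<longleftrightarrow> integrable \<mu> (\<lambda>x. \<bar>\<psi> x\<bar> * f x)"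
    "(LINT x|\<sigma>. f x) = (LINT x|\<mu>. \<bar>\<psi> x\<bar> * f x)" if "f \<in> borel_measurable \<mu>" for f :: "real ^ 'n \<Rightarrow> real"
    using that unfolding \<sigma>_def by (auto simp: integrable_density integral_density)
  have \<sigma>: "finite_measure \<sigma>" "all_moments_finite \<sigma>"
  proof -
    have "emeasure \<sigma> (space \<sigma>) = (\<integral>\<^sup>+x. ennreal \<bar>\<psi> x\<bar> \<partial>\<mu>)"
      by (auto simp: \<sigma>_def emeasure_density intro!: nn_integral_cong split: split_indicator)
    also have "\<dots> < \<infinity>"
      using int_abs\<psi>[of 0] by (simp add: nn_integral_eq_integral)
    finally show "finite_measure \<sigma>" by (intro finite_measureI) simp
    show "all_moments_finite \<sigma>"
      using int_abs\<psi> by (simp add: all_moments_finite_def int_\<sigma>)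
  qed
  interpret \<sigma>: finite_measure \<sigma> by (rule \<sigma>)
  note [simp] = integrable_monomial[OF \<sigma>]
  have int_ind: "integrable \<sigma> (\<lambda>x. indicator A x * f x)" if "integrable \<sigma> f" for f :: "real ^ 'n \<Rightarrow> real"
    using that by (rule Bochner_Integration.integrable_bound) (use that in \<open>auto split: split_indicator\<close>)
  define z where "z \<alpha> = (LINT x|\<sigma>. indicator A x * monomial \<alpha> x)" for \<alpha>
  \<comment> \<open>Completing the square: with \<open>p\<close> the polynomial,
    \<open>p^2 - 2 * 1_A * p + 1\<close> is nonnegative pointwise, so the variational functional is
    bounded below by minus the mass of \<open>\<sigma>\<close>.\<close>
  have "- measure \<sigma> (space \<sigma>) \<le> (LINT x|\<sigma>. (poly_fun d c x)\<^sup>2) - 2 * (\<Sum>\<alpha>\<in>mindices_le d. c \<alpha> * z \<alpha>)" for d c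
  proof -
    have int_poly: "integrable \<sigma> (poly_fun d c)"
      unfolding poly_fun_def[abs_def] by simp
    have "(\<Sum>\<alpha>\<in>mindices_le d. c \<alpha> * z \<alpha>) = (LINT x|\<sigma>. indicator A x * poly_fun d c x)"
      unfolding poly_fun_def z_def sum_distrib_left mult.left_commute[of "indicator A _"]
      by (subst Bochner_Integration.integral_sum) (auto intro!: integrable_mult_right int_ind)
    then have "(LINT x|\<sigma>. (poly_fun d c x)\<^sup>2) - 2 * (\<Sum>\<alpha>\<in>mindices_le d. c \<alpha> * z \<alpha>) + measure \<sigma> (space \<sigma>)
        = (LINT x|\<sigma>. (poly_fun d c x)\<^sup>2 - 2 * (indicator A x * poly_fun d c x) + 1)"
      using integrable_poly_square[OF \<sigma>] int_ind[OF int_poly] by simp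
    also have "\<dots> \<ge> 0"
    proof (rule integral_nonneg_AE, rule always_eventually, rule allI)
      fix x
      show "0 \<le> (poly_fun d c x)\<^sup>2 - 2 * (indicator A x * poly_fun d c x) + 1"
        using zero_le_power2[of "poly_fun d c x - 1"] by (auto simp: power2_diff split: split_indicator)
    qed
    finally show ?thesis by simp
  qed
  from riesz_polynomials[OF \<sigma> this] obtain g d c where g[measurable]: "g \<in> borel_measurable \<sigma>"
    and int_g: "integrable \<sigma> (\<lambda>x. (g x)\<^sup>2)"
    and int_pg: "\<And>n. integrable \<sigma> (\<lambda>x. (poly_fun (d n) (c n) x - g x)\<^sup>2)"
    and conv: "(\<lambda>n::nat. LINT x|\<sigma>. (poly_fun (d n) (c n) x - g x)\<^sup>2) \<longlonglongrightarrow> 0"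
    and gz: "\<And>\<alpha>. (LINT x|\<sigma>. g x * monomial \<alpha> x) = z \<alpha>"
    by blast
  \<comment> \<open>\<open>h\<close> is the defect of the projection, orthogonal to all monomials.
    Its positive and negative parts times \<open>\<sigma>\<close> are the measures
    \<open>\<nu> 1\<close> and \<open>\<nu> (-1)\<close>, and orthogonality says that their moments
    agree.\<close>
  define h where "h x = g x - indicator A x" for x
  have h[measurable]: "h \<in> borel_measurable \<sigma>" unfolding h_def[abs_def] by measurable
  have int_h: "integrable \<sigma> (\<lambda>x. (h x)\<^sup>2)"
  proof (rule Bochner_Integration.integrable_bound)
    show "integrable \<sigma> (\<lambda>x. 2 * (g x)\<^sup>2 + 2)" using int_g by simp
    have "(a - i)\<^sup>2 \<le> 2 * a\<^sup>2 + 2" if "i = 0 \<or> i = 1" for a i :: real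
      using that zero_le_power2[of "a + 1"] by (elim disjE) (simp_all add: power2_eq_square algebra_simps)
    then show "AE x in \<sigma>. norm ((h x)\<^sup>2) \<le> norm (2 * (g x)\<^sup>2 + 2)"
      by (simp add: h_def indicator_def)
  qed measurable
  have h_orth: "(LINT x|\<sigma>. h x * monomial \<alpha> x) = 0" for \<alpha>
  proof -
    have "integrable \<sigma> (\<lambda>x. g x * monomial \<alpha> x)"
      by (intro integrable_mult_square int_g integrable_monomial_square \<sigma>) auto
    then show ?thesis
      using gz[of \<alpha>] int_ind[of "monomial \<alpha>"] by (simp add: h_def left_diff_distrib z_def)
  qed
  define \<nu> where "\<nu> s = density \<sigma> (\<lambda>x. ennreal (max 0 (s * h x)))" for s
  \<comment> \<open>Cauchy-Schwarz over \<open>\<sigma>\<close> splits off \<open>h\<close>; after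
    squaring, Cauchy-Schwarz over \<open>\<mu>\<close> splits off \<open>\<psi>\<close>.\<close>
  define C where "C = (LINT x|\<sigma>. (h x)\<^sup>2)\<^sup>2 * (LINT x|\<mu>. (\<psi> x)\<^sup>2)"
  have sq_le: "(max 0 (s * h x))\<^sup>2 \<le> (h x)\<^sup>2" if "s = 1 \<or> s = -1" for s x
    using that by (auto simp: max_def power2_eq_square)
  have props: "finite_measure (\<nu> s)" "all_moments_finite (\<nu> s)"
    "moment (\<nu> s) \<alpha> = (LINT x|\<sigma>. max 0 (s * h x) * monomial \<alpha> x)"
    "(LINT x|\<nu> s. \<bar>monomial \<alpha> x\<bar>) ^ 4 \<le> C * moment \<mu> (\<alpha> + \<alpha> + (\<alpha> + \<alpha>))"
    if s: "s = 1 \<or> s = -1" for s \<alpha>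
  proof -
    have int_sq: "integrable \<sigma> (\<lambda>x. (max 0 (s * h x))\<^sup>2)"
      by (rule Bochner_Integration.integrable_bound[OF int_h]) (auto simp: sq_le s)
    have int_m: "integrable \<sigma> (\<lambda>x. max 0 (s * h x) * monomial \<alpha> x)" for \<alpha>
      by (intro integrable_mult_square int_sq integrable_monomial_square \<sigma>) auto
    have "emeasure (\<nu> s) (space (\<nu> s)) = (\<integral>\<^sup>+x. ennreal (max 0 (s * h x)) \<partial>\<sigma>)"
      by (auto simp: \<nu>_def emeasure_density intro!: nn_integral_cong split: split_indicator)
    also have "\<dots> < \<infinity>"
      using int_m[of 0] by (subst nn_integral_eq_integral) auto
    finally show "finite_measure (\<nu> s)" by (intro finite_measureI) simp
    show "all_moments_finite (\<nu> s)"
      using int_m by (simp add: all_moments_finite_def \<nu>_def integrable_density)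
    show "moment (\<nu> s) \<alpha> = (LINT x|\<sigma>. max 0 (s * h x) * monomial \<alpha> x)"
      by (simp add: moment_def \<nu>_def integral_density)
    define I where "I = (LINT x|\<nu> s. \<bar>monomial \<alpha> x\<bar>)"
    have "I = (LINT x|\<sigma>. \<bar>max 0 (s * h x)\<bar> * \<bar>monomial \<alpha> x\<bar>)"
      unfolding I_def \<nu>_def by (subst integral_density) auto
    then have "I\<^sup>2 \<le> (LINT x|\<sigma>. (max 0 (s * h x))\<^sup>2) * (LINT x|\<sigma>. (monomial \<alpha> x)\<^sup>2)"
      using Cauchy_Schwarz_integral[OF _ _ int_sq integrable_monomial_square[OF \<sigma>]] by simp
    also have "\<dots> \<le> (LINT x|\<sigma>. (h x)\<^sup>2) * (LINT x|\<sigma>. (monomial \<alpha> x)\<^sup>2)"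
      by (intro mult_right_mono integral_mono int_sq int_h) (auto simp: sq_le s)
    finally have "(I\<^sup>2)\<^sup>2 \<le> ((LINT x|\<sigma>. (h x)\<^sup>2) * (LINT x|\<sigma>. (monomial \<alpha> x)\<^sup>2))\<^sup>2"
      by (intro power_mono) auto
    also have "\<dots> = (LINT x|\<sigma>. (h x)\<^sup>2)\<^sup>2 * (LINT x|\<mu>. \<bar>\<psi> x\<bar> * \<bar>monomial (\<alpha> + \<alpha>) x\<bar>)\<^sup>2"
      by (simp add: power_mult_distrib int_\<sigma> monomial_add power2_eq_square)
    also have "\<dots> \<le> (LINT x|\<sigma>. (h x)\<^sup>2)\<^sup>2 * ((LINT x|\<mu>. (\<psi> x)\<^sup>2) * (LINT x|\<mu>. (monomial (\<alpha> + \<alpha>) x)\<^sup>2))"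
      by (intro mult_left_mono Cauchy_Schwarz_integral int_\<psi> integrable_monomial_square \<mu>) auto
    also have "\<dots> = C * moment \<mu> (\<alpha> + \<alpha> + (\<alpha> + \<alpha>))"
      by (simp add: C_def moment_square[OF \<mu>(1,2)])
    finally show "I ^ 4 \<le> C * moment \<mu> (\<alpha> + \<alpha> + (\<alpha> + \<alpha>))"
      by (simp flip: power_mult)
  qed
  have "\<nu> 1 = \<nu> (-1)"
  proof (rule carleman_dominated.moment_determinate)
    show "sets (\<nu> 1) = sets (restrict_space borel X)" "X \<in> sets borel"
      using sets X by (simp_all add: \<nu>_def \<sigma>_def)
    show "carleman_dominated (\<nu> 1) (\<nu> (-1)) \<mu> C"
    proof (rule carleman_dominated.intro)
      show "sets (\<nu> 1) = sets (\<nu> (-1))" by (simp add: \<nu>_def)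
      show "moment (\<nu> 1) = moment (\<nu> (-1))"
      proof
        fix \<alpha>
        have int: "integrable \<sigma> (\<lambda>x. max 0 (s * h x) * monomial \<alpha> x)" if "s = 1 \<or> s = -1" for s
          using props(2)[OF that] by (simp add: all_moments_finite_def \<nu>_def integrable_density)
        have "moment (\<nu> 1) \<alpha> - moment (\<nu> (-1)) \<alpha> = (LINT x|\<sigma>. max 0 (1 * h x) * monomial \<alpha> x - max 0 (-1 * h x) * monomial \<alpha> x)"
          using int[of 1] int[of "-1"] by (subst Bochner_Integration.integral_diff) (auto simp: props)
        also have "\<dots> = (LINT x|\<sigma>. h x * monomial \<alpha> x)"
          by (intro Bochner_Integration.integral_cong) (auto simp: max_def algebra_simps)
        finally show "moment (\<nu> 1) \<alpha> = moment (\<nu> (-1)) \<alpha>" by (simp add: h_orth)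
      qed
      show "finite_measure (\<nu> 1)" "all_moments_finite (\<nu> 1)"
        "finite_measure (\<nu> (-1))" "all_moments_finite (\<nu> (-1))"
        by (simp_all add: props(1,2))
      show "(LINT x|\<nu> 1. \<bar>monomial \<alpha> x\<bar>) ^ 4 \<le> C * moment \<mu> (\<alpha> + \<alpha> + (\<alpha> + \<alpha>))"
        "(LINT x|\<nu> (-1). \<bar>monomial \<alpha> x\<bar>) ^ 4 \<le> C * moment \<mu> (\<alpha> + \<alpha> + (\<alpha> + \<alpha>))" for \<alpha>
        by (rule props(4), simp)+
    qed (rule \<mu>)+
  qed
  then have "AE x in \<sigma>. ennreal (max 0 (1 * h x)) = ennreal (max 0 (-1 * h x))"
    unfolding \<nu>_def
  proof (subst (asm) finite_density_unique)
    have "finite_measure (\<nu> 1)" using props(1) by simp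
    then have "emeasure (\<nu> 1) (space (\<nu> 1)) \<noteq> \<infinity>" by (simp add: finite_measure.emeasure_finite)
    also have "emeasure (\<nu> 1) (space (\<nu> 1)) = (\<integral>\<^sup>+x. ennreal (max 0 (1 * h x)) \<partial>\<sigma>)"
      by (auto simp: \<nu>_def emeasure_density intro!: nn_integral_cong split: split_indicator)
    finally show "(\<integral>\<^sup>+x. ennreal (max 0 (1 * h x)) \<partial>\<sigma>) \<noteq> \<infinity>" .
  qed auto
  then have g_eq: "AE x in \<sigma>. g x = indicator A x"
    by eventually_elim (auto simp: h_def max_def split: if_splits)
  define \<delta> where "\<delta> n = (LINT x|\<sigma>. (poly_fun (d n) (c n) x - g x)\<^sup>2)" for n
  note [measurable] = measurable_poly_fun[OF \<mu>(1,2)]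
  \<comment> \<open>The limit is taken through the pointwise bound \<open>\<bar>\<psi>\<bar> * 1_A
    \<le> 4 * \<bar>\<psi>\<bar> * (p - 1_A)^2 - 2 * \<psi> * p^2\<close>, which on \<open>A\<close>
    amounts to \<open>6 * p^2 - 8 * p + 3 \<ge> 0\<close> and off \<open>A\<close> follows from
    \<open>\<psi> \<ge> 0\<close>. The hypothesis on squares discards the last term.\<close>
  have "(LINT x|\<mu>. \<bar>\<psi> x\<bar> * indicator A x) \<le> 4 * \<delta> n" for n
  proof -
    define p where "p = poly_fun (d n) (c n)"
    have p[measurable]: "p \<in> borel_measurable \<mu>" by (simp add: p_def)
    have "integrable \<sigma> (\<lambda>x. (p x - indicator A x)\<^sup>2)"
      using int_pg[of n] g_eq unfolding p_def[symmetric]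
      by (subst (asm) integrable_cong_AE[where g = "\<lambda>x. (p x - indicator A x)\<^sup>2"]) auto
    then have int1: "integrable \<mu> (\<lambda>x. \<bar>\<psi> x\<bar> * (p x - indicator A x)\<^sup>2)"
      by (subst (asm) int_\<sigma>) auto
    have int2: "integrable \<mu> (\<lambda>x. \<psi> x * (p x)\<^sup>2)"
      unfolding p_def by (rule integrable_mult_poly_square[OF int_\<psi>_mono])
    have "\<delta> n = (LINT x|\<sigma>. (p x - indicator A x)\<^sup>2)"
      unfolding \<delta>_def p_def[symmetric] using g_eq by (intro integral_cong_AE) auto
    then have \<delta>: "\<delta> n = (LINT x|\<mu>. \<bar>\<psi> x\<bar> * (p x - indicator A x)\<^sup>2)"
      by (simp add: int_\<sigma>)
    have "(LINT x|\<mu>. \<bar>\<psi> x\<bar> * indicator A x)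
        \<le> (LINT x|\<mu>. 4 * (\<bar>\<psi> x\<bar> * (p x - indicator A x)\<^sup>2) - 2 * (\<psi> x * (p x)\<^sup>2))"
    proof (rule integral_mono)
      show "integrable \<mu> (\<lambda>x. \<bar>\<psi> x\<bar> * indicator A x)"
        by (intro Bochner_Integration.integrable_bound[OF int_abs\<psi>[of 0]]) (auto split: split_indicator)
      show "integrable \<mu> (\<lambda>x. 4 * (\<bar>\<psi> x\<bar> * (p x - indicator A x)\<^sup>2) - 2 * (\<psi> x * (p x)\<^sup>2))"
        using int1 int2 by simp
      fix x
      show "\<bar>\<psi> x\<bar> * indicator A x \<le> 4 * (\<bar>\<psi> x\<bar> * (p x - indicator A x)\<^sup>2) - 2 * (\<psi> x * (p x)\<^sup>2)"
      proof (cases "x \<in> A")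
        case True
        have "1 \<le> 4 * (p x - 1)\<^sup>2 + 2 * (p x)\<^sup>2"
          using zero_le_power2[of "3 * p x - 2"] by (simp add: power2_eq_square algebra_simps)
        then have "- \<psi> x * 1 \<le> - \<psi> x * (4 * (p x - 1)\<^sup>2 + 2 * (p x)\<^sup>2)"
          using True by (intro mult_left_mono) (auto simp: A_def)
        then show ?thesis using True by (simp add: A_def algebra_simps)
      next
        case False
        then show ?thesis by (simp add: A_def)
      qed
    qed
    also have "\<dots> = 4 * \<delta> n - 2 * (LINT x|\<mu>. \<psi> x * (p x)\<^sup>2)"
      using int1 int2 by (simp add: \<delta>)
    also have "\<dots> \<le> 4 * \<delta> n"
      using nonneg[of "d n" "c n"] by (simp add: p_def)
    finally show ?thesis .
  qed
  moreover have "(\<lambda>n. 4 * \<delta> n) \<longlonglongrightarrow> 0"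
    unfolding \<delta>_def using conv by (intro tendsto_mult_right_zero)
  ultimately have "(LINT x|\<mu>. \<bar>\<psi> x\<bar> * indicator A x) \<le> 0"
    by (intro LIMSEQ_le_const[of "\<lambda>n. 4 * \<delta> n"]) auto
  moreover have "0 \<le> (LINT x|\<mu>. \<bar>\<psi> x\<bar> * indicator A x)" by simp
  ultimately have "(LINT x|\<mu>. \<bar>\<psi> x\<bar> * indicator A x) = 0" by simp
  moreover have "integrable \<mu> (\<lambda>x. \<bar>\<psi> x\<bar> * indicator A x)"
    by (intro Bochner_Integration.integrable_bound[OF int_abs\<psi>[of 0]]) (auto split: split_indicator)
  ultimately have "AE x in \<mu>. \<bar>\<psi> x\<bar> * indicator A x = 0"
    by (subst (asm) integral_nonneg_eq_0_iff_AE) auto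
  then show ?thesis
    by eventually_elim (auto simp: A_def split: split_indicator_asm)
qed

section \<open>Bounded densities and positive semidefinite moment matrices\<close>

lemma bounded_density:
  fixes \<mu> :: "(real ^ 'n::finite) measure"
  assumes \<mu>: "finite_measure \<mu>" "all_moments_finite \<mu>"
    and \<phi>[measurable]: "\<phi> \<in> borel_measurable \<mu>"
    and bounds: "AE x in \<mu>. 0 \<le> \<phi> x" "AE x in \<mu>. \<phi> x \<le> K"
  shows "finite_measure (density \<mu> (\<lambda>x. ennreal (\<phi> x)))"
    and "all_moments_finite (density \<mu> (\<lambda>x. ennreal (\<phi> x)))"
    and "moment (density \<mu> (\<lambda>x. ennreal (\<phi> x))) \<alpha> = (LINT x|\<mu>. \<phi> x * monomial \<alpha> x)"
    and "integrable \<mu> (\<lambda>x. \<phi> x * monomial \<alpha> x)"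
proof -
  note [measurable] = measurable_monomial[OF \<mu>]
  have int: "integrable \<mu> (\<lambda>x. \<phi> x * monomial \<alpha> x)" for \<alpha>
  proof (rule Bochner_Integration.integrable_bound)
    show "integrable \<mu> (\<lambda>x. K * monomial \<alpha> x)"
      by (intro integrable_mult_right integrable_monomial \<mu>)
    show "AE x in \<mu>. norm (\<phi> x * monomial \<alpha> x) \<le> norm (K * monomial \<alpha> x)"
      using bounds by eventually_elim (auto simp: abs_mult intro!: mult_right_mono)
  qed measurable
  then show "integrable \<mu> (\<lambda>x. \<phi> x * monomial \<alpha> x)" .
  show "all_moments_finite (density \<mu> (\<lambda>x. ennreal (\<phi> x)))"
    using int bounds(1) by (simp add: all_moments_finite_def integrable_density)
  show "moment (density \<mu> (\<lambda>x. ennreal (\<phi> x))) \<alpha> = (LINT x|\<mu>. \<phi> x * monomial \<alpha> x)"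
    using bounds(1) by (simp add: moment_def integral_density)
  have "emeasure (density \<mu> (\<lambda>x. ennreal (\<phi> x))) (space \<mu>) = (\<integral>\<^sup>+x. ennreal (\<phi> x) \<partial>\<mu>)"
    by (auto simp: emeasure_density intro!: nn_integral_cong split: split_indicator)
  also have "\<dots> < \<infinity>"
    using int[of 0] bounds(1) by (simp add: nn_integral_eq_integral)
  finally show "finite_measure (density \<mu> (\<lambda>x. ennreal (\<phi> x)))"
    by (intro finite_measureI) simp
qed

lemma sum_delta_mult:
  fixes f :: "'a \<Rightarrow> real"
  assumes "finite S" "a \<in> S"
  shows "(\<Sum>b\<in>S. f b * (if b = a then r else 0)) = f a * r"
proof -
  have "(\<Sum>b\<in>S. f b * (if b = a then r else 0)) = (\<Sum>b\<in>S. if b = a then f b * r else 0)"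
    by (intro sum.cong) auto
  then show ?thesis using assms by simp
qed

text \<open>The test vector is \<open>s\<close> times the unit vector at \<open>a\<close> plus
  \<open>t\<close> times that at \<open>b\<close>. Being a sum, it also covers \<open>a = b\<close>,
  which occurs in the applications.\<close>

lemma psd_on_two:
  assumes psd: "psd_on S A" and S: "finite S" "a \<in> S" "b \<in> S"
  shows "0 \<le> s\<^sup>2 * A a a + 2 * s * t * A a b + t\<^sup>2 * A b b"
proof -
  define \<delta> where "\<delta> r p x = (if x = p then r else 0 :: real)" for r p and x :: 'a
  have inner: "(\<Sum>y\<in>S. k * A x y * (\<delta> s a y + \<delta> t b y)) = k * (A x a * s + A x b * t)" for x k
    using sum_delta_mult[OF S(1,2), of "\<lambda>y. k * A x y" s] sum_delta_mult[OF S(1,3), of "\<lambda>y. k * A x y" t]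
    by (simp add: \<delta>_def distrib_left sum.distrib mult.assoc)
  have "0 \<le> (\<Sum>x\<in>S. \<Sum>y\<in>S. (\<delta> s a x + \<delta> t b x) * A x y * (\<delta> s a y + \<delta> t b y))"
    using psd by (simp add: psd_on_def)
  also have "\<dots> = (\<Sum>x\<in>S. (A x a * s + A x b * t) * (\<delta> s a x + \<delta> t b x))"
    by (simp only: inner) (simp only: mult.commute)
  also have "\<dots> = (A a a * s + A a b * t) * s + (A b a * s + A b b * t) * t"
    using sum_delta_mult[OF S(1,2), of "\<lambda>x. A x a * s + A x b * t" s]
      sum_delta_mult[OF S(1,3), of "\<lambda>x. A x a * s + A x b * t" t]
    by (simp add: \<delta>_def distrib_left[of "_ + _"] sum.distrib)
  also have "A b a = A a b"
    using psd S by (auto simp: psd_on_def)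
  finally show ?thesis by (simp add: power2_eq_square algebra_simps)
qed

text \<open>Vectors on \<open>S\<close> are padded by 0 to \<open>T\<close>. As \<open>A\<close> and
  \<open>B\<close> have to agree on \<open>S\<close> only, the lemma also exchanges the matrix of a
  sequence with that of its truncation.\<close>

lemma psd_on_subset:
  assumes psd: "psd_on T A" and "S \<subseteq> T" "finite T" and eq: "\<And>a b. a \<in> S \<Longrightarrow> b \<in> S \<Longrightarrow> A a b = B a b"
  shows "psd_on S B"
  unfolding psd_on_def
proof safe
  show "B a b = B b a" if "a \<in> S" "b \<in> S" for a b
  proof -
    have "A a b = A b a" using psd that \<open>S \<subseteq> T\<close> unfolding psd_on_def by blast
    then show ?thesis using eq that by simp
  qed
  fix c :: "'a \<Rightarrow> real"
  define c' where "c' a = (if a \<in> S then c a else 0)" for a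
  have "0 \<le> (\<Sum>a\<in>T. \<Sum>b\<in>T. c' a * A a b * c' b)"
    using psd by (simp add: psd_on_def)
  also have "\<dots> = (\<Sum>a\<in>S. \<Sum>b\<in>T. c' a * A a b * c' b)"
    using assms by (intro sum.mono_neutral_right) (auto simp: c'_def)
  also have "\<dots> = (\<Sum>a\<in>S. \<Sum>b\<in>S. c' a * A a b * c' b)"
    using assms by (intro sum.cong sum.mono_neutral_right) (auto simp: c'_def)
  also have "\<dots> = (\<Sum>a\<in>S. \<Sum>b\<in>S. c a * B a b * c b)"
    by (intro sum.cong) (auto simp: c'_def eq)
  finally show "0 \<le> (\<Sum>a\<in>S. \<Sum>b\<in>S. c a * B a b * c b)" .
qed

lemma psd_on_scale:
  assumes "psd_on S (moment_matrix z)" "0 \<le> r"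
  shows "psd_on S (moment_matrix (\<lambda>\<alpha>. r * z \<alpha>))"
proof -
  have "(\<Sum>a\<in>S. \<Sum>b\<in>S. c a * (r * z (a + b)) * c b) = r * (\<Sum>a\<in>S. \<Sum>b\<in>S. c a * z (a + b) * c b)" for c
    unfolding sum_distrib_left by (intro sum.cong refl) simp
  then show ?thesis
    using assms by (auto simp: psd_on_def moment_matrix_def)
qed

lemma psd_on_moment:
  assumes "finite_measure M" "all_moments_finite M"
  shows "psd_on (mindices_le d) (moment_matrix (moment M))"
  unfolding psd_on_def integral_poly_square[OF assms, symmetric]
  by (simp add: moment_matrix_def add.commute)

text \<open>Testing with the square of \<open>1 - p\<close> gives
  \<open>2 * L(p) \<le> L(1) + L(p^2)\<close>, and \<open>psd_diff\<close> bounds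
  \<open>L(p^2)\<close> by the integral of \<open>p^2\<close>: this is the lower bound that the
  variational representation requires. The sign criterion is then applied to \<open>\<phi>\<close>
  and to \<open>1 - \<phi>\<close>.\<close>

lemma psd_moments_representation:
  fixes \<mu> :: "(real ^ 'n::finite) measure"
  assumes X: "X \<in> sets borel" and sets: "sets \<mu> = sets (restrict_space borel X)"
    and \<mu>: "finite_measure \<mu>" "all_moments_finite \<mu>" "carleman (moment \<mu>)"
    and psd: "\<And>d. psd_on (mindices_le d) (moment_matrix z)"
    and psd_diff: "\<And>d. psd_on (mindices_le d) (moment_matrix (\<lambda>\<alpha>. moment \<mu> \<alpha> - z \<alpha>))"
  shows "\<exists>\<phi>\<in>borel_measurable \<mu>. (AE x in \<mu>. 0 \<le> \<phi> x) \<and> (AE x in \<mu>. \<phi> x \<le> 1)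
    \<and> (\<forall>\<alpha>. (LINT x|\<mu>. \<phi> x * monomial \<alpha> x) = z \<alpha>)"
proof -
  interpret \<mu>: finite_measure \<mu> by (rule \<mu>)
  define Q where "Q z d c = (\<Sum>\<alpha>\<in>mindices_le d. \<Sum>\<beta>\<in>mindices_le d. c \<alpha> * z (\<alpha> + \<beta>) * c \<beta>)"
    for z c :: "'n mindex \<Rightarrow> real" and d
  have Q_nonneg: "0 \<le> Q z d c" for d c
    using psd[of d] by (simp add: psd_on_def Q_def moment_matrix_def)
  have Q_diff: "0 \<le> Q (moment \<mu>) d c - Q z d c" for d c
  proof -
    have "0 \<le> Q (\<lambda>\<alpha>. moment \<mu> \<alpha> - z \<alpha>) d c"
      using psd_diff[of d] by (simp add: psd_on_def Q_def moment_matrix_def)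
    then show ?thesis by (simp add: Q_def left_diff_distrib right_diff_distrib sum_subtractf)
  qed
  have Q_\<mu>: "(LINT x|\<mu>. (poly_fun d c x)\<^sup>2) = Q (moment \<mu>) d c" for d c
    by (simp add: integral_poly_square[OF \<mu>(1,2)] Q_def moment_matrix_def)
  have "- z 0 \<le> (LINT x|\<mu>. (poly_fun d c x)\<^sup>2) - 2 * (\<Sum>\<alpha>\<in>mindices_le d. c \<alpha> * z \<alpha>)" for d c
  proof -
    define S where "S = (mindices_le d :: 'n mindex set)"
    have S: "finite S" "0 \<in> S" by (simp_all add: S_def finite_mindices_le zero_in_mindices_le)
    \<comment> \<open>The coefficient vector of the constant polynomial 1.\<close>
    define e where "e \<alpha> = (if \<alpha> = 0 then 1 else 0 :: real)" for \<alpha> :: "'n mindex"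
    have delta: "(\<Sum>\<beta>\<in>S. f \<beta> * e \<beta>) = f 0" for f
      using sum_delta_mult[OF S, of f 1] by (simp add: e_def)
    have "0 \<le> (\<Sum>\<alpha>\<in>S. \<Sum>\<beta>\<in>S. (c \<alpha> - e \<alpha>) * z (\<alpha> + \<beta>) * (c \<beta> - e \<beta>))"
      using Q_nonneg[of d "\<lambda>\<alpha>. c \<alpha> - e \<alpha>"] by (simp add: Q_def S_def)
    also have "\<dots> = (\<Sum>\<alpha>\<in>S. (c \<alpha> - e \<alpha>) * ((\<Sum>\<beta>\<in>S. z (\<alpha> + \<beta>) * c \<beta>) - z \<alpha>))"
    proof (rule sum.cong[OF refl])
      fix \<alpha>
      have "(\<Sum>\<beta>\<in>S. (c \<alpha> - e \<alpha>) * z (\<alpha> + \<beta>) * (c \<beta> - e \<beta>))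
          = (c \<alpha> - e \<alpha>) * ((\<Sum>\<beta>\<in>S. z (\<alpha> + \<beta>) * c \<beta>) - (\<Sum>\<beta>\<in>S. z (\<alpha> + \<beta>) * e \<beta>))"
        by (simp add: sum_subtractf[symmetric] sum_distrib_left right_diff_distrib mult.assoc)
      also have "(\<Sum>\<beta>\<in>S. z (\<alpha> + \<beta>) * e \<beta>) = z \<alpha>"
        by (subst delta) simp
      finally show "(\<Sum>\<beta>\<in>S. (c \<alpha> - e \<alpha>) * z (\<alpha> + \<beta>) * (c \<beta> - e \<beta>))
          = (c \<alpha> - e \<alpha>) * ((\<Sum>\<beta>\<in>S. z (\<alpha> + \<beta>) * c \<beta>) - z \<alpha>)" .
    qed
    also have "\<dots> = (\<Sum>\<alpha>\<in>S. c \<alpha> * (\<Sum>\<beta>\<in>S. z (\<alpha> + \<beta>) * c \<beta>)) - (\<Sum>\<alpha>\<in>S. c \<alpha> * z \<alpha>)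
        - (\<Sum>\<alpha>\<in>S. ((\<Sum>\<beta>\<in>S. z (\<alpha> + \<beta>) * c \<beta>) - z \<alpha>) * e \<alpha>)"
      by (simp add: left_diff_distrib right_diff_distrib sum_subtractf mult.commute)
    also have "(\<Sum>\<alpha>\<in>S. ((\<Sum>\<beta>\<in>S. z (\<alpha> + \<beta>) * c \<beta>) - z \<alpha>) * e \<alpha>) = (\<Sum>\<beta>\<in>S. c \<beta> * z \<beta>) - z 0"
      by (subst delta) (simp add: mult.commute)
    also have "(\<Sum>\<alpha>\<in>S. c \<alpha> * (\<Sum>\<beta>\<in>S. z (\<alpha> + \<beta>) * c \<beta>)) = Q z d c"
      by (simp add: Q_def S_def sum_distrib_left mult.assoc)
    finally show ?thesis
      using Q_diff[of d c] by (simp add: Q_\<mu> S_def)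
  qed
  from riesz_polynomials[OF \<mu>(1,2) this] obtain \<phi> where \<phi>[measurable]: "\<phi> \<in> borel_measurable \<mu>"
    and int: "integrable \<mu> (\<lambda>x. (\<phi> x)\<^sup>2)" and z: "\<And>\<alpha>. (LINT x|\<mu>. \<phi> x * monomial \<alpha> x) = z \<alpha>"
    by blast
  note [measurable] = measurable_monomial[OF \<mu>(1,2)]
  have int_mono: "integrable \<mu> (\<lambda>x. \<phi> x * monomial \<alpha> x)" for \<alpha>
    by (intro integrable_mult_square int integrable_monomial_square \<mu>) auto
  have int_mono': "integrable \<mu> (\<lambda>x. (1 - \<phi> x) * monomial \<alpha> x)" for \<alpha>
    using int_mono integrable_monomial[OF \<mu>(1,2)] by (simp add: left_diff_distrib)
  have "AE x in \<mu>. 0 \<le> \<phi> x"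
  proof (rule density_nonneg_of_squares[OF X sets \<mu> \<phi> int])
    show "0 \<le> (LINT x|\<mu>. \<phi> x * (poly_fun d c x)\<^sup>2)" for d c
      using Q_nonneg by (simp add: integral_mult_poly_square[OF int_mono] z Q_def)
  qed
  moreover have "AE x in \<mu>. 0 \<le> 1 - \<phi> x"
  proof (rule density_nonneg_of_squares[OF X sets \<mu>])
    show "integrable \<mu> (\<lambda>x. (1 - \<phi> x)\<^sup>2)"
    proof (rule Bochner_Integration.integrable_bound)
      show "integrable \<mu> (\<lambda>x. 2 + 2 * (\<phi> x)\<^sup>2)" using int by simp
      have "(1 - a)\<^sup>2 \<le> 2 + 2 * a\<^sup>2" for a :: real
        using zero_le_power2[of "1 + a"] by (simp add: power2_eq_square algebra_simps)
      then show "AE x in \<mu>. norm ((1 - \<phi> x)\<^sup>2) \<le> norm (2 + 2 * (\<phi> x)\<^sup>2)" by simp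
    qed measurable
    have diff: "(LINT x|\<mu>. (1 - \<phi> x) * monomial \<alpha> x) = moment \<mu> \<alpha> - z \<alpha>" for \<alpha>
      using int_mono integrable_monomial[OF \<mu>(1,2)] by (simp add: left_diff_distrib z moment_def)
    have "(LINT x|\<mu>. (1 - \<phi> x) * (poly_fun d c x)\<^sup>2) = Q (moment \<mu>) d c - Q z d c" for d c
      unfolding integral_mult_poly_square[OF int_mono'] diff Q_def
      by (simp add: left_diff_distrib right_diff_distrib sum_subtractf)
    then show "0 \<le> (LINT x|\<mu>. (1 - \<phi> x) * (poly_fun d c x)\<^sup>2)" for d c
      using Q_diff by simp
  qed measurable
  ultimately show ?thesis
    using \<phi> z by (intro bexI[of _ \<phi>]) auto
qed

lemma density_le:
  assumes "\<phi> \<in> borel_measurable M" "AE x in M. \<phi> x \<le> r" "0 \<le> r"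
  shows "density M (\<lambda>x. ennreal (\<phi> x)) \<le> scale_measure (ennreal r) M"
proof (subst le_measure)
  show "\<forall>A\<in>sets (density M (\<lambda>x. ennreal (\<phi> x))). emeasure (density M (\<lambda>x. ennreal (\<phi> x))) A \<le> emeasure (scale_measure (ennreal r) M) A"
  proof
    fix A assume "A \<in> sets (density M (\<lambda>x. ennreal (\<phi> x)))"
    then have A: "A \<in> sets M" by simp
    have "(\<integral>\<^sup>+x. ennreal (\<phi> x) * indicator A x \<partial>M) \<le> (\<integral>\<^sup>+x. ennreal r * indicator A x \<partial>M)"
      by (rule nn_integral_mono_AE, use assms(2) in eventually_elim) (auto intro!: mult_right_mono ennreal_leI)
    then show "emeasure (density M (\<lambda>x. ennreal (\<phi> x))) A \<le> emeasure (scale_measure (ennreal r) M) A"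
      using A assms(1) by (simp add: emeasure_density nn_integral_cmult_indicator)
  qed
qed simp

lemma psd_moments_measure:
  fixes \<mu> lam :: "(real ^ 'n::finite) measure"
  assumes X: "X \<in> sets borel"
    and \<mu>: "\<mu> \<in> finite_borel_measures X" "all_moments_finite \<mu>" "carleman (moment \<mu>)"
    and lam: "lam \<in> finite_borel_measures X" "all_moments_finite lam" "carleman (moment lam)"
    and \<gamma>: "\<gamma> > 0"
    and psd: "\<And>d. psd_on (mindices_le d) (moment_matrix z)"
    and psd_\<mu>: "\<And>d. psd_on (mindices_le d) (moment_matrix (\<lambda>\<alpha>. moment \<mu> \<alpha> - z \<alpha>))"
    and psd_lam: "\<And>d. psd_on (mindices_le d) (moment_matrix (\<lambda>\<alpha>. \<gamma> * moment lam \<alpha> - z \<alpha>))"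
  shows "\<exists>\<nu>\<in>finite_borel_measures X. \<nu> \<le> \<mu> \<and> \<nu> \<le> scale_measure (ennreal \<gamma>) lam \<and> moment \<nu> = z"
proof -
  have fin: "finite_measure \<mu>" "finite_measure lam"
    and sets: "sets \<mu> = sets (restrict_space borel X)" "sets lam = sets (restrict_space borel X)"
    using \<mu>(1) lam(1) by (simp_all add: finite_borel_measures_def)
  obtain \<phi> where \<phi>: "\<phi> \<in> borel_measurable \<mu>" "AE x in \<mu>. 0 \<le> \<phi> x" "AE x in \<mu>. \<phi> x \<le> 1"
    "\<And>\<alpha>. (LINT x|\<mu>. \<phi> x * monomial \<alpha> x) = z \<alpha>"
    using psd_moments_representation[OF X sets(1) fin(1) \<mu>(2,3) psd psd_\<mu>] by blast
  define \<nu>1 where "\<nu>1 = density \<mu> (\<lambda>x. ennreal (\<phi> x))"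
  \<comment> \<open>Division by \<open>\<gamma>\<close> normalises the problem over
    \<open>lam\<close>, where the representation yields a density between 0 and 1;
    \<open>\<psi>'\<close> undoes it.\<close>
  have "psd_on (mindices_le d) (moment_matrix (\<lambda>\<alpha>. (1 / \<gamma>) * z \<alpha>))" for d
    using \<gamma> by (intro psd_on_scale psd) auto
  moreover have "psd_on (mindices_le d) (moment_matrix (\<lambda>\<alpha>. moment lam \<alpha> - (1 / \<gamma>) * z \<alpha>))" for d
    using psd_on_scale[OF psd_lam[of d], of "1 / \<gamma>"] \<gamma> by (simp add: right_diff_distrib)
  ultimately obtain \<psi> where \<psi>: "\<psi> \<in> borel_measurable lam" "AE x in lam. 0 \<le> \<psi> x" "AE x in lam. \<psi> x \<le> 1"
    "\<And>\<alpha>. (LINT x|lam. \<psi> x * monomial \<alpha> x) = (1 / \<gamma>) * z \<alpha>"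
    using psd_moments_representation[OF X sets(2) fin(2) lam(2,3)] by meson
  define \<psi>' where "\<psi>' x = \<gamma> * \<psi> x" for x
  have \<psi>': "\<psi>' \<in> borel_measurable lam" "AE x in lam. 0 \<le> \<psi>' x" "AE x in lam. \<psi>' x \<le> \<gamma>"
    using \<psi>(1-3) \<gamma> by (auto simp: \<psi>'_def[abs_def])
  define \<nu>2 where "\<nu>2 = density lam (\<lambda>x. ennreal (\<psi>' x))"
  have \<nu>1: "finite_measure \<nu>1" "all_moments_finite \<nu>1" "moment \<nu>1 = z"
    using bounded_density(1-3)[OF fin(1) \<mu>(2) \<phi>(1-3)] \<phi>(4) by (auto simp: \<nu>1_def)
  have \<nu>2: "finite_measure \<nu>2" "all_moments_finite \<nu>2" "moment \<nu>2 = z"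
    using bounded_density(1-3)[OF fin(2) lam(2) \<psi>'] \<psi>(4) \<gamma> by (auto simp: \<nu>2_def \<psi>'_def mult.assoc)
  \<comment> \<open>With \<open>m\<close> for the moments of \<open>\<mu>\<close>, the chain is
    \<open>I^2 \<le> z (2\<alpha>) * z 0\<close>, \<open>z (2\<alpha>) \<le> m (2\<alpha>)\<close>
    and \<open>m (2\<alpha>)^2 \<le> m (4\<alpha>) * m 0\<close>. It sees a measure through its
    moments \<open>z\<close> alone, so it serves for \<open>\<nu>1\<close> and \<open>\<nu>2\<close>
    alike.\<close>
  define C where "C = (z 0)\<^sup>2 * moment \<mu> 0"
  have z_le: "z (\<alpha> + \<alpha>) \<le> moment \<mu> (\<alpha> + \<alpha>)" for \<alpha>
  proof -
    obtain d where "\<alpha> \<in> mindices_le d" using ex_in_mindices_le by blast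
    then show ?thesis
      using psd_on_two[OF psd_\<mu>[of d], of \<alpha> \<alpha> 1 0] by (simp add: finite_mindices_le moment_matrix_def)
  qed
  have dom: "(LINT x|\<nu>. \<bar>monomial \<alpha> x\<bar>) ^ 4 \<le> C * moment \<mu> (\<alpha> + \<alpha> + (\<alpha> + \<alpha>))"
    if \<nu>: "finite_measure \<nu>" "all_moments_finite \<nu>" "moment \<nu> = z" for \<nu> \<alpha>
  proof -
    define I where "I = (LINT x|\<nu>. \<bar>monomial \<alpha> x\<bar>)"
    have z: "0 \<le> z 0" "0 \<le> z (\<alpha> + \<alpha>)"
      using moment_square_nonneg[OF \<nu>(1,2), of 0] moment_square_nonneg[OF \<nu>(1,2), of \<alpha>] \<nu>(3) by simp_all
    have "I\<^sup>2 \<le> z (\<alpha> + \<alpha>) * z 0"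
      using Cauchy_Schwarz_monomial[OF \<nu>(1,2), of \<alpha> 0] \<nu>(3) by (simp add: I_def)
    then have "(I\<^sup>2)\<^sup>2 \<le> (z (\<alpha> + \<alpha>) * z 0)\<^sup>2" by (intro power_mono) auto
    also have "\<dots> \<le> (moment \<mu> (\<alpha> + \<alpha>) * z 0)\<^sup>2"
      using z z_le[of \<alpha>] by (intro power_mono mult_right_mono) auto
    also have "\<dots> \<le> (moment \<mu> (\<alpha> + \<alpha> + (\<alpha> + \<alpha>)) * moment \<mu> 0) * (z 0)\<^sup>2"
      using moment_add_square_le[OF fin(1) \<mu>(2), of "\<alpha> + \<alpha>" 0]
      unfolding power_mult_distrib by (intro mult_right_mono) auto
    finally show ?thesis by (simp add: C_def I_def ac_simps flip: power_mult)
  qed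
  have "\<nu>1 = \<nu>2"
  proof (rule carleman_dominated.moment_determinate[of _ _ \<mu> C])
    show "carleman_dominated \<nu>1 \<nu>2 \<mu> C"
    proof (rule carleman_dominated.intro)
      show "sets \<nu>1 = sets \<nu>2" by (simp add: \<nu>1_def \<nu>2_def sets)
      show "moment \<nu>1 = moment \<nu>2" by (simp add: \<nu>1 \<nu>2)
    qed (rule \<nu>1(1,2) \<nu>2(1,2) fin(1) \<mu>(2,3) dom[OF \<nu>1] dom[OF \<nu>2])+
    show "sets \<nu>1 = sets (restrict_space borel X)" by (simp add: \<nu>1_def sets)
  qed (rule X)
  moreover have "\<nu>1 \<le> \<mu>"
    using density_le[OF \<phi>(1,3)] by (simp add: \<nu>1_def)
  moreover have "\<nu>2 \<le> scale_measure (ennreal \<gamma>) lam"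
    unfolding \<nu>2_def using \<psi>' \<gamma> by (intro density_le) auto
  moreover have "\<nu>1 \<in> finite_borel_measures X"
    using \<nu>1(1) by (simp add: finite_borel_measures_def \<nu>1_def sets)
  ultimately show ?thesis using \<nu>1(3) by auto
qed

section \<open>Lebesgue decomposition and the largest feasible measure\<close>

text \<open>Exhaustion: \<open>N\<close> has the largest \<open>\<mu>\<close>-mass among the null
  sets of \<open>lam\<close>, so nothing singular is left off \<open>N\<close> and Radon-Nikodym
  applies there. The set \<open>N\<close> is returned because the comparison with the truncated
  density needs to know where \<open>f\<close> represents \<open>\<mu>\<close>.\<close>

lemma lebesgue_decomposition_density:
  fixes \<mu> lam :: "'a measure"
  assumes \<mu>: "finite_measure \<mu>" and lam: "finite_measure lam" and sets: "sets \<mu> = sets lam"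
  shows "\<exists>N f. N \<in> sets lam \<and> emeasure lam N = 0 \<and> integrable lam f \<and> (\<forall>x. 0 \<le> f x)
    \<and> (\<forall>B\<in>sets lam. emeasure (density lam (\<lambda>x. ennreal (f x))) B = emeasure \<mu> (B - N))"
proof -
  interpret \<mu>: finite_measure \<mu> by fact
  interpret lam: finite_measure lam by fact
  define s where "s = (SUP A\<in>null_sets lam. emeasure \<mu> A)"
  have "null_sets lam \<noteq> {}" by auto
  from ennreal_SUP_countable_SUP[OF this, of "emeasure \<mu>"] obtain e :: "nat \<Rightarrow> ennreal"
    where e: "range e \<subseteq> emeasure \<mu> ` null_sets lam" "s = Sup (range e)"
    by (auto simp: s_def)
  then have "\<forall>n. \<exists>A. A \<in> null_sets lam \<and> emeasure \<mu> A = e n"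
    by (metis image_iff range_subsetD)
  then obtain A where A: "\<And>n. A n \<in> null_sets lam" "\<And>n. emeasure \<mu> (A n) = e n"
    by metis
  define N where "N = (\<Union>n::nat. A n)"
  have N: "N \<in> null_sets lam"
    unfolding N_def using A(1) by auto
  then have N_sets[measurable]: "N \<in> sets lam" "N \<in> sets \<mu>" by (auto simp: sets)
  have s_le: "s \<le> emeasure \<mu> N"
    unfolding e(2) using N_sets(2) by (auto intro!: SUP_least emeasure_mono simp: A(2)[symmetric] N_def)
  define \<nu> where "\<nu> = density \<mu> (indicator (space \<mu> - N))"
  have \<nu>: "emeasure \<nu> B = emeasure \<mu> (B - N)" if "B \<in> sets lam" for B
  proof -
    have B: "B \<in> sets \<mu>" using that sets by simp
    have "space \<mu> - N \<in> sets \<mu>" using N_sets(2) by (rule sets.compl_sets)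
    then have "emeasure \<nu> B = (\<integral>\<^sup>+x. indicator (space \<mu> - N) x * indicator B x \<partial>\<mu>)"
      unfolding \<nu>_def using B by (intro emeasure_density) auto
    also have "\<dots> = (\<integral>\<^sup>+x. indicator (B - N) x \<partial>\<mu>)"
      using sets.sets_into_space[OF B] by (intro nn_integral_cong) (auto split: split_indicator)
    also have "\<dots> = emeasure \<mu> (B - N)"
      using B N_sets(2) by (intro nn_integral_indicator) auto
    finally show ?thesis .
  qed
  have "absolutely_continuous lam \<nu>"
    unfolding absolutely_continuous_def
  proof
    fix B assume B: "B \<in> null_sets lam"
    \<comment> \<open>A null set with mass outside \<open>N\<close> would push the mass beyond the
      supremum.\<close>
    then have "B - N \<union> N \<in> null_sets lam" using N by auto
    then have "emeasure \<mu> (B - N \<union> N) \<le> s"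
      unfolding s_def by (rule SUP_upper)
    also have "emeasure \<mu> (B - N \<union> N) = emeasure \<mu> (B - N) + emeasure \<mu> N"
    proof (rule plus_emeasure[symmetric])
      show "B - N \<in> sets \<mu>"
        unfolding sets using null_setsD2[OF B] N_sets(1) by (rule sets.Diff)
      show "N \<in> sets \<mu>" by (rule N_sets)
    qed auto
    finally have "emeasure \<mu> (B - N) + emeasure \<mu> N \<le> emeasure \<mu> N"
      using s_le by (rule order_trans)
    then have "measure \<mu> (B - N) + measure \<mu> N \<le> measure \<mu> N"
      by (simp add: \<mu>.emeasure_eq_measure flip: ennreal_plus)
    then have "emeasure \<mu> (B - N) = 0"
      using measure_nonneg[of \<mu> "B - N"] by (simp add: \<mu>.emeasure_eq_measure)
    then show "B \<in> null_sets \<nu>"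
      using B \<nu>[of B] by (auto simp: null_sets_def \<nu>_def sets)
  qed
  moreover have "finite_measure \<nu>"
    using \<nu>[of "space lam"] sets_eq_imp_space_eq[OF sets] by (intro finite_measureI) (simp add: \<nu>_def)
  ultimately obtain F where F[measurable]: "F \<in> borel_measurable lam" and FD: "density lam F = \<nu>"
    using lam.Radon_Nikodym_finite_measure[of \<nu>] by (auto simp: \<nu>_def sets)
  have F_fin: "(\<integral>\<^sup>+x. F x \<partial>lam) \<noteq> \<infinity>"
  proof -
    have "(\<integral>\<^sup>+x. F x \<partial>lam) = emeasure \<nu> (space lam)"
      unfolding FD[symmetric] by (auto simp: emeasure_density intro!: nn_integral_cong split: split_indicator)
    then show ?thesis using \<nu>[of "space lam"] by simp
  qed
  \<comment> \<open>\<open>enn2real\<close> sends the value infinity to 0, which changes the density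
    on a null set only.\<close>
  define f where "f x = enn2real (F x)" for x
  have f[measurable]: "f \<in> borel_measurable lam" unfolding f_def[abs_def] by measurable
  have F_eq: "AE x in lam. ennreal (f x) = F x"
    using nn_integral_PInf_AE[OF F F_fin] by eventually_elim (simp add: f_def less_top)
  have "density lam (\<lambda>x. ennreal (f x)) = \<nu>"
    unfolding FD[symmetric] using F_eq by (intro density_cong) auto
  moreover have "integrable lam f"
  proof (rule integrableI_nonneg)
    have "(\<integral>\<^sup>+x. ennreal (f x) \<partial>lam) = (\<integral>\<^sup>+x. F x \<partial>lam)"
      using F_eq by (rule nn_integral_cong_AE)
    then show "(\<integral>\<^sup>+x. ennreal (f x) \<partial>lam) < \<infinity>" using F_fin by (simp add: less_top)
  qed (auto simp: f_def)
  ultimately show ?thesis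
    using N \<nu> by (intro exI[of _ N] exI[of _ f]) (auto simp: f_def)
qed

section \<open>Sums, differences and order of measures\<close>

lemma nn_integral_add_measure:
  assumes sets: "sets N1 = sets M" "sets N2 = sets M"
    and add: "\<And>A. A \<in> sets M \<Longrightarrow> emeasure M A = emeasure N1 A + emeasure N2 A"
    and f: "f \<in> borel_measurable M"
  shows "(\<integral>\<^sup>+x. f x \<partial>M) = (\<integral>\<^sup>+x. f x \<partial>N1) + (\<integral>\<^sup>+x. f x \<partial>N2)"
  using f
proof (induction rule: borel_measurable_induct)
  case (cong f g)
  have "space N1 = space M" "space N2 = space M"
    using sets by (auto dest: sets_eq_imp_space_eq)
  with cong have "integral\<^sup>N N1 f = integral\<^sup>N N1 g" "integral\<^sup>N N2 f = integral\<^sup>N N2 g" "integral\<^sup>N M f = integral\<^sup>N M g"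
    by (intro nn_integral_cong; simp)+
  then show ?case using cong.IH by (simp only:)
next
  case (set A)
  then show ?case using sets add by simp
next
  case (mult u c)
  then have "u \<in> borel_measurable N1" "u \<in> borel_measurable N2"
    using sets by (simp_all cong: measurable_cong_sets)
  then show ?case using mult by (simp add: nn_integral_cmult distrib_left)
next
  case (add u v)
  then have "u \<in> borel_measurable N1" "u \<in> borel_measurable N2" "v \<in> borel_measurable N1" "v \<in> borel_measurable N2"
    using sets by (simp_all cong: measurable_cong_sets)
  then show ?case using add by (simp add: nn_integral_add ac_simps)
next
  case (seq U)
  then have m: "U i \<in> borel_measurable N1" "U i \<in> borel_measurable N2" for i
    using sets by (simp_all cong: measurable_cong_sets)
  have "incseq (\<lambda>i. \<integral>\<^sup>+x. U i x \<partial>N)" for N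
    using seq(3) by (auto simp: incseq_def le_fun_def intro!: nn_integral_mono)
  then show ?case
    using seq m by (simp add: nn_integral_monotone_convergence_SUP SUP_apply image_comp ennreal_SUP_add)
qed

lemma all_moments_finite_le:
  assumes sets: "sets \<nu> = sets \<mu>" and le: "\<nu> \<le> \<mu>" and \<mu>: "all_moments_finite \<mu>"
  shows "all_moments_finite \<nu>"
  unfolding all_moments_finite_def
proof
  fix \<alpha>
  have int: "integrable \<mu> (monomial \<alpha>)" using \<mu> by (simp add: all_moments_finite_def)
  have "(\<integral>\<^sup>+x. ennreal (norm (monomial \<alpha> x)) \<partial>\<nu>) \<le> (\<integral>\<^sup>+x. ennreal (norm (monomial \<alpha> x)) \<partial>\<mu>)"
    by (rule nn_integral_mono_measure[OF sets le])
  moreover have "monomial \<alpha> \<in> borel_measurable \<nu>"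
    using borel_measurable_integrable[OF int] sets by (simp cong: measurable_cong_sets)
  ultimately show "integrable \<nu> (monomial \<alpha>)"
    using int unfolding integrable_iff_bounded by (auto intro: le_less_trans)
qed

lemma diff_measure_props:
  fixes \<mu> \<nu> :: "'a measure"
  assumes fin: "finite_measure \<mu>" "finite_measure \<nu>" and sets: "sets \<nu> = sets \<mu>" and le: "\<nu> \<le> \<mu>"
  shows "A \<in> sets \<mu> \<Longrightarrow> emeasure \<mu> A = emeasure \<nu> A + emeasure (diff_measure \<mu> \<nu>) A"
    and "finite_measure (diff_measure \<mu> \<nu>)" and "diff_measure \<mu> \<nu> \<le> \<mu>"
proof -
  have le': "emeasure \<nu> A \<le> emeasure \<mu> A" if "A \<in> sets \<mu>" for A
    using le that sets by (simp add: le_measure)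
  have D: "emeasure (diff_measure \<mu> \<nu>) A = emeasure \<mu> A - emeasure \<nu> A" if "A \<in> sets \<mu>" for A
    by (rule emeasure_diff_measure[OF fin sets[symmetric] le' that])
  show "emeasure \<mu> A = emeasure \<nu> A + emeasure (diff_measure \<mu> \<nu>) A" if "A \<in> sets \<mu>" for A
    by (simp add: D[OF that] add_diff_inverse_ennreal[OF le'[OF that]])
  show "diff_measure \<mu> \<nu> \<le> \<mu>"
    by (subst le_measure) (auto simp: D diff_le_self_ennreal)
  show "finite_measure (diff_measure \<mu> \<nu>)"
    using D[OF sets.top] finite_measure.emeasure_finite[OF fin(1)]
    by (intro finite_measureI) (simp add: ennreal_minus_eq_top)
qed

lemma moment_diff_measure:
  fixes \<mu> \<nu> :: "(real ^ 'n::finite) measure"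
  assumes fin: "finite_measure \<mu>" "finite_measure \<nu>" and sets: "sets \<nu> = sets \<mu>" and le: "\<nu> \<le> \<mu>"
    and \<mu>: "all_moments_finite \<mu>"
  shows "all_moments_finite (diff_measure \<mu> \<nu>)"
    and "moment (diff_measure \<mu> \<nu>) \<alpha> = moment \<mu> \<alpha> - moment \<nu> \<alpha>"
proof -
  define D where "D = diff_measure \<mu> \<nu>"
  note props = diff_measure_props[OF fin sets le, folded D_def]
  have sets_D: "sets D = sets \<mu>" by (simp add: D_def)
  show D: "all_moments_finite (diff_measure \<mu> \<nu>)"
    using all_moments_finite_le[OF sets_D props(3) \<mu>] by (simp add: D_def)
  have \<nu>: "all_moments_finite \<nu>" by (rule all_moments_finite_le[OF sets le \<mu>])
  have int: "integrable \<mu> (monomial \<alpha>)" "integrable \<nu> (monomial \<alpha>)" "integrable D (monomial \<alpha>)"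
    using \<mu> \<nu> D by (simp_all add: all_moments_finite_def D_def)
  then have meas: "monomial \<alpha> \<in> borel_measurable \<mu>" by simp
  have add: "(\<integral>\<^sup>+x. ennreal (g x) \<partial>\<mu>) = (\<integral>\<^sup>+x. ennreal (g x) \<partial>\<nu>) + (\<integral>\<^sup>+x. ennreal (g x) \<partial>D)"
    if "g \<in> borel_measurable \<mu>" for g
    using that by (intro nn_integral_add_measure sets sets_D props(1)) auto
  show "moment (diff_measure \<mu> \<nu>) \<alpha> = moment \<mu> \<alpha> - moment \<nu> \<alpha>"
    using int meas unfolding moment_def D_def[symmetric]
    by (simp add: real_lebesgue_integral_def add enn2real_plus real_integrable_def less_top)
qed

text \<open>The inequality also holds on the complement, and the totals leave no room for a strict
  one. For the measure problem this makes the setwise largest feasible measure the only optimal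
  one.\<close>

lemma measure_eq_of_le:
  assumes \<kappa>: "finite_measure \<kappa>" and sets: "sets \<nu> = sets \<kappa>"
    and le: "\<And>B. B \<in> sets \<kappa> \<Longrightarrow> emeasure \<nu> B \<le> emeasure \<kappa> B"
    and total: "measure \<kappa> (space \<kappa>) \<le> measure \<nu> (space \<kappa>)"
  shows "\<nu> = \<kappa>"
proof (rule measure_eqI[OF sets])
  interpret \<kappa>: finite_measure \<kappa> by fact
  have space: "space \<nu> = space \<kappa>" using sets by (rule sets_eq_imp_space_eq)
  interpret \<nu>: finite_measure \<nu>
    using le[of "space \<kappa>"] space by (intro finite_measureI) (auto simp: top_unique)
  have le_real: "measure \<nu> B \<le> measure \<kappa> B" if "B \<in> sets \<kappa>" for B
    using le[OF that] by (simp add: \<nu>.emeasure_eq_measure \<kappa>.emeasure_eq_measure)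
  fix B assume "B \<in> sets \<nu>"
  then have B: "B \<in> sets \<kappa>" "B \<in> sets \<nu>" by (simp_all add: sets)
  have "measure \<nu> (space \<kappa> - B) \<le> measure \<kappa> (space \<kappa> - B)"
    using B by (intro le_real) auto
  then have "measure \<nu> B = measure \<kappa> B"
    using le_real[OF B(1)] total \<nu>.finite_measure_compl[OF B(2)] \<kappa>.finite_measure_compl[OF B(1)]
    by (simp add: space)
  then show "emeasure \<nu> B = emeasure \<kappa> B"
    by (simp add: \<nu>.emeasure_eq_measure \<kappa>.emeasure_eq_measure)
qed

text \<open>The set is cut along \<open>f < \<gamma>\<close>. There, off \<open>N\<close>, the bound
  by \<open>\<mu>\<close> is the sharper one; on the rest it is the bound by \<open>\<gamma>\<close>
  times \<open>lam\<close>, which also makes \<open>N\<close> null for \<open>\<nu>\<close>.\<close>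

lemma le_truncated_density:
  fixes \<mu> lam \<nu> :: "'a measure"
  assumes sets: "sets \<mu> = sets lam" "sets \<nu> = sets lam"
    and N: "N \<in> sets lam" "emeasure lam N = 0"
    and f[measurable]: "f \<in> borel_measurable lam"
    and fN: "\<And>B. B \<in> sets lam \<Longrightarrow> emeasure (density lam (\<lambda>x. ennreal (f x))) B = emeasure \<mu> (B - N)"
    and \<nu>: "\<nu> \<le> \<mu>" "\<nu> \<le> scale_measure (ennreal \<gamma>) lam" and B: "B \<in> sets lam"
  shows "emeasure \<nu> B \<le> emeasure (density lam (\<lambda>x. ennreal (min \<gamma> (f x)))) B"
proof -
  define \<kappa> where "\<kappa> = density lam (\<lambda>x. ennreal (min \<gamma> (f x)))"
  have le: "emeasure \<nu> A \<le> emeasure \<mu> A" "emeasure \<nu> A \<le> ennreal \<gamma> * emeasure lam A" if "A \<in> sets lam" for A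
    using \<nu> that sets by (simp_all add: le_measure)
  define E where "E = {x \<in> space lam. f x < \<gamma>}"
  have E: "E \<in> sets lam" unfolding E_def by measurable
  have \<nu>N: "emeasure \<nu> N = 0"
    using le(2)[OF N(1)] N(2) by simp
  have "emeasure \<nu> B \<le> emeasure \<nu> ((B \<inter> E - N) \<union> (B - E) \<union> N)"
    using B E N(1) sets(2) by (intro emeasure_mono) auto
  also have "\<dots> \<le> emeasure \<nu> ((B \<inter> E - N) \<union> (B - E)) + emeasure \<nu> N"
    by (rule emeasure_subadditive) (use B E N(1) sets(2) in simp_all)
  also have "\<dots> \<le> emeasure \<nu> (B \<inter> E - N) + emeasure \<nu> (B - E)"
    unfolding \<nu>N add_0_right by (rule emeasure_subadditive) (use B E N(1) sets(2) in simp_all)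
  also have "\<dots> \<le> emeasure \<mu> (B \<inter> E - N) + ennreal \<gamma> * emeasure lam (B - E)"
    using B E N(1) by (intro add_mono le) auto
  also have "emeasure \<mu> (B \<inter> E - N) = emeasure \<kappa> (B \<inter> E)"
  proof -
    have "emeasure \<mu> (B \<inter> E - N) = (\<integral>\<^sup>+x. ennreal (f x) * indicator (B \<inter> E) x \<partial>lam)"
      using B E by (subst fN[symmetric]) (auto simp: emeasure_density)
    also have "\<dots> = (\<integral>\<^sup>+x. ennreal (min \<gamma> (f x)) * indicator (B \<inter> E) x \<partial>lam)"
      by (intro nn_integral_cong) (auto simp: E_def split: split_indicator)
    also have "\<dots> = emeasure \<kappa> (B \<inter> E)"
      unfolding \<kappa>_def using B E by (subst emeasure_density) auto
    finally show ?thesis .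
  qed
  also have "ennreal \<gamma> * emeasure lam (B - E) = emeasure \<kappa> (B - E)"
  proof -
    have "ennreal \<gamma> * emeasure lam (B - E) = (\<integral>\<^sup>+x. ennreal \<gamma> * indicator (B - E) x \<partial>lam)"
      using B E by (subst nn_integral_cmult_indicator) auto
    also have "\<dots> = (\<integral>\<^sup>+x. ennreal (min \<gamma> (f x)) * indicator (B - E) x \<partial>lam)"
      by (intro nn_integral_cong) (auto simp: E_def split: split_indicator)
    also have "\<dots> = emeasure \<kappa> (B - E)"
      unfolding \<kappa>_def using B E by (subst emeasure_density) auto
    finally show ?thesis .
  qed
  also have "emeasure \<kappa> (B \<inter> E) + emeasure \<kappa> (B - E) = emeasure \<kappa> ((B \<inter> E) \<union> (B - E))"
    by (rule plus_emeasure) (use B E in \<open>auto simp: \<kappa>_def\<close>)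
  also have "(B \<inter> E) \<union> (B - E) = B" by auto
  finally show ?thesis unfolding \<kappa>_def .
qed

section \<open>Convergence of the semidefinite programs\<close>

lemma pointwise_convergent_subseq:
  fixes f :: "nat \<Rightarrow> 'a \<Rightarrow> real"
  assumes countable: "countable (UNIV :: 'a set)" and bounded: "\<And>a. Bseq (\<lambda>n. f n a)"
  shows "\<exists>r. strict_mono r \<and> (\<forall>a. convergent (\<lambda>n. f (r n) a))"
proof -
  define e :: "nat \<Rightarrow> 'a" where "e = from_nat_into UNIV"
  interpret subseqs "\<lambda>k s. convergent (\<lambda>n. f (s n) (e k))"
  proof
    fix k and s :: "nat \<Rightarrow> nat" assume "strict_mono s"
    obtain r where r: "strict_mono r" "monoseq (\<lambda>n. f (s (r n)) (e k))"
      using seq_monosub[of "\<lambda>n. f (s n) (e k)"] by auto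
    have "Bseq (\<lambda>n. f (s (r n)) (e k))"
      using Bseq_subseq[OF bounded[of "e k"], of "s \<circ> r"] by simp
    with r show "\<exists>r. strict_mono r \<and> convergent (\<lambda>n. f ((s \<circ> r) n) (e k))"
      using Bseq_monoseq_convergent by auto
  qed
  have "convergent (\<lambda>n. f (diagseq n) a)" for a
  proof -
    obtain k where k: "e k = a"
      using countable range_from_nat_into[of "UNIV :: 'a set"] unfolding e_def
      by (metis UNIV_I UNIV_not_empty imageE)
    \<comment> \<open>The diagonal sequence is used as a subsequence of the k-th selection from
      index \<open>Suc k\<close> on; the shift is removed afterwards.\<close>
    have "convergent (\<lambda>n. f ((diagseq \<circ> (+) (Suc k)) n) (e k))"
    proof (rule diagseq_holds)
      fix r s :: "nat \<Rightarrow> nat" and n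
      assume "strict_mono r" "convergent (\<lambda>m. f (s m) (e n))"
      then show "convergent (\<lambda>m. f ((s \<circ> r) m) (e n))"
        using convergent_subseq_convergent[of "\<lambda>m. f (s m) (e n)" r] by (simp add: o_def)
    qed
    then have "convergent (\<lambda>n. f (diagseq (n + Suc k)) a)"
      by (simp add: k o_def add.commute)
    then show ?thesis
      using convergent_ignore_initial_segment[of "\<lambda>n. f (diagseq n) a" "Suc k"] by simp
  qed
  then show ?thesis using subseq_diagseq by blast
qed

lemma countable_mindex: "countable (UNIV :: 'n::finite mindex set)"
proof -
  have "(UNIV :: 'n mindex set) = (\<Union>d. mindices_le d)"
    using ex_in_mindices_le by auto
  also have "countable (\<Union>d. mindices_le d :: 'n mindex set)"
    by (rule countable_UN) (auto intro: countable_finite finite_mindices_le)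
  finally show ?thesis .
qed

section \<open>Limits, bounds and truncations of feasible points\<close>

lemma psd_on_limit:
  assumes lim: "\<And>\<alpha>. (\<lambda>n. f n \<alpha>) \<longlonglongrightarrow> z \<alpha>"
    and psd: "\<forall>\<^sub>F n in sequentially. psd_on S (moment_matrix (f n))"
  shows "psd_on S (moment_matrix z)"
  unfolding psd_on_def moment_matrix_def
proof safe
  fix c
  have "(\<lambda>n. \<Sum>a\<in>S. \<Sum>b\<in>S. c a * f n (a + b) * c b) \<longlonglongrightarrow> (\<Sum>a\<in>S. \<Sum>b\<in>S. c a * z (a + b) * c b)"
    by (intro tendsto_intros lim)
  moreover have "\<forall>\<^sub>F n in sequentially. 0 \<le> (\<Sum>a\<in>S. \<Sum>b\<in>S. c a * f n (a + b) * c b)"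
    using psd by eventually_elim (simp add: psd_on_def moment_matrix_def)
  ultimately show "0 \<le> (\<Sum>a\<in>S. \<Sum>b\<in>S. c a * z (a + b) * c b)"
    by (rule tendsto_lowerbound) simp
qed (simp add: add.commute)

text \<open>Eliminating \<open>u\<close> and \<open>v\<close> leaves conditions on \<open>y\<close>
  alone, at a fixed level \<open>e\<close> where limits can be taken while \<open>d\<close> grows.
  Sums of two indices of degree at most \<open>d\<close> have degree at most \<open>2 * d\<close>,
  so the linear constraints reach every matrix entry.\<close>

lemma sdp_feasible_psd:
  assumes feas: "sdp_feasible m l \<gamma> d (y, u, v)" and "e \<le> d"
  shows "psd_on (mindices_le e) (moment_matrix y)"
    and "psd_on (mindices_le e) (moment_matrix (\<lambda>\<alpha>. m \<alpha> - y \<alpha>))"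
    and "psd_on (mindices_le e) (moment_matrix (\<lambda>\<alpha>. \<gamma> * l \<alpha> - y \<alpha>))"
proof -
  have sub: "mindices_le e \<subseteq> mindices_le d" by (rule mindices_le_mono) fact
  have eqs: "v (a + b) = m (a + b) - y (a + b)" "u (a + b) = \<gamma> * l (a + b) - y (a + b)"
    if "a \<in> mindices_le e" "b \<in> mindices_le e" for a b
  proof -
    have "a + b \<in> mindices_le (2 * d)"
      using add_in_mindices_le[of a d b d] that sub by (auto simp: mult_2)
    then have "y (a + b) + v (a + b) = m (a + b) \<and> y (a + b) + u (a + b) = \<gamma> * l (a + b)"
      using feas by (simp add: sdp_feasible_def)
    then show "v (a + b) = m (a + b) - y (a + b)" "u (a + b) = \<gamma> * l (a + b) - y (a + b)" by auto
  qed
  show "psd_on (mindices_le e) (moment_matrix y)"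
    by (rule psd_on_subset[OF _ sub finite_mindices_le, of "moment_matrix y"])
       (use feas in \<open>auto simp: sdp_feasible_def\<close>)
  show "psd_on (mindices_le e) (moment_matrix (\<lambda>\<alpha>. m \<alpha> - y \<alpha>))"
    by (rule psd_on_subset[OF _ sub finite_mindices_le, of "moment_matrix v"])
       (use feas in \<open>auto simp: sdp_feasible_def moment_matrix_def eqs\<close>)
  show "psd_on (mindices_le e) (moment_matrix (\<lambda>\<alpha>. \<gamma> * l \<alpha> - y \<alpha>))"
    by (rule psd_on_subset[OF _ sub finite_mindices_le, of "moment_matrix u"])
       (use feas in \<open>auto simp: sdp_feasible_def moment_matrix_def eqs\<close>)
qed

text \<open>The rows 0 and \<alpha>, tested with \<open>(1, 1)\<close> and \<open>(1, -1)\<close>,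
  bound \<open>y \<alpha>\<close> by diagonal entries, and these are at most the corresponding
  values of \<open>m\<close>. Independence of \<open>d\<close> yields convergent
  subsequences.\<close>

lemma sdp_feasible_bound:
  assumes feas: "sdp_feasible m l \<gamma> d (y, u, v)" and \<alpha>: "\<alpha> \<in> mindices_le d"
  shows "\<bar>y \<alpha>\<bar> \<le> (m 0 + m (\<alpha> + \<alpha>)) / 2"
proof -
  note two = psd_on_two[OF _ finite_mindices_le]
  note psd = sdp_feasible_psd[OF feas order_refl]
  have "0 \<le> m 0 - y 0" "0 \<le> m (\<alpha> + \<alpha>) - y (\<alpha> + \<alpha>)"
    using two[OF psd(2) zero_in_mindices_le \<alpha>, of 1 0] two[OF psd(2) zero_in_mindices_le \<alpha>, of 0 1]
    by (simp_all add: moment_matrix_def)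
  moreover have "0 \<le> y 0 + 2 * y \<alpha> + y (\<alpha> + \<alpha>)" "0 \<le> y 0 - 2 * y \<alpha> + y (\<alpha> + \<alpha>)"
    using two[OF psd(1) zero_in_mindices_le \<alpha>, of 1 1] two[OF psd(1) zero_in_mindices_le \<alpha>, of 1 "-1"]
    by (simp_all add: moment_matrix_def)
  ultimately have "2 * y \<alpha> \<le> m 0 + m (\<alpha> + \<alpha>)" "2 * - y \<alpha> \<le> m 0 + m (\<alpha> + \<alpha>)"
    by linarith+
  then show ?thesis by (simp add: abs_le_iff)
qed

text \<open>The matrix of order \<open>d\<close> sees only indices of degree at most
  \<open>2 * d\<close>, so it survives the truncation. A single sequence thus competes in every
  program.\<close>

lemma sdp_feasible_truncate:
  assumes "\<And>d. psd_on (mindices_le d) (moment_matrix z)"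
    and "\<And>d. psd_on (mindices_le d) (moment_matrix (\<lambda>\<alpha>. \<gamma> * l \<alpha> - z \<alpha>))"
    and "\<And>d. psd_on (mindices_le d) (moment_matrix (\<lambda>\<alpha>. m \<alpha> - z \<alpha>))"
  defines "tr \<equiv> \<lambda>d w \<alpha>. if \<alpha> \<in> mindices_le (2 * d) then w \<alpha> else 0"
  shows "sdp_feasible m l \<gamma> d (tr d z, tr d (\<lambda>\<alpha>. \<gamma> * l \<alpha> - z \<alpha>), tr d (\<lambda>\<alpha>. m \<alpha> - z \<alpha>))"
proof -
  have "psd_on (mindices_le d) (moment_matrix (tr d w))"
    if "psd_on (mindices_le d) (moment_matrix w)" for w :: "'a mindex \<Rightarrow> real"
  proof (rule psd_on_subset[OF that order_refl finite_mindices_le])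
    show "moment_matrix w a b = moment_matrix (tr d w) a b" if "a \<in> mindices_le d" "b \<in> mindices_le d" for a b
      using add_in_mindices_le[OF that] by (simp add: moment_matrix_def tr_def mult_2)
  qed
  then show ?thesis
    using assms(1-3) by (auto simp: sdp_feasible_def tr_def)
qed

lemma tendsto_of_subseq:
  fixes f :: "nat \<Rightarrow> real"
  assumes "\<And>r :: nat \<Rightarrow> nat. strict_mono r \<Longrightarrow> \<exists>s :: nat \<Rightarrow> nat. strict_mono s \<and> (\<lambda>n. f (r (s n))) \<longlonglongrightarrow> L"
  shows "f \<longlonglongrightarrow> L"
proof (rule ccontr)
  assume "\<not> f \<longlonglongrightarrow> L"
  then obtain e where e: "e > 0" "\<not> (\<forall>\<^sub>F n in sequentially. dist (f n) L < e)"
    by (auto simp: tendsto_iff)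
  then have "infinite {n. \<not> dist (f n) L < e}"
    by (simp add: frequently_def[symmetric] cofinite_eq_sequentially[symmetric] eventually_cofinite)
  then obtain r :: "nat \<Rightarrow> nat" where r: "strict_mono r" "\<And>n. \<not> dist (f (r n)) L < e"
    using infinite_enumerate[of "{n. \<not> dist (f n) L < e}"] by auto
  from assms[OF r(1)] obtain s where "(\<lambda>n. f (r (s n))) \<longlonglongrightarrow> L" by blast
  then have "\<forall>\<^sub>F n in sequentially. dist (f (r (s n))) L < e"
    using e(1) by (rule tendstoD)
  then show False using r(2) by (auto simp: eventually_sequentially)
qed

text \<open>Optimality enters through the lower bound \<open>r\<close> on \<open>y d 0\<close>. Each
  limit point has a feasible representing measure of mass at least \<open>r\<close>, whose moments
  \<open>unique\<close> identifies, so all subsequences share one limit.\<close>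

lemma sdp_optimal_tendsto:
  fixes \<mu> lam :: "(real ^ 'n::finite) measure"
  assumes X: "X \<in> sets borel"
    and \<mu>: "\<mu> \<in> finite_borel_measures X" "all_moments_finite \<mu>" "carleman (moment \<mu>)"
    and lam: "lam \<in> finite_borel_measures X" "all_moments_finite lam" "carleman (moment lam)"
    and \<gamma>: "\<gamma> > 0"
    and feas: "\<And>d. d \<ge> 1 \<Longrightarrow> sdp_feasible (moment \<mu>) (moment lam) \<gamma> d (y d, u d, v d)"
    and ge: "\<And>d. d \<ge> 1 \<Longrightarrow> r \<le> y d 0"
    and unique: "\<And>\<nu>. \<nu> \<in> finite_borel_measures X \<Longrightarrow> \<nu> \<le> \<mu> \<Longrightarrow> \<nu> \<le> scale_measure (ennreal \<gamma>) lam
        \<Longrightarrow> r \<le> moment \<nu> 0 \<Longrightarrow> moment \<nu> = z"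
  shows "(\<lambda>d. y d \<alpha>) \<longlonglongrightarrow> z \<alpha>"
proof (rule tendsto_of_subseq)
  fix s :: "nat \<Rightarrow> nat" assume s: "strict_mono s"
  have bounded: "Bseq (\<lambda>n. y (s n) \<beta>)" for \<beta>
  proof -
    obtain e where e: "\<beta> \<in> mindices_le e" using ex_in_mindices_le by blast
    have "norm (y d \<beta>) \<le> (moment \<mu> 0 + moment \<mu> (\<beta> + \<beta>)) / 2" if "d \<ge> max 1 e" for d
      using sdp_feasible_bound[OF feas, of d \<beta>] that e mindices_le_mono[of e d] by auto
    then have "Bseq (\<lambda>d. y d \<beta>)"
      by (intro BfunI[of _ "(moment \<mu> 0 + moment \<mu> (\<beta> + \<beta>)) / 2"] eventually_sequentiallyI[of "max 1 e"])
    then show ?thesis by (rule Bseq_subseq)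
  qed
  obtain t where t: "strict_mono t" "\<And>\<beta>. convergent (\<lambda>n. y (s (t n)) \<beta>)"
    using pointwise_convergent_subseq[OF countable_mindex, of "\<lambda>n. y (s n)"] bounded by auto
  define w where "w \<beta> = lim (\<lambda>n. y (s (t n)) \<beta>)" for \<beta>
  have lim: "(\<lambda>n. y (s (t n)) \<beta>) \<longlonglongrightarrow> w \<beta>" for \<beta>
    using t(2) by (simp add: w_def convergent_LIMSEQ_iff)
  have st: "n \<le> s (t n)" for n
    using seq_suble[OF strict_mono_o[OF s t(1)], of n] by simp
  have large: "\<forall>\<^sub>F n in sequentially. P (s (t n))" if "\<And>d. d \<ge> max 1 e \<Longrightarrow> P d" for P and e :: nat
    using st that by (intro eventually_sequentiallyI[of "max 1 e"]) (meson order_trans)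
  have "\<exists>\<nu>\<in>finite_borel_measures X. \<nu> \<le> \<mu> \<and> \<nu> \<le> scale_measure (ennreal \<gamma>) lam \<and> moment \<nu> = w"
  proof (rule psd_moments_measure[OF X \<mu> lam \<gamma>])
    fix e
    show "psd_on (mindices_le e) (moment_matrix w)"
      by (rule psd_on_limit[OF lim], rule large[of e]) (rule sdp_feasible_psd[OF feas], auto)
    show "psd_on (mindices_le e) (moment_matrix (\<lambda>\<alpha>. moment \<mu> \<alpha> - w \<alpha>))"
      by (rule psd_on_limit[OF tendsto_diff[OF tendsto_const lim]], rule large[of e])
         (rule sdp_feasible_psd[OF feas], auto)
    show "psd_on (mindices_le e) (moment_matrix (\<lambda>\<alpha>. \<gamma> * moment lam \<alpha> - w \<alpha>))"
      by (rule psd_on_limit[OF tendsto_diff[OF tendsto_const lim]], rule large[of e])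
         (rule sdp_feasible_psd[OF feas], auto)
  qed
  then obtain \<nu> where \<nu>: "\<nu> \<in> finite_borel_measures X" "\<nu> \<le> \<mu>" "\<nu> \<le> scale_measure (ennreal \<gamma>) lam"
    "moment \<nu> = w" by blast
  have "r \<le> w 0"
    by (rule tendsto_lowerbound[OF lim large[of 1]]) (auto intro: ge)
  then have "w = z" using unique[OF \<nu>(1-3)] \<nu>(4) by simp
  then show "\<exists>t. strict_mono t \<and> (\<lambda>n. y (s (t n)) \<alpha>) \<longlonglongrightarrow> z \<alpha>"
    using t(1) lim by blast
qed

theorem theorem3p4:
  fixes X :: "(real ^ 'n::finite) set"
    and \<mu> lam :: "(real ^ 'n) measure"
    and \<gamma> :: real
    and y v u :: "nat \<Rightarrow> 'n mindex \<Rightarrow> real"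
  assumes "X \<in> sets borel"
    and "\<mu> \<in> finite_borel_measures X" and "lam \<in> finite_borel_measures X"
    and "all_moments_finite \<mu>" and "all_moments_finite lam"
    and "carleman (moment \<mu>)" and "carleman (moment lam)"
    and "\<gamma> > 0"
    and "\<And>d. d \<ge> 1 \<Longrightarrow> sdp_optimal (moment \<mu>) (moment lam) \<gamma> d (y d, u d, v d)"
  shows "\<exists>ystar vstar ustar \<nu>\<gamma> \<nu>star fstar.
    (\<forall>\<alpha>. (\<lambda>d. y d \<alpha>) \<longlonglongrightarrow> ystar \<alpha> \<and>
         (\<lambda>d. v d \<alpha>) \<longlonglongrightarrow> vstar \<alpha> \<and> vstar \<alpha> = moment \<mu> \<alpha> - ystar \<alpha> \<and>
         (\<lambda>d. u d \<alpha>) \<longlonglongrightarrow> ustar \<alpha> \<and> ustar \<alpha> = \<gamma> * moment lam \<alpha> - ystar \<alpha>) \<and>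
    all_moments_finite \<nu>\<gamma> \<and> ystar = moment \<nu>\<gamma> \<and>
    \<nu>\<gamma> \<le> \<mu> \<and>
    measure_optimal X \<mu> lam \<gamma> \<nu>\<gamma> \<and>
    (\<forall>\<nu>. measure_optimal X \<mu> lam \<gamma> \<nu> \<longrightarrow> \<nu> = \<nu>\<gamma>) \<and>
    lebesgue_decomposition \<mu> lam \<nu>star (diff_measure \<mu> \<nu>star) \<and>
    integrable lam fstar \<and> (AE x in lam. 0 \<le> fstar x) \<and>
    \<nu>star = density lam (\<lambda>x. ennreal (fstar x)) \<and>
    \<nu>\<gamma> = density lam (\<lambda>x. ennreal (min \<gamma> (fstar x))) \<and>
    (\<lambda>x. min \<gamma> (fstar x)) \<in> borel_measurable lam \<and>
    esssup lam (\<lambda>x. ereal \<bar>min \<gamma> (fstar x)\<bar>) \<le> ereal \<gamma> \<and>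
    all_moments_finite (diff_measure \<mu> \<nu>\<gamma>) \<and> vstar = moment (diff_measure \<mu> \<nu>\<gamma>)"
proof -
  have fin: "finite_measure \<mu>" "finite_measure lam"
    and sets: "sets \<mu> = sets (restrict_space borel X)" "sets lam = sets (restrict_space borel X)"
    using assms(2,3) by (simp_all add: finite_borel_measures_def)
  have sets_eq: "sets \<mu> = sets lam" using sets by simp
  have space: "space M = X" if "sets M = sets (restrict_space borel X)" for M :: "(real ^ 'n) measure"
    using sets_eq_imp_space_eq[OF that] by (simp add: space_restrict_space)
  \<comment> \<open>The moment at 0 links the objectives of the two problems.\<close>
  have moment_0: "moment M 0 = measure M X" if "M \<in> finite_borel_measures X" for M :: "(real ^ 'n) measure"
    using that space[of M] by (simp add: moment_def finite_borel_measures_def)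
  obtain N f where N: "N \<in> sets lam" "emeasure lam N = 0" and f: "integrable lam f" "\<And>x. 0 \<le> f x"
    and fN: "\<And>B. B \<in> sets lam \<Longrightarrow> emeasure (density lam (\<lambda>x. ennreal (f x))) B = emeasure \<mu> (B - N)"
    using lebesgue_decomposition_density[OF fin sets_eq] by blast
  have f_meas[measurable]: "f \<in> borel_measurable lam" using f(1) by simp
  define \<nu>star where "\<nu>star = density lam (\<lambda>x. ennreal (f x))"
  \<comment> \<open>The pointwise largest density compatible with both constraints.\<close>
  define \<kappa> where "\<kappa> = density lam (\<lambda>x. ennreal (min \<gamma> (f x)))"
  have min_bounds: "AE x in lam. 0 \<le> min \<gamma> (f x)" "AE x in lam. min \<gamma> (f x) \<le> \<gamma>"
    using f(2) \<open>\<gamma> > 0\<close> by auto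
  have sets_\<kappa>: "sets \<kappa> = sets \<mu>" "sets \<kappa> = sets lam" and sets_\<nu>star: "sets \<nu>star = sets \<mu>"
    by (simp_all add: \<kappa>_def \<nu>star_def sets)
  note \<kappa>_props = bounded_density[OF fin(2) assms(5) _ min_bounds, folded \<kappa>_def]
  have \<kappa>: "\<kappa> \<in> finite_borel_measures X" "all_moments_finite \<kappa>"
    using \<kappa>_props(1,2) by (simp_all add: finite_borel_measures_def sets_\<kappa> sets)
  have \<nu>star_le: "\<nu>star \<le> \<mu>"
    using N by (subst le_measure) (auto simp: \<nu>star_def fN sets_eq intro!: emeasure_mono)
  have "\<kappa> \<le> \<nu>star"
    by (subst le_measure)
       (auto simp: \<kappa>_def \<nu>star_def emeasure_density intro!: nn_integral_mono mult_right_mono ennreal_leI)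
  then have \<kappa>_le: "\<kappa> \<le> \<mu>" using \<nu>star_le by (rule order_trans)
  have \<kappa>_le_lam: "\<kappa> \<le> scale_measure (ennreal \<gamma>) lam"
    unfolding \<kappa>_def using min_bounds \<open>\<gamma> > 0\<close> by (intro density_le) auto
  have max: "emeasure \<nu> B \<le> emeasure \<kappa> B"
    if "\<nu> \<in> finite_borel_measures X" "\<nu> \<le> \<mu>" "\<nu> \<le> scale_measure (ennreal \<gamma>) lam" "B \<in> sets lam" for \<nu> B
    unfolding \<kappa>_def using that
    by (intro le_truncated_density[OF sets_eq _ N f_meas fN]) (auto simp: finite_borel_measures_def sets)
  have unique: "\<nu> = \<kappa>"
    if \<nu>: "\<nu> \<in> finite_borel_measures X" "\<nu> \<le> \<mu>" "\<nu> \<le> scale_measure (ennreal \<gamma>) lam"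
      and ge: "measure \<kappa> X \<le> measure \<nu> X" for \<nu>
  proof (rule measure_eq_of_le)
    show "finite_measure \<kappa>" using \<kappa> by (simp add: finite_borel_measures_def)
    show "sets \<nu> = sets \<kappa>" using \<nu>(1) by (simp add: finite_borel_measures_def sets_\<kappa> sets)
    show "emeasure \<nu> B \<le> emeasure \<kappa> B" if "B \<in> sets \<kappa>" for B
      using max[OF \<nu>] that by (simp add: sets_\<kappa>(2))
    show "measure \<kappa> (space \<kappa>) \<le> measure \<nu> (space \<kappa>)"
      using ge space[of \<kappa>] by (simp add: sets_\<kappa> sets)
  qed
  have \<kappa>_optimal: "measure_optimal X \<mu> lam \<gamma> \<kappa>"
    unfolding measure_optimal_def is_arg_max_linorder
  proof (intro conjI allI impI)
    fix \<nu> assume \<nu>: "\<nu> \<in> finite_borel_measures X \<and> \<nu> \<le> \<mu> \<and> \<nu> \<le> scale_measure (ennreal \<gamma>) lam"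
    have "X \<in> sets lam" using sets.top[of lam] space[OF sets(2)] by simp
    then have "emeasure \<nu> X \<le> emeasure \<kappa> X" using max \<nu> by blast
    then show "measure \<nu> X \<le> measure \<kappa> X"
      using \<nu> \<kappa>(1) by (simp add: finite_borel_measures_def finite_measure.emeasure_eq_measure)
  qed (rule \<kappa> \<kappa>_le \<kappa>_le_lam)+
  have \<kappa>_unique: "\<nu> = \<kappa>" if "measure_optimal X \<mu> lam \<gamma> \<nu>" for \<nu>
    using that \<kappa>(1) \<kappa>_le \<kappa>_le_lam unfolding measure_optimal_def is_arg_max_linorder
    by (intro unique) blast+
  have fin_\<kappa>: "finite_measure \<kappa>" using \<kappa>(1) by (simp add: finite_borel_measures_def)
  note diff_\<kappa> = moment_diff_measure[OF fin(1) fin_\<kappa> sets_\<kappa>(1) \<kappa>_le assms(4)]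
  have psd: "psd_on (mindices_le d) (moment_matrix (moment \<kappa>))"
    "psd_on (mindices_le d) (moment_matrix (\<lambda>\<alpha>. \<gamma> * moment lam \<alpha> - moment \<kappa> \<alpha>))"
    "psd_on (mindices_le d) (moment_matrix (\<lambda>\<alpha>. moment \<mu> \<alpha> - moment \<kappa> \<alpha>))" for d
  proof -
    show "psd_on (mindices_le d) (moment_matrix (moment \<kappa>))"
      by (rule psd_on_moment[OF fin_\<kappa> \<kappa>(2)])
    show "psd_on (mindices_le d) (moment_matrix (\<lambda>\<alpha>. moment \<mu> \<alpha> - moment \<kappa> \<alpha>))"
      using psd_on_moment[OF diff_measure_props(2)[OF fin(1) fin_\<kappa> sets_\<kappa>(1) \<kappa>_le] diff_\<kappa>(1)]
      unfolding diff_\<kappa>(2)[abs_def] .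
    \<comment> \<open>The slack of the constraint by \<open>\<gamma>\<close> times
      \<open>lam\<close> is again a bounded density, so its moment matrix is positive
      semidefinite.\<close>
    have rest: "AE x in lam. 0 \<le> \<gamma> - min \<gamma> (f x)" "AE x in lam. \<gamma> - min \<gamma> (f x) \<le> \<gamma>"
      using f(2) \<open>\<gamma> > 0\<close> by auto
    note rest_props = bounded_density[OF fin(2) assms(5) _ rest]
    have rest_moment: "moment (density lam (\<lambda>x. ennreal (\<gamma> - min \<gamma> (f x)))) \<alpha> = \<gamma> * moment lam \<alpha> - moment \<kappa> \<alpha>" for \<alpha>
      using \<kappa>_props(4)[of \<alpha>] integrable_monomial[OF fin(2) assms(5), of \<alpha>]
      by (simp add: rest_props(3) \<kappa>_props(3) left_diff_distrib moment_def[of lam])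
    show "psd_on (mindices_le d) (moment_matrix (\<lambda>\<alpha>. \<gamma> * moment lam \<alpha> - moment \<kappa> \<alpha>))"
      using psd_on_moment[OF rest_props(1,2), of d] unfolding rest_moment[abs_def] by simp
  qed
  have feas: "sdp_feasible (moment \<mu>) (moment lam) \<gamma> d (y d, u d, v d)" if "d \<ge> 1" for d
    using assms(9)[OF that] by (simp add: sdp_optimal_def is_arg_max_linorder)
  \<comment> \<open>Each optimum is compared with one feasible point, the truncated moments of
    \<open>\<kappa>\<close>.\<close>
  have ge: "moment \<kappa> 0 \<le> y d 0" if "d \<ge> 1" for d
  proof -
    have "\<forall>w. sdp_feasible (moment \<mu>) (moment lam) \<gamma> d w \<longrightarrow> (case w of (y, u, v) \<Rightarrow> y 0) \<le> y d 0"
      using assms(9)[OF that] by (simp add: sdp_optimal_def is_arg_max_linorder)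
    from this[rule_format, OF sdp_feasible_truncate[OF psd]] show ?thesis
      by (simp add: zero_in_mindices_le)
  qed
  have y_lim: "(\<lambda>d. y d \<alpha>) \<longlonglongrightarrow> moment \<kappa> \<alpha>" for \<alpha>
  proof (rule sdp_optimal_tendsto[OF assms(1,2,4,6,3,5,7,8) feas ge])
    show "moment \<nu> = moment \<kappa>"
      if "\<nu> \<in> finite_borel_measures X" "\<nu> \<le> \<mu>" "\<nu> \<le> scale_measure (ennreal \<gamma>) lam" "moment \<kappa> 0 \<le> moment \<nu> 0" for \<nu>
      using unique[OF that(1-3)] that(4) by (simp add: moment_0 that(1) \<kappa>(1))
  qed
  \<comment> \<open>The linear constraints hold at \<alpha> once \<open>2 * d\<close> reaches its
    degree; before that the entries are zeros of the completion, and limits ignore these finitely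
    many \<open>d\<close>.\<close>
  have eqs: "\<forall>\<^sub>F d in sequentially. moment \<mu> \<alpha> - y d \<alpha> = v d \<alpha>"
    "\<forall>\<^sub>F d in sequentially. \<gamma> * moment lam \<alpha> - y d \<alpha> = u d \<alpha>" for \<alpha>
  proof -
    obtain e where e: "\<alpha> \<in> mindices_le e" using ex_in_mindices_le by blast
    have "y d \<alpha> + v d \<alpha> = moment \<mu> \<alpha> \<and> y d \<alpha> + u d \<alpha> = \<gamma> * moment lam \<alpha>" if "d \<ge> max 1 e" for d
    proof -
      have "\<alpha> \<in> mindices_le (2 * d)" using e mindices_le_mono[of e "2 * d"] that by auto
      then show ?thesis using feas[of d] that by (simp add: sdp_feasible_def)
    qed
    then show "\<forall>\<^sub>F d in sequentially. moment \<mu> \<alpha> - y d \<alpha> = v d \<alpha>"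
      "\<forall>\<^sub>F d in sequentially. \<gamma> * moment lam \<alpha> - y d \<alpha> = u d \<alpha>"
      by (auto intro!: eventually_sequentiallyI[of "max 1 e"] simp: algebra_simps)
  qed
  have v_lim: "(\<lambda>d. v d \<alpha>) \<longlonglongrightarrow> moment \<mu> \<alpha> - moment \<kappa> \<alpha>" for \<alpha>
    by (rule Lim_transform_eventually[OF tendsto_diff[OF tendsto_const y_lim] eqs(1)])
  have u_lim: "(\<lambda>d. u d \<alpha>) \<longlonglongrightarrow> \<gamma> * moment lam \<alpha> - moment \<kappa> \<alpha>" for \<alpha>
    by (rule Lim_transform_eventually[OF tendsto_diff[OF tendsto_const y_lim] eqs(2)])
  have decomposition: "lebesgue_decomposition \<mu> lam \<nu>star (diff_measure \<mu> \<nu>star)"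
  proof -
    have fin_\<nu>star: "finite_measure \<nu>star"
    proof (rule finite_measureI)
      have "emeasure \<nu>star (space lam) = emeasure \<mu> (space lam - N)"
        unfolding \<nu>star_def by (rule fN) simp
      then show "emeasure \<nu>star (space \<nu>star) \<noteq> \<infinity>"
        using finite_measure.emeasure_finite[OF fin(1)] by (simp add: \<nu>star_def)
    qed
    note diff = diff_measure_props[OF fin(1) fin_\<nu>star sets_\<nu>star \<nu>star_le]
    \<comment> \<open>The complement of \<open>N\<close> witnesses singularity: there
      \<open>\<nu>star\<close> already carries all of \<open>\<mu>\<close>, while \<open>N\<close>
      is null for \<open>lam\<close>.\<close>
    define A where "A = space lam - N"
    have A: "A \<in> sets lam" "A - N = A" "space lam - A = N"
      using N(1) sets.sets_into_space[OF N(1)] by (auto simp: A_def)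
    have "emeasure (diff_measure \<mu> \<nu>star) A = emeasure \<mu> A - emeasure \<nu>star A"
      using \<nu>star_le A(1)
      by (intro emeasure_diff_measure fin fin_\<nu>star) (simp_all add: sets_\<nu>star sets_eq le_measure)
    also have "emeasure \<nu>star A = emeasure \<mu> A"
      unfolding \<nu>star_def using fN[OF A(1)] by (simp add: A(2))
    finally have "emeasure (diff_measure \<mu> \<nu>star) A = 0"
      using finite_measure.emeasure_finite[OF fin(1)] by simp
    then have "mutually_singular (diff_measure \<mu> \<nu>star) lam"
      unfolding mutually_singular_def using A N(2) sets_eq by (intro bexI[of _ A]) auto
    moreover have "absolutely_continuous lam \<nu>star"
      unfolding \<nu>star_def by (rule absolutely_continuousI_density) measurable
    ultimately show ?thesis
      using diff(1) by (simp add: lebesgue_decomposition_def sets_\<nu>star)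
  qed
  have esssup_le: "esssup lam (\<lambda>x. ereal \<bar>min \<gamma> (f x)\<bar>) \<le> ereal \<gamma>"
    using f(2) \<open>\<gamma> > 0\<close> by (intro esssup_I) auto
  have min_meas: "(\<lambda>x. min \<gamma> (f x)) \<in> borel_measurable lam" by measurable
  show ?thesis
    by (rule exI[of _ "moment \<kappa>"], rule exI[of _ "\<lambda>\<alpha>. moment \<mu> \<alpha> - moment \<kappa> \<alpha>"],
        rule exI[of _ "\<lambda>\<alpha>. \<gamma> * moment lam \<alpha> - moment \<kappa> \<alpha>"], rule exI[of _ \<kappa>],
        rule exI[of _ \<nu>star], rule exI[of _ f],
        (intro conjI allI impI y_lim v_lim u_lim refl \<kappa>(2) \<kappa>_le \<kappa>_optimal f(1) diff_\<kappa>(1) \<nu>star_def \<kappa>_def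
          decomposition esssup_le min_meas \<kappa>_unique; assumption?),
        simp_all add: f(2) diff_\<kappa>(2) fun_eq_iff)
qed

end
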